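(* Let $D\in L^\infty(\mathbb R)$ be $1$-periodic with $D(y)\ge m$ for all $y\in\mathbb R$ and some constant $m>0$. For $0<\varepsilon<1$ let $\mathcal L_\varepsilon$ be the self-adjoint operator in $L^2(\mathbb R)$ generated by the form $$\varepsilon^{-2}\int_{\mathbb R}D(\tfrac x\varepsilon)\big(u(x+\varepsilon)-u(x)\big)\overline{\big(\tilde u(x+\varepsilon)-\tilde u(x)\big)}\,dx+\int_{\mathbb R}u\,\overline{\tilde u}\,dx,\qquad u,\tilde u\in L^2(\mathbb R),$$ and let $\mathcal L$ be the self-adjoint operator in $L^2(\mathbb R\times\square)$, $\square=[0,1]$, generated by the form $$\int_{\mathbb R}\int_\square D(y)\,\frac{\partial u}{\partial x}(x,y)\,\overline{\frac{\partial\tilde u}{\partial x}(x,y)}\,dy\,dx+\int_{\mathbb R}\int_\square u\,\overline{\tilde u}\,dy\,dx,\qquad u,\tilde u\in H^1(\mathbb R;L^2(\square)).$$ Then for $0<\varepsilon<1$ $$\big\|\mathcal L_\varepsilon^{-1}-\mathcal I_\varepsilon^*\mathcal L^{-1}\mathcal I_\varepsilon\big\|_{L^2(\mathbb R)\to L^2(\mathbb R)}\le C\,\varepsilon$$ for some positive constant $C$ independent of $\varepsilon$. Here $\mathcal I_\varepsilon:L^2(\mathbb R)\to L^2(\mathbb R\times\square)$ is the two-scale interpolation operator defined in the context, which is an $L^2$-isometry, and $\mathcal I_\varepsilon^*$ is its adjoint.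
   Context: $\mathcal I_\varepsilon:=\Gamma_\varepsilon^{-1}\mathcal F^{-1}\chi U\Gamma_\varepsilon$, where $\Gamma_\varepsilon:F(x)\mapsto\varepsilon^{1/2}F(\varepsilon x)$ and $\Gamma_\varepsilon^{-1}:f(x,y)\mapsto\varepsilon^{-1/2}f(x/\varepsilon,y)$; $U:L^2(\mathbb R)\to L^2([-\pi,\pi]\times\square)$ is the unitary Gelfand transform, the continuous extension of $UF(\theta,y)=(2\pi)^{-1/2}\sum_{l\in\mathbb Z}F(y+l)e^{-\mathrm i\theta(y+l)}$, $F\in C_0^\infty(\mathbb R)$; $\chi$ is extension by zero outside $[-\pi,\pi]$ in the first variable; $\mathcal F$ is the unitary Fourier transform in the first variable (kernel $(2\pi)^{-1/2}e^{-\mathrm ix\xi}$). Explicitly, $\mathcal I_\varepsilon$ is the continuous extension of $(\mathcal I_\varepsilon F)(x,y)=\sum_{l\in\mathbb Z}F(\varepsilon y+\varepsilon l)\,\mathrm{Sinc}(\frac x\varepsilon-l-y)$, $F\in C_0^\infty(\mathbb R)$, and $\mathcal I_\varepsilon^*$ is the continuous extension of $\mathcal I_\varepsilon^*u_0(x)=\varepsilon^{-1}\int_{\mathbb R}u_0(s,\{\frac x\varepsilon\})\,\mathrm{Sinc}(\frac{x-s}\varepsilon)\,ds$, where $\mathrm{Sinc}(t)=\frac{\sin\pi t}{\pi t}$ ($\mathrm{Sinc}(0)=1$) and $\{p\}\in[0,1)$ is the fractional part of $p$. *)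

theory Defs
  imports "HOL-Analysis.Analysis"
begin

text \<open>
  Elements of L2 are represented by Borel functions, not by their classes modulo null sets.
  A linear operator, possibly unbounded or densely defined, is represented by its graph, a
  relation between representatives. Inverses are converses (\<open>r\<inverse>\<close>) and products are relational
  compositions (\<open>r O s\<close> applies \<open>r\<close> first). The graphs \<open>gelfand\<close>, \<open>fourier\<close>, \<open>interp \<epsilon>\<close>,
  \<open>interp_adj \<epsilon>\<close>, \<open>op_eps D \<epsilon>\<close>, \<open>op_hom D\<close> below (with \<open>\<epsilon> > 0\<close>) are closed under changing either
  component on a null set, so they are determined by the corresponding operators on classes.
\<close>

section \<open>L2 spaces and operators\<close>

definition L2 :: "'a measure \<Rightarrow> ('a \<Rightarrow> complex) set" where
  "L2 M = {f \<in> borel_measurable M. integrable M (\<lambda>x. (cmod (f x))\<^sup>2)}"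

definition l2_inner :: "'a measure \<Rightarrow> ('a \<Rightarrow> complex) \<Rightarrow> ('a \<Rightarrow> complex) \<Rightarrow> complex" where
  "l2_inner M f g = (LINT x|M. f x * cnj (g x))"

definition l2_norm :: "'a measure \<Rightarrow> ('a \<Rightarrow> complex) \<Rightarrow> real" where
  "l2_norm M f = sqrt (LINT x|M. (cmod (f x))\<^sup>2)"

type_synonym ('a, 'b) l2_op = "(('a \<Rightarrow> complex) \<times> ('b \<Rightarrow> complex)) set"

text \<open>
  Closure of a graph. For a bounded operator given on a dense subspace this is (the graph of)
  its continuous extension.
\<close>
definition l2_closure :: "'a measure \<Rightarrow> 'b measure \<Rightarrow> ('a, 'b) l2_op \<Rightarrow> ('a, 'b) l2_op" where
  "l2_closure M N T =
    {(f, g). f \<in> L2 M \<and> g \<in> L2 N \<and>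
       (\<exists>s t. (\<forall>n. (s n, t n) \<in> T \<and> s n \<in> L2 M \<and> t n \<in> L2 N) \<and>
              (\<lambda>n. l2_norm M (\<lambda>x. s n x - f x)) \<longlonglongrightarrow> 0 \<and>
              (\<lambda>n. l2_norm N (\<lambda>x. t n x - g x)) \<longlonglongrightarrow> 0)}"

definition l2_adjoint :: "'a measure \<Rightarrow> 'b measure \<Rightarrow> ('a, 'b) l2_op \<Rightarrow> ('b, 'a) l2_op" where
  "l2_adjoint M N T =
    {(u, f). u \<in> L2 N \<and> f \<in> L2 M \<and> (\<forall>(g, v) \<in> T. l2_inner N v u = l2_inner M g f)}"

definition op_diff :: "('a, 'b) l2_op \<Rightarrow> ('a, 'b) l2_op \<Rightarrow> ('a, 'b) l2_op" where
  "op_diff S T = {(f, \<lambda>x. g x - h x) | f g h. (f, g) \<in> S \<and> (f, h) \<in> T}"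

text \<open>
  The operator norm is \<open>\<infinity>\<close> unless the operator is defined on the whole space. For a linear
  relation a finite value also forces single-valuedness up to null sets: the relation would
  otherwise contain pairs \<open>(0, c g)\<close> with \<open>g\<close> nonzero and \<open>c\<close> arbitrary.
\<close>
definition l2_opnorm :: "'a measure \<Rightarrow> 'b measure \<Rightarrow> ('a, 'b) l2_op \<Rightarrow> ennreal" where
  "l2_opnorm M N T =
    (if Domain T = L2 M \<and> Range T \<subseteq> L2 N
     then (SUP (f, g) \<in> {(f, g) \<in> T. l2_norm M f \<le> 1}. ennreal (l2_norm N g))
     else \<infinity>)"

text \<open>
  The operator generated by a form \<open>a\<close> with form domain \<open>V\<close>, as in the first representation
  theorem: \<open>u\<close> is in the operator domain and is mapped to \<open>f\<close> iff \<open>a(u,v) = \<langle>f,v\<rangle>\<close> for all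
  \<open>v\<close> in \<open>V\<close>.
\<close>
definition form_op :: "'a measure \<Rightarrow> ('a \<Rightarrow> complex) set \<Rightarrow>
    (('a \<Rightarrow> complex) \<Rightarrow> ('a \<Rightarrow> complex) \<Rightarrow> complex) \<Rightarrow> ('a, 'a) l2_op" where
  "form_op M V a = {(u, f). u \<in> V \<and> f \<in> L2 M \<and> (\<forall>v\<in>V. a u v = l2_inner M f v)}"

section \<open>The underlying measure spaces and test functions\<close>

abbreviation unit_M :: "real measure" where
  "unit_M \<equiv> restrict_space lborel {0..1}"

abbreviation strip_M :: "(real \<times> real) measure" where
  "strip_M \<equiv> lborel \<Otimes>\<^sub>M unit_M"

abbreviation zone_M :: "(real \<times> real) measure" where
  "zone_M \<equiv> restrict_space lborel {-pi..pi} \<Otimes>\<^sub>M unit_M"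

definition test_funs :: "(real \<Rightarrow> complex) set" where
  "test_funs = {\<phi>. compact (closure {x. \<phi> x \<noteq> 0}) \<and>
     (\<exists>d. d 0 = \<phi> \<and> (\<forall>n x. (d n has_vector_derivative d (Suc n) x) (at x)))}"

section \<open>The two-scale interpolation operator\<close>

definition scaling :: "real \<Rightarrow> (real \<Rightarrow> complex) \<Rightarrow> real \<Rightarrow> complex" where
  "scaling \<epsilon> F = (\<lambda>x. of_real (sqrt \<epsilon>) * F (\<epsilon> * x))"

definition unscaling :: "real \<Rightarrow> (real \<times> real \<Rightarrow> complex) \<Rightarrow> real \<times> real \<Rightarrow> complex" where
  "unscaling \<epsilon> f = (\<lambda>(x, y). of_real (1 / sqrt \<epsilon>) * f (x / \<epsilon>, y))"

definition gelfand :: "(real, real \<times> real) l2_op" where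
  "gelfand = l2_closure lborel zone_M
    {(F, \<lambda>(\<theta>, y). of_real (1 / sqrt (2 * pi)) *
           (\<Sum>\<^sub>\<infinity>l\<in>(UNIV :: int set). F (y + of_int l) * cis (- (\<theta> * (y + of_int l))))) |
     F. F \<in> test_funs}"

definition ext_zero :: "(real \<times> real \<Rightarrow> complex) \<Rightarrow> real \<times> real \<Rightarrow> complex" where
  "ext_zero g = (\<lambda>(\<theta>, y). if \<theta> \<in> {-pi..pi} then g (\<theta>, y) else 0)"

text \<open>
  The Fourier transform in the first variable is extended from the intersection of L1 and L2.
\<close>
definition fourier :: "(real \<times> real, real \<times> real) l2_op" where
  "fourier = l2_closure strip_M strip_M
    {(u, \<lambda>(\<xi>, y). of_real (1 / sqrt (2 * pi)) * (LINT x|lborel. u (x, y) * cis (- (x * \<xi>)))) |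
     u. u \<in> L2 strip_M \<and> integrable strip_M u}"

definition interp :: "real \<Rightarrow> (real, real \<times> real) l2_op" where
  "interp \<epsilon> = {(F, unscaling \<epsilon> h) | F g h.
     F \<in> L2 lborel \<and> (scaling \<epsilon> F, g) \<in> gelfand \<and> (ext_zero g, h) \<in> fourier\<inverse>}"

definition interp_adj :: "real \<Rightarrow> (real \<times> real, real) l2_op" where
  "interp_adj \<epsilon> = l2_adjoint lborel strip_M (interp \<epsilon>)"

section \<open>The two operators\<close>

text \<open>
  The integrals involving \<open>D\<close> are taken over the completed measures because \<open>D\<close> is only
  assumed to be Lebesgue measurable.
\<close>
definition form_eps :: "(real \<Rightarrow> real) \<Rightarrow> real \<Rightarrow> (real \<Rightarrow> complex) \<Rightarrow> (real \<Rightarrow> complex) \<Rightarrow> complex" where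
  "form_eps D \<epsilon> u v =
     of_real (1 / \<epsilon>\<^sup>2) *
       (LINT x|lebesgue. of_real (D (x / \<epsilon>)) * (u (x + \<epsilon>) - u x) * cnj (v (x + \<epsilon>) - v x))
     + (LINT x|lborel. u x * cnj (v x))"

definition op_eps :: "(real \<Rightarrow> real) \<Rightarrow> real \<Rightarrow> (real, real) l2_op" where
  "op_eps D \<epsilon> = form_op lborel (L2 lborel) (form_eps D \<epsilon>)"

text \<open>
  Weak derivative in \<open>x\<close> of \<open>u \<in> L2(R; L2([0,1]))\<close>. The defining identity between
  \<open>L2([0,1])\<close>-valued integrals is written out pointwise for almost every \<open>y\<close>, where the
  exceptional set may depend on the scalar test function.
\<close>
definition is_weak_dx :: "(real \<times> real \<Rightarrow> complex) \<Rightarrow> (real \<times> real \<Rightarrow> complex) \<Rightarrow> bool" where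
  "is_weak_dx u w \<longleftrightarrow> w \<in> L2 strip_M \<and>
     (\<forall>\<phi>\<in>test_funs. AE y in unit_M.
        (LINT x|lborel. vector_derivative \<phi> (at x) * u (x, y)) =
        - (LINT x|lborel. \<phi> x * w (x, y)))"

definition weak_dx :: "(real \<times> real \<Rightarrow> complex) \<Rightarrow> real \<times> real \<Rightarrow> complex" where
  "weak_dx u = (SOME w. is_weak_dx u w)"

definition H1 :: "(real \<times> real \<Rightarrow> complex) set" where
  "H1 = {u \<in> L2 strip_M. \<exists>w. is_weak_dx u w}"

definition form_hom ::
    "(real \<Rightarrow> real) \<Rightarrow> (real \<times> real \<Rightarrow> complex) \<Rightarrow> (real \<times> real \<Rightarrow> complex) \<Rightarrow> complex" where
  "form_hom D u v =
     (LINT z|completion strip_M. of_real (D (snd z)) * weak_dx u z * cnj (weak_dx v z))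
     + (LINT z|strip_M. u z * cnj (v z))"

definition op_hom :: "(real \<Rightarrow> real) \<Rightarrow> (real \<times> real, real \<times> real) l2_op" where
  "op_hom D = form_op strip_M H1 (form_hom D)"

end

theory Submission
  imports Defs "HOL-Probability.Characteristic_Functions"
begin

text \<open>
  Since \<open>D\<close> is 1-periodic, \<open>D (x / \<epsilon>)\<close> does not change under the shift by \<open>\<epsilon>\<close>, so the rescaled Gelfand
  transform turns \<open>L\<^sub>\<epsilon>\<close> into multiplication by \<open>1 + D(y) (2 - 2 cos \<theta>) / \<epsilon>\<^sup>2\<close>, while the Fourier
  transform in \<open>x\<close> turns \<open>L\<close> into multiplication by \<open>1 + D(y) \<xi>\<^sup>2\<close>. The interpolation operator
  identifies \<open>\<xi>\<close> with \<open>\<theta> / \<epsilon>\<close> for \<open>|\<theta>| \<le> \<pi>\<close>, hence the difference of the resolvents is bounded by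
  the supremum of the difference of the two inverse symbols. As \<open>\<theta>\<^sup>2 - (2 - 2 cos \<theta>)\<close> is at most
  a constant times \<open>\<theta>\<^sup>2 (2 - 2 cos \<theta>)\<close> there, this is of order \<open>\<epsilon>\<^sup>2\<close>.
\<close>

section \<open>The space L2\<close>

text \<open>Operators are relations between representatives, so each needs two facts: an explicit
  solution exists, and any two functions related to the same datum agree outside a null set.
  Existence makes the domain all of L2; uniqueness turns the operator norm, a supremum over all
  related pairs, into an estimate for the explicit pair. The explicit formulas go through adjoints:
  \<open>gelfand_adj\<close> and \<open>ift\<close> are genuine integrals for frequencies in
  [-pi, pi], whereas \<open>gelfand\<close> and \<open>fourier\<close> are closures, known only
  through approximating sequences. Duality matches the closures to the integrals. Multiplication by
  a bounded symbol keeps the frequency support, so symbols can be applied before the adjoint. The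
  coefficient is only Lebesgue measurable and bounded almost everywhere; it is replaced by a Borel
  function with pointwise bounds and exact period. In C = 3 / (4 m) the factor 3/4 is 9/12: 1/12
  comes from the quartic bound for t^2 - (2 - 2 cos t), and 9 bounds the ratio of t^2 to 2 - 2 cos t
  on [-pi, pi].\<close>

lemma L2_measurable: "f \<in> L2 M \<Longrightarrow> f \<in> borel_measurable M"
  by (simp add: L2_def)

lemma L2_integrable: "f \<in> L2 M \<Longrightarrow> integrable M (\<lambda>x. (cmod (f x))\<^sup>2)"
  by (simp add: L2_def)

lemma L2_iff_nn_integral:
  "f \<in> L2 M \<longleftrightarrow> f \<in> borel_measurable M \<and> (\<integral>\<^sup>+x. ennreal ((cmod (f x))\<^sup>2) \<partial>M) < \<infinity>"
  unfolding L2_def by (auto simp: integrable_iff_bounded)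

lemma l2_norm_nonneg [simp]: "0 \<le> l2_norm M f"
  by (simp add: l2_norm_def)

lemma l2_norm_sq: "(l2_norm M f)\<^sup>2 = (LINT x|M. (cmod (f x))\<^sup>2)"
  by (simp add: l2_norm_def)

lemma nn_integral_L2: "f \<in> L2 M \<Longrightarrow> (\<integral>\<^sup>+x. ennreal ((cmod (f x))\<^sup>2) \<partial>M) = ennreal ((l2_norm M f)\<^sup>2)"
  unfolding l2_norm_sq by (rule nn_integral_eq_integral) (auto simp: L2_integrable)

lemma L2_bound:
  assumes "f \<in> borel_measurable M" "g \<in> L2 M" "AE x in M. cmod (f x) \<le> c * cmod (g x)"
  shows "f \<in> L2 M"
proof -
  have "integrable M (\<lambda>x. (cmod (f x))\<^sup>2)"
  proof (rule Bochner_Integration.integrable_bound)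
    show "integrable M (\<lambda>x. c\<^sup>2 * (cmod (g x))\<^sup>2)"
      using L2_integrable[OF assms(2)] by simp
    show "AE x in M. norm ((cmod (f x))\<^sup>2) \<le> norm (c\<^sup>2 * (cmod (g x))\<^sup>2)"
      using assms(3)
    proof eventually_elim
      case (elim x)
      then have "(cmod (f x))\<^sup>2 \<le> (c * cmod (g x))\<^sup>2" by (intro power_mono) auto
      then show ?case by (simp add: power_mult_distrib)
    qed
  qed (use assms(1) in auto)
  then show ?thesis using assms(1) by (simp add: L2_def)
qed

lemma l2_norm_bound:
  assumes "f \<in> borel_measurable M" "g \<in> L2 M" "AE x in M. cmod (f x) \<le> c * cmod (g x)" "0 \<le> c"
  shows "l2_norm M f \<le> c * l2_norm M g"
proof -
  have "(LINT x|M. (cmod (f x))\<^sup>2) \<le> (LINT x|M. c\<^sup>2 * (cmod (g x))\<^sup>2)"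
  proof (rule integral_mono_AE)
    show "integrable M (\<lambda>x. (cmod (f x))\<^sup>2)" using L2_bound[OF assms(1-3)] L2_integrable by blast
    show "integrable M (\<lambda>x. c\<^sup>2 * (cmod (g x))\<^sup>2)"
      using L2_integrable[OF assms(2)] by simp
    show "AE x in M. ((cmod (f x))\<^sup>2) \<le> (c\<^sup>2 * (cmod (g x))\<^sup>2)"
      using assms(3)
    proof eventually_elim
      case (elim x)
      then have "(cmod (f x))\<^sup>2 \<le> (c * cmod (g x))\<^sup>2" by (intro power_mono) auto
      then show ?case by (simp add: power_mult_distrib)
    qed
  qed
  then have "(l2_norm M f)\<^sup>2 \<le> (c * l2_norm M g)\<^sup>2"
    by (simp add: l2_norm_sq power_mult_distrib)
  then show ?thesis using assms(4) by (meson l2_norm_nonneg mult_nonneg_nonneg power2_le_imp_le)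
qed

lemma L2_mult_bounded:
  assumes "f \<in> L2 M" "a \<in> borel_measurable M" "\<And>x. cmod (a x) \<le> c"
  shows "(\<lambda>x. a x * f x) \<in> L2 M"
  using L2_measurable[OF assms(1)] assms(2)
  by (intro L2_bound[OF _ assms(1), of _ c]) (auto simp: norm_mult intro!: mult_right_mono assms(3))

lemma L2_cmult: "f \<in> L2 M \<Longrightarrow> (\<lambda>x. c * f x) \<in> L2 M"
  by (rule L2_mult_bounded[where c = "cmod c"]) auto

lemma borel_measurable_cnj [measurable (raw)]:
  "f \<in> borel_measurable M \<Longrightarrow> (\<lambda>x. cnj (f x)) \<in> borel_measurable M"
  by (rule measurable_compose[OF _ borel_measurable_continuous_onI]) (auto intro: continuous_intros)

lemma borel_measurable_cis [measurable (raw)]: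
  "f \<in> borel_measurable M \<Longrightarrow> (\<lambda>x. cis (f x)) \<in> borel_measurable M"
  by (rule measurable_compose[OF _ borel_measurable_continuous_onI]) (auto intro: continuous_intros)

lemma L2_cnj: "f \<in> L2 M \<Longrightarrow> (\<lambda>x. cnj (f x)) \<in> L2 M"
  unfolding L2_def by auto

lemma L2_add:
  assumes "f \<in> L2 M" "g \<in> L2 M"
  shows "(\<lambda>x. f x + g x) \<in> L2 M"
proof -
  have "integrable M (\<lambda>x. (cmod (f x + g x))\<^sup>2)"
  proof (rule Bochner_Integration.integrable_bound)
    show "integrable M (\<lambda>x. 2 * (cmod (f x))\<^sup>2 + 2 * (cmod (g x))\<^sup>2)"
      using assms by (simp add: L2_integrable)
    have "(cmod (f x + g x))\<^sup>2 \<le> 2 * (cmod (f x))\<^sup>2 + 2 * (cmod (g x))\<^sup>2" for x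
    proof -
      have "(cmod (f x + g x))\<^sup>2 \<le> (cmod (f x) + cmod (g x))\<^sup>2"
        by (intro power_mono norm_triangle_ineq) auto
      also have "\<dots> \<le> 2 * (cmod (f x))\<^sup>2 + 2 * (cmod (g x))\<^sup>2"
        using sum_squares_bound[of "cmod (f x)" "cmod (g x)"] by (simp add: power2_sum)
      finally show ?thesis .
    qed
    then show "AE x in M. norm ((cmod (f x + g x))\<^sup>2) \<le> norm (2 * (cmod (f x))\<^sup>2 + 2 * (cmod (g x))\<^sup>2)"
      by simp
  qed (use assms[THEN L2_measurable] in auto)
  then show ?thesis using assms[THEN L2_measurable] by (simp add: L2_def)
qed

lemma L2_minus:
  assumes "f \<in> L2 M" shows "(\<lambda>x. - f x) \<in> L2 M"
  using L2_cmult[OF assms, of "-1"] by simp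

lemma L2_diff:
  assumes "f \<in> L2 M" "g \<in> L2 M" shows "(\<lambda>x. f x - g x) \<in> L2 M"
  using L2_add[OF assms(1) L2_minus[OF assms(2)]] by simp

lemma L2_zero [simp]: "(\<lambda>x. 0) \<in> L2 M"
  by (simp add: L2_def)

lemma L2_sum: "(\<And>i. i \<in> I \<Longrightarrow> f i \<in> L2 M) \<Longrightarrow> (\<lambda>x. \<Sum>i\<in>I. f i x) \<in> L2 M"
  by (induction I rule: infinite_finite_induct) (auto intro: L2_add)

lemma L2_AE_cong:
  assumes "f \<in> L2 M" "g \<in> borel_measurable M" "AE x in M. f x = g x"
  shows "g \<in> L2 M"
  using assms by (intro L2_bound[OF assms(2,1), of 1]) auto

lemma L2_indicator:
  assumes "A \<in> sets M" "emeasure M A < \<infinity>"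
  shows "(indicator A :: _ \<Rightarrow> complex) \<in> L2 M"
proof -
  have "(cmod (indicator A x))\<^sup>2 = indicator A x" for x
    by (auto simp: indicator_def)
  then show ?thesis using assms by (auto simp: L2_def)
qed

lemma l2_norm_AE_cong:
  assumes "f \<in> borel_measurable M" "g \<in> borel_measurable M" "AE x in M. f x = g x"
  shows "l2_norm M f = l2_norm M g"
  unfolding l2_norm_def using assms by (intro arg_cong[where f = sqrt] integral_cong_AE) auto

lemma l2_inner_AE_cong:
  assumes [measurable]: "f \<in> borel_measurable M" "f' \<in> borel_measurable M"
    "g \<in> borel_measurable M" "g' \<in> borel_measurable M"
    and "AE x in M. f x = f' x" "AE x in M. g x = g' x"
  shows "l2_inner M f g = l2_inner M f' g'"
  unfolding l2_inner_def using assms(5,6) by (intro integral_cong_AE) auto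

lemma l2_norm_zero_iff:
  assumes "f \<in> L2 M"
  shows "l2_norm M f = 0 \<longleftrightarrow> (AE x in M. f x = 0)"
  using integral_nonneg_eq_0_iff_AE[OF L2_integrable[OF assms]] by (simp add: l2_norm_def)

lemma l2_norm_cmult: "l2_norm M (\<lambda>x. c * f x) = cmod c * l2_norm M f"
  by (simp add: l2_norm_def norm_mult power_mult_distrib real_sqrt_mult)

lemma l2_norm_diff_commute: "l2_norm M (\<lambda>x. f x - g x) = l2_norm M (\<lambda>x. g x - f x)"
  by (simp add: l2_norm_def norm_minus_commute)

section \<open>Inner product, Cauchy-Schwarz inequality and convergence in L2\<close>

lemma integrable_L2_mult:
  assumes "f \<in> L2 M" "g \<in> L2 M"
  shows "integrable M (\<lambda>x. f x * g x)"
proof (rule Bochner_Integration.integrable_bound)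
  show "integrable M (\<lambda>x. (cmod (f x))\<^sup>2 + (cmod (g x))\<^sup>2)"
    using assms by (simp add: L2_integrable)
  have "cmod (f x) * cmod (g x) \<le> (cmod (f x))\<^sup>2 + (cmod (g x))\<^sup>2" for x
    using sum_squares_bound[of "cmod (f x)" "cmod (g x)"]
      mult_nonneg_nonneg[OF norm_ge_zero norm_ge_zero, of "f x" "g x"] by linarith
  then show "AE x in M. norm (f x * g x) \<le> norm ((cmod (f x))\<^sup>2 + (cmod (g x))\<^sup>2)"
    by (simp add: norm_mult)
qed (use assms[THEN L2_measurable] in auto)

lemma integrable_L2_cnj: "f \<in> L2 M \<Longrightarrow> g \<in> L2 M \<Longrightarrow> integrable M (\<lambda>x. f x * cnj (g x))"
  by (intro integrable_L2_mult L2_cnj)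

lemma l2_inner_add_left:
  assumes "f \<in> L2 M" "g \<in> L2 M" "h \<in> L2 M"
  shows "l2_inner M (\<lambda>x. f x + g x) h = l2_inner M f h + l2_inner M g h"
  unfolding l2_inner_def using assms
  by (simp add: ring_distribs integrable_L2_cnj)

lemma l2_inner_add_right:
  assumes "f \<in> L2 M" "g \<in> L2 M" "h \<in> L2 M"
  shows "l2_inner M h (\<lambda>x. f x + g x) = l2_inner M h f + l2_inner M h g"
  unfolding l2_inner_def using assms
  by (simp add: ring_distribs integrable_L2_cnj)

lemma l2_inner_cmult_left: "l2_inner M (\<lambda>x. c * f x) h = c * l2_inner M f h"
  by (simp add: l2_inner_def mult.assoc)

lemma l2_inner_cmult_right: "l2_inner M h (\<lambda>x. c * f x) = cnj c * l2_inner M h f"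
  by (simp add: l2_inner_def mult.left_commute)

lemma l2_inner_diff_left:
  assumes "f \<in> L2 M" "g \<in> L2 M" "h \<in> L2 M"
  shows "l2_inner M (\<lambda>x. f x - g x) h = l2_inner M f h - l2_inner M g h"
  unfolding l2_inner_def using assms
  by (simp add: ring_distribs integrable_L2_cnj)

lemma l2_inner_diff_right:
  assumes "f \<in> L2 M" "g \<in> L2 M" "h \<in> L2 M"
  shows "l2_inner M h (\<lambda>x. f x - g x) = l2_inner M h f - l2_inner M h g"
  unfolding l2_inner_def using assms
  by (simp add: ring_distribs integrable_L2_cnj)

lemma l2_inner_commute: "l2_inner M f g = cnj (l2_inner M g f)"
  unfolding l2_inner_def by (subst Bochner_Integration.integral_cnj[symmetric]) (simp add: mult.commute)

lemma l2_inner_self: "l2_inner M f f = of_real ((l2_norm M f)\<^sup>2)"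
  unfolding l2_inner_def l2_norm_sq integral_complex_of_real[symmetric]
  by (simp add: complex_norm_square del: of_real_power)

lemma integral_cmod_mult_le:
  assumes "f \<in> L2 M" "g \<in> L2 M"
  shows "(LINT x|M. cmod (f x) * cmod (g x)) \<le> l2_norm M f * l2_norm M g"
proof -
  let ?I = "LINT x|M. cmod (f x) * cmod (g x)"
  let ?A = "l2_norm M f" and ?B = "l2_norm M g"
  have int: "integrable M (\<lambda>x. cmod (f x) * cmod (g x))"
    using integrable_norm[OF integrable_L2_mult[OF assms]] by (simp add: norm_mult)
  have I: "2 * ?I \<le> t * ?A\<^sup>2 + ?B\<^sup>2 / t" if "t > 0" for t :: real
  proof -
    have "2 * ?I = (LINT x|M. 2 * (cmod (f x) * cmod (g x)))" by simp
    also have "\<dots> \<le> (LINT x|M. t * (cmod (f x))\<^sup>2 + (cmod (g x))\<^sup>2 / t)"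
    proof (rule integral_mono)
      fix x
      have "0 \<le> (t * cmod (f x) - cmod (g x))\<^sup>2 / t" using that by simp
      also have "\<dots> = t * (cmod (f x))\<^sup>2 + (cmod (g x))\<^sup>2 / t - 2 * (cmod (f x) * cmod (g x))"
        using that by (simp add: power2_eq_square field_simps)
      finally show "2 * (cmod (f x) * cmod (g x)) \<le> t * (cmod (f x))\<^sup>2 + (cmod (g x))\<^sup>2 / t" by simp
    qed (use int assms in \<open>auto simp: L2_integrable\<close>)
    also have "\<dots> = t * ?A\<^sup>2 + ?B\<^sup>2 / t"
      using assms by (simp add: l2_norm_sq L2_integrable)
    finally show ?thesis .
  qed
  consider "?A = 0" | "?B = 0" | "?A > 0" "?B > 0"
    using l2_norm_nonneg[of M f] l2_norm_nonneg[of M g] by linarith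
  then show ?thesis
  proof cases
    case 1
    then have "AE x in M. f x = 0" using l2_norm_zero_iff assms by blast
    then have "?I = (LINT x|M. 0)"
      using assms[THEN L2_measurable] by (intro integral_cong_AE) auto
    then show ?thesis using 1 by simp
  next
    case 2
    then have "AE x in M. g x = 0" using l2_norm_zero_iff assms by blast
    then have "?I = (LINT x|M. 0)"
      using assms[THEN L2_measurable] by (intro integral_cong_AE) auto
    then show ?thesis using 2 by simp
  next
    case 3
    then show ?thesis using I[of "?B / ?A"] by (simp add: power2_eq_square field_simps)
  qed
qed

lemma l2_Cauchy_Schwarz:
  assumes "f \<in> L2 M" "g \<in> L2 M"
  shows "cmod (l2_inner M f g) \<le> l2_norm M f * l2_norm M g"
proof -
  have "cmod (l2_inner M f g) \<le> (LINT x|M. cmod (f x * cnj (g x)))"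
    unfolding l2_inner_def by (rule integral_norm_bound)
  also have "\<dots> \<le> l2_norm M f * l2_norm M g"
    using integral_cmod_mult_le[OF assms] by (simp add: norm_mult)
  finally show ?thesis .
qed

lemma l2_norm_triangle:
  assumes "f \<in> L2 M" "g \<in> L2 M"
  shows "l2_norm M (\<lambda>x. f x + g x) \<le> l2_norm M f + l2_norm M g"
proof (rule power2_le_imp_le)
  let ?s = "\<lambda>x. f x + g x"
  have "of_real ((l2_norm M ?s)\<^sup>2) = l2_inner M ?s ?s" by (simp add: l2_inner_self)
  also have "\<dots> = l2_inner M f f + l2_inner M f g + (l2_inner M g f + l2_inner M g g)"
    using assms by (simp add: l2_inner_add_left l2_inner_add_right L2_add)
  finally have "(l2_norm M ?s)\<^sup>2 =
      (l2_norm M f)\<^sup>2 + Re (l2_inner M f g) + (Re (l2_inner M g f) + (l2_norm M g)\<^sup>2)"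
    by (metis Re_complex_of_real l2_inner_self plus_complex.sel(1))
  also have "\<dots> \<le> (l2_norm M f)\<^sup>2 + l2_norm M f * l2_norm M g +
      (l2_norm M f * l2_norm M g + (l2_norm M g)\<^sup>2)"
    using order_trans[OF complex_Re_le_cmod l2_Cauchy_Schwarz[OF assms]]
      order_trans[OF complex_Re_le_cmod l2_Cauchy_Schwarz[OF assms(2,1)]]
    by (intro add_mono) (auto simp: mult.commute)
  finally show "(l2_norm M ?s)\<^sup>2 \<le> (l2_norm M f + l2_norm M g)\<^sup>2"
    by (simp add: power2_eq_square algebra_simps)
qed simp

lemma l2_norm_triangle_diff:
  assumes "f \<in> L2 M" "g \<in> L2 M" "h \<in> L2 M"
  shows "l2_norm M (\<lambda>x. f x - h x) \<le> l2_norm M (\<lambda>x. f x - g x) + l2_norm M (\<lambda>x. g x - h x)"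
  using l2_norm_triangle[OF L2_diff[OF assms(1,2)] L2_diff[OF assms(2,3)]] by simp

lemma l2_norm_diff_abs:
  assumes "f \<in> L2 M" "g \<in> L2 M"
  shows "\<bar>l2_norm M f - l2_norm M g\<bar> \<le> l2_norm M (\<lambda>x. f x - g x)"
  using l2_norm_triangle[OF L2_diff[OF assms] assms(2)]
    l2_norm_triangle[OF L2_diff[OF assms(2,1)] assms(1)]
  by (simp add: l2_norm_diff_commute[of M g f])

lemma l2_inner_tendsto:
  assumes "\<And>n. s n \<in> L2 M" "f \<in> L2 M" "(\<lambda>n. l2_norm M (\<lambda>x. s n x - f x)) \<longlonglongrightarrow> 0" "g \<in> L2 M"
  shows "(\<lambda>n. l2_inner M (s n) g) \<longlonglongrightarrow> l2_inner M f g"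
proof (rule LIM_zero_cancel, rule Lim_null_comparison)
  show "\<forall>\<^sub>F n in sequentially. norm (l2_inner M (s n) g - l2_inner M f g)
      \<le> l2_norm M (\<lambda>x. s n x - f x) * l2_norm M g"
    using assms l2_Cauchy_Schwarz[OF L2_diff[OF assms(1,2)] assms(4)]
    by (simp add: l2_inner_diff_left)
  show "(\<lambda>n. l2_norm M (\<lambda>x. s n x - f x) * l2_norm M g) \<longlonglongrightarrow> 0"
    using tendsto_mult_right[OF assms(3), of "l2_norm M g"] by simp
qed

lemma l2_inner_tendsto_right:
  assumes "\<And>n. s n \<in> L2 M" "f \<in> L2 M" "(\<lambda>n. l2_norm M (\<lambda>x. s n x - f x)) \<longlonglongrightarrow> 0" "g \<in> L2 M"
  shows "(\<lambda>n. l2_inner M g (s n)) \<longlonglongrightarrow> l2_inner M g f"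
  using tendsto_cnj[OF l2_inner_tendsto[OF assms]] by (subst (1 2) l2_inner_commute)

lemma l2_lim_unique:
  assumes "\<And>n. s n \<in> L2 M" "f \<in> L2 M" "(\<lambda>n. l2_norm M (\<lambda>x. s n x - f x)) \<longlonglongrightarrow> 0"
    "g \<in> L2 M" "(\<lambda>n. l2_norm M (\<lambda>x. s n x - g x)) \<longlonglongrightarrow> 0"
  shows "AE x in M. f x = g x"
proof -
  have "(\<lambda>n. l2_norm M (\<lambda>x. s n x - f x) + l2_norm M (\<lambda>x. s n x - g x)) \<longlonglongrightarrow> 0"
    using tendsto_add[OF assms(3,5)] by simp
  moreover have "l2_norm M (\<lambda>x. f x - g x) \<le> l2_norm M (\<lambda>x. s n x - f x) + l2_norm M (\<lambda>x. s n x - g x)" for n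
    using l2_norm_triangle_diff[OF assms(2,1,4)] by (simp add: l2_norm_diff_commute[of M f])
  ultimately have "l2_norm M (\<lambda>x. f x - g x) \<le> 0"
    by (intro tendsto_lowerbound) auto
  then have "l2_norm M (\<lambda>x. f x - g x) = 0" using l2_norm_nonneg by (metis order_antisym)
  then show ?thesis using l2_norm_zero_iff[OF L2_diff[OF assms(2,4)]] by simp
qed

lemma l2_norm_dominated_convergence:
  assumes s: "\<And>n. s n \<in> borel_measurable M" and f: "f \<in> borel_measurable M" and b: "b \<in> L2 M"
    and lim: "AE x in M. (\<lambda>n. s n x) \<longlonglongrightarrow> f x"
    and bound: "\<And>n. AE x in M. cmod (s n x - f x) \<le> c * cmod (b x)"
  shows "(\<lambda>n. l2_norm M (\<lambda>x. s n x - f x)) \<longlonglongrightarrow> 0"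
proof -
  have "(\<lambda>n. LINT x|M. (cmod (s n x - f x))\<^sup>2) \<longlonglongrightarrow> (LINT x|M. 0)"
  proof (rule integral_dominated_convergence)
    show "integrable M (\<lambda>x. c\<^sup>2 * (cmod (b x))\<^sup>2)"
      using L2_integrable[OF b] by simp
    show "AE x in M. (\<lambda>n. (cmod (s n x - f x))\<^sup>2) \<longlonglongrightarrow> 0"
      using lim by eventually_elim (auto simp: LIM_zero intro!: tendsto_eq_intros)
    show "AE x in M. norm ((cmod (s n x - f x))\<^sup>2) \<le> c\<^sup>2 * (cmod (b x))\<^sup>2" for n
      using bound[of n]
    proof eventually_elim
      case (elim x)
      then have "(cmod (s n x - f x))\<^sup>2 \<le> (c * cmod (b x))\<^sup>2" by (intro power_mono) auto
      then show ?case by (simp add: power_mult_distrib)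
    qed
  qed (use s f in auto)
  then show ?thesis unfolding l2_norm_def by (auto intro: tendsto_eq_intros)
qed

lemma l2_Cauchy:
  assumes "\<And>n. s n \<in> L2 M" "f \<in> L2 M" "(\<lambda>n. l2_norm M (\<lambda>x. s n x - f x)) \<longlonglongrightarrow> 0" "e > 0"
  shows "\<exists>N. \<forall>m\<ge>N. \<forall>n\<ge>N. l2_norm M (\<lambda>x. s m x - s n x) < e"
proof -
  obtain N where N: "\<forall>n\<ge>N. l2_norm M (\<lambda>x. s n x - f x) < e / 2"
    using LIMSEQ_D[OF assms(3), of "e/2"] assms(4) by auto
  have "l2_norm M (\<lambda>x. s m x - s n x) < e" if "m \<ge> N" "n \<ge> N" for m n
  proof -
    have "l2_norm M (\<lambda>x. s m x - s n x) \<le> l2_norm M (\<lambda>x. s m x - f x) + l2_norm M (\<lambda>x. f x - s n x)"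
      by (rule l2_norm_triangle_diff[OF assms(1,2,1)])
    also have "\<dots> < e / 2 + e / 2"
      using N that by (intro add_strict_mono) (auto simp: l2_norm_diff_commute[of M f])
    finally show ?thesis by simp
  qed
  then show ?thesis by blast
qed

section \<open>Completeness of L2\<close>

lemma suminf_ennreal_bounded:
  assumes "(\<Sum>k. ennreal (a k)) \<noteq> \<infinity>"
  shows "\<exists>C\<ge>0. \<forall>k. a k \<le> C"
proof -
  define C where "C = enn2real (\<Sum>k. ennreal (a k))"
  have C: "(\<Sum>k. ennreal (a k)) = ennreal C"
    using assms by (simp add: C_def less_top)
  have "a k \<le> C" for k
  proof -
    have "ennreal (a k) \<le> (\<Sum>k. ennreal (a k))"
      using sum_le_suminf[of "\<lambda>k. ennreal (a k)" "{k}"] by simp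
    then show ?thesis unfolding C by (simp add: C_def ennreal_le_iff)
  qed
  then show ?thesis by (intro exI[of _ C]) (simp add: C_def)
qed

text \<open>The Riesz-Fischer argument. Along a fast subsequence the weighted sum of 4^k |d k|^2 has
  finite integral, so it is finite almost everywhere. Boundedness of its terms then gives |d k x|
  \<le> C / 2^k, and the telescoping series converges absolutely.\<close>

theorem L2_complete:
  assumes s: "\<And>n. s n \<in> L2 M"
    and Cauchy: "\<And>e. e > 0 \<Longrightarrow> \<exists>N. \<forall>m\<ge>N. \<forall>n\<ge>N. l2_norm M (\<lambda>x. s m x - s n x) < e"
  shows "\<exists>f\<in>L2 M. (\<lambda>n. l2_norm M (\<lambda>x. s n x - f x)) \<longlonglongrightarrow> 0"
proof -
  have meas [measurable]: "s n \<in> borel_measurable M" for n using s L2_measurable by blast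
  \<comment> \<open>The rate \<open>(1/4)^k\<close> leaves room for the weight 4^k used below: 4^k
    times the squared rate is still the summable \<open>(1/4)^k\<close>.\<close>
  have "\<exists>r. \<forall>k. (\<forall>m\<ge>r k. \<forall>n\<ge>r k. l2_norm M (\<lambda>x. s m x - s n x) < (1/4)^k) \<and> r k < r (Suc k)"
  proof (rule dependent_nat_choice)
    show "\<exists>x. \<forall>m\<ge>x. \<forall>n\<ge>x. l2_norm M (\<lambda>xa. s m xa - s n xa) < (1 / 4) ^ 0"
      using Cauchy[of 1] by simp
  next
    fix x k
    obtain N where "\<forall>m\<ge>N. \<forall>n\<ge>N. l2_norm M (\<lambda>x. s m x - s n x) < (1/4)^(Suc k)"
      using Cauchy[of "(1/4)^(Suc k)"] by auto
    then show "\<exists>y. (\<forall>m\<ge>y. \<forall>n\<ge>y. l2_norm M (\<lambda>xa. s m xa - s n xa) < (1 / 4) ^ Suc k) \<and> x < y"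
      by (intro exI[of _ "max N (Suc x)"]) auto
  qed
  then obtain r where r: "\<And>k m n. m \<ge> r k \<Longrightarrow> n \<ge> r k \<Longrightarrow> l2_norm M (\<lambda>x. s m x - s n x) < (1/4)^k"
    and r_Suc: "\<And>k. r k < r (Suc k)" by blast
  have mono: "strict_mono r" using r_Suc by (simp add: strict_mono_Suc_iff)
  define d where "d k x = s (r (Suc k)) x - s (r k) x" for k x
  have dL2: "d k \<in> L2 M" for k unfolding d_def using s by (intro L2_diff)
  have [measurable]: "d k \<in> borel_measurable M" for k using dL2 L2_measurable by blast
  have "(\<integral>\<^sup>+x. (\<Sum>k. ennreal (4^k * (cmod (d k x))\<^sup>2)) \<partial>M) = (\<Sum>k. \<integral>\<^sup>+x. ennreal (4^k * (cmod (d k x))\<^sup>2) \<partial>M)"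
    by (rule nn_integral_suminf) simp
  also have "\<dots> \<le> (\<Sum>k. ennreal ((1/4)^k))"
  proof (rule suminf_le)
    fix k
    have "(\<integral>\<^sup>+x. ennreal (4^k * (cmod (d k x))\<^sup>2) \<partial>M) = ennreal (4^k) * (\<integral>\<^sup>+x. ennreal ((cmod (d k x))\<^sup>2) \<partial>M)"
      by (subst nn_integral_cmult[symmetric]) (auto simp: ennreal_mult)
    also have "\<dots> = ennreal (4^k * (l2_norm M (d k))\<^sup>2)"
      using nn_integral_L2[OF dL2] by (simp add: ennreal_mult)
    also have "\<dots> \<le> ennreal (4^k * ((1/4)^k)\<^sup>2)"
    proof (intro ennreal_leI mult_left_mono power_mono)
      show "l2_norm M (d k) \<le> (1/4)^k"
        unfolding d_def using r[of k "r (Suc k)" "r k"] r_Suc[of k] by simp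
    qed auto
    also have "4^k * ((1/4)^k)\<^sup>2 = ((1/4)^k :: real)"
    proof -
      have "4^k * (1/4)^k = (1::real)" by (simp add: power_one_over)
      then show ?thesis unfolding power2_eq_square mult.assoc[symmetric] by simp
    qed
    finally show "(\<integral>\<^sup>+x. ennreal (4^k * (cmod (d k x))\<^sup>2) \<partial>M) \<le> ennreal ((1/4)^k)" .
  qed auto
  also have "\<dots> < \<infinity>"
    by (subst suminf_ennreal2) (auto intro: summable_geometric)
  finally have "AE x in M. (\<Sum>k. ennreal (4^k * (cmod (d k x))\<^sup>2)) \<noteq> \<infinity>"
    by (intro nn_integral_noteq_infinite) auto
  then have conv: "AE x in M. convergent (\<lambda>k. s (r k) x)"
  proof eventually_elim
    case (elim x)
    then obtain C where C: "C \<ge> 0" and "\<And>k. 4^k * (cmod (d k x))\<^sup>2 \<le> C"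
      using suminf_ennreal_bounded[of "\<lambda>k. 4^k * (cmod (d k x))\<^sup>2"] by blast
    then have "(2^k * cmod (d k x))\<^sup>2 \<le> (sqrt C)\<^sup>2" for k
    proof -
      have "(4::real)^k = (2^k)\<^sup>2"
        using power_mult[of "2::real" 2 k] power_mult[of "2::real" k 2] by (simp add: mult.commute)
      then show ?thesis using \<open>4^k * (cmod (d k x))\<^sup>2 \<le> C\<close> C by (simp add: power_mult_distrib)
    qed
    then have b: "2^k * cmod (d k x) \<le> sqrt C" for k
      using C by (meson power2_le_imp_le real_sqrt_ge_zero)
    have "cmod (d k x) \<le> sqrt C * (1/2)^k" for k
      using b[of k] by (simp add: field_simps)
    moreover have "summable (\<lambda>k. sqrt C * (1/2)^k)"
      by (intro summable_mult summable_geometric) simp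
    ultimately have "summable (\<lambda>k. d k x)"
      using summable_comparison_test'[of "\<lambda>k. sqrt C * (1/2)^k" 0 "\<lambda>k. d k x"] by blast
    then have "convergent (\<lambda>n. s (r 0) x + (\<Sum>k<n. d k x))"
      by (intro convergent_add convergent_const) (simp add: summable_iff_convergent)
    moreover have "s (r 0) x + (\<Sum>k<n. d k x) = s (r n) x" for n
      unfolding d_def by (subst sum_lessThan_telescope) simp
    ultimately show ?case by simp
  qed
  define f where "f x = lim (\<lambda>k. s (r k) x)" for x
  have [measurable]: "f \<in> borel_measurable M"
    unfolding f_def by (rule borel_measurable_lim_metric) simp
  have lim: "AE x in M. (\<lambda>k. s (r k) x) \<longlonglongrightarrow> f x"
    using conv by eventually_elim (simp add: f_def convergent_LIMSEQ_iff)
  \<comment> \<open>Fatou's lemma along the subsequence transfers the Cauchy estimate to the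
    pointwise limit, for every index \<open>m\<close> beyond \<open>r k\<close>. It provides both
    membership of \<open>f\<close> in L2 and convergence of the whole sequence.\<close>
  have F: "(\<integral>\<^sup>+x. ennreal ((cmod (s m x - f x))\<^sup>2) \<partial>M) \<le> ennreal (((1/4)^k)\<^sup>2)" if "m \<ge> r k" for m k
  proof -
    have "(\<integral>\<^sup>+x. ennreal ((cmod (s m x - f x))\<^sup>2) \<partial>M) =
        (\<integral>\<^sup>+x. liminf (\<lambda>j. ennreal ((cmod (s m x - s (r j) x))\<^sup>2)) \<partial>M)"
    proof (rule nn_integral_cong_AE)
      show "AE x in M. ennreal ((cmod (s m x - f x))\<^sup>2) = liminf (\<lambda>j. ennreal ((cmod (s m x - s (r j) x))\<^sup>2))"
        using lim
      proof eventually_elim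
        case (elim x)
        then have "(\<lambda>j. ennreal ((cmod (s m x - s (r j) x))\<^sup>2)) \<longlonglongrightarrow> ennreal ((cmod (s m x - f x))\<^sup>2)"
          by (intro tendsto_intros) auto
        then show ?case by (intro lim_imp_Liminf[symmetric]) auto
      qed
    qed
    also have "\<dots> \<le> liminf (\<lambda>j. \<integral>\<^sup>+x. ennreal ((cmod (s m x - s (r j) x))\<^sup>2) \<partial>M)"
      by (rule nn_integral_liminf) simp
    also have "\<dots> \<le> limsup (\<lambda>j. \<integral>\<^sup>+x. ennreal ((cmod (s m x - s (r j) x))\<^sup>2) \<partial>M)"
      by (rule Liminf_le_Limsup) simp
    also have "\<dots> \<le> ennreal (((1/4)^k)\<^sup>2)"
    proof (rule Limsup_bounded, rule eventually_sequentiallyI)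
      fix j assume "j \<ge> k"
      then have "r j \<ge> r k" using mono by (simp add: strict_mono_less_eq)
      then have "l2_norm M (\<lambda>x. s m x - s (r j) x) \<le> (1/4)^k" using r[of k m "r j"] that by simp
      then show "(\<integral>\<^sup>+x. ennreal ((cmod (s m x - s (r j) x))\<^sup>2) \<partial>M) \<le> ennreal (((1/4)^k)\<^sup>2)"
        by (subst nn_integral_L2[OF L2_diff[OF s s]]) (intro ennreal_leI power_mono, auto)
    qed
    finally show ?thesis .
  qed
  have "(\<lambda>x. s (r 0) x - f x) \<in> L2 M"
    using F[of 0 "r 0"] unfolding L2_iff_nn_integral by (auto intro: le_less_trans)
  from L2_diff[OF s this, of "r 0"] have fL2: "f \<in> L2 M" by simp
  have "(\<lambda>n. l2_norm M (\<lambda>x. s n x - f x)) \<longlonglongrightarrow> 0"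
  proof (rule LIMSEQ_I)
    fix e :: real assume "e > 0"
    then obtain k where k: "(1/4)^k < e" using real_arch_pow_inv[of e "1/4"] by auto
    have "norm (l2_norm M (\<lambda>x. s m x - f x) - 0) < e" if "m \<ge> r k" for m
    proof -
      have "ennreal ((l2_norm M (\<lambda>x. s m x - f x))\<^sup>2) \<le> ennreal (((1/4)^k)\<^sup>2)"
        using F[OF that] nn_integral_L2[OF L2_diff[OF s fL2]] by simp
      then have "(l2_norm M (\<lambda>x. s m x - f x))\<^sup>2 \<le> ((1/4)^k)\<^sup>2" by (simp del: power_one_over)
      then have "l2_norm M (\<lambda>x. s m x - f x) \<le> (1/4)^k" by (rule power2_le_imp_le) simp
      then show ?thesis using k by simp
    qed
    then show "\<exists>no. \<forall>n\<ge>no. norm (l2_norm M (\<lambda>x. s n x - f x) - 0) < e" by blast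
  qed
  with fL2 show ?thesis by blast
qed

lemma l2_inner_cong_right:
  assumes "f \<in> L2 M" "g \<in> L2 M" "g' \<in> L2 M" "AE x in M. g x = g' x"
  shows "l2_inner M f g = l2_inner M f g'"
  by (rule l2_inner_AE_cong[OF assms(1,1-3)[THEN L2_measurable] _ assms(4)]) simp

text \<open>Polarisation: expanding both squared norms isolates the real part of
  \<open>cnj c\<close> times the inner product. Taking c = 1 and c = i recovers the real and the
  imaginary part. In this form an isometry that is additive only almost everywhere still preserves
  inner products.\<close>

lemma l2_inner_eq_of_norm_eq:
  assumes "f \<in> L2 M" "g \<in> L2 M" "F \<in> L2 N" "G \<in> L2 N"
    and eq: "\<And>c. l2_norm M (\<lambda>x. f x + c * g x) = l2_norm N (\<lambda>x. F x + c * G x)"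
    and eq_g: "l2_norm M g = l2_norm N G"
  shows "l2_inner M f g = l2_inner N F G"
proof -
  have eq_f: "l2_norm M f = l2_norm N F" using eq[of 0] by simp
  have ex: "(l2_norm M (\<lambda>x. f x + c * g x))\<^sup>2 = (l2_norm M f)\<^sup>2 + 2 * Re (cnj c * l2_inner M f g) + (cmod c)\<^sup>2 * (l2_norm M g)\<^sup>2"
    if "f \<in> L2 M" "g \<in> L2 M" for f g :: "'c \<Rightarrow> complex" and M c
  proof -
    have "of_real ((l2_norm M (\<lambda>x. f x + c * g x))\<^sup>2) = l2_inner M f f + cnj c * l2_inner M f g + (c * l2_inner M g f + c * cnj c * l2_inner M g g)"
      unfolding l2_inner_self[symmetric] using that
      by (simp add: l2_inner_add_left l2_inner_add_right L2_add L2_cmult l2_inner_cmult_left l2_inner_cmult_right mult.assoc distrib_left)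
    also have "c * l2_inner M g f = cnj (cnj c * l2_inner M f g)" by (subst l2_inner_commute) simp
    finally have "Re (of_real ((l2_norm M (\<lambda>x. f x + c * g x))\<^sup>2)) = Re (l2_inner M f f + cnj c * l2_inner M f g + (cnj (cnj c * l2_inner M f g) + c * cnj c * l2_inner M g g))"
      by (rule arg_cong)
    then show ?thesis by (simp add: l2_inner_self complex_mult_cnj cmod_power2 flip: of_real_power of_real_mult of_real_add)
  qed
  have "Re (cnj c * l2_inner M f g) = Re (cnj c * l2_inner N F G)" for c
    using ex[OF assms(1,2), of c] ex[OF assms(3,4), of c] eq[of c] eq_f eq_g by simp
  from this[of 1] this[of "\<i>"] show ?thesis by (simp add: complex_eq_iff)
qed

lemma l2_closureI:
  assumes "f \<in> L2 M" "g \<in> L2 N" "\<And>n. (s n, t n) \<in> T" "\<And>n. s n \<in> L2 M" "\<And>n. t n \<in> L2 N"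
    "(\<lambda>n. l2_norm M (\<lambda>x. s n x - f x)) \<longlonglongrightarrow> 0" "(\<lambda>n. l2_norm N (\<lambda>x. t n x - g x)) \<longlonglongrightarrow> 0"
  shows "(f, g) \<in> l2_closure M N T"
  unfolding l2_closure_def mem_Collect_eq prod.case
  by (intro conjI assms exI[of _ s] exI[of _ t] allI)

lemma l2_closureE:
  assumes "(f, g) \<in> l2_closure M N T"
  obtains s t where "f \<in> L2 M" "g \<in> L2 N" "\<And>n. (s n, t n) \<in> T" "\<And>n. s n \<in> L2 M" "\<And>n. t n \<in> L2 N"
    "(\<lambda>n. l2_norm M (\<lambda>x. s n x - f x)) \<longlonglongrightarrow> 0" "(\<lambda>n. l2_norm N (\<lambda>x. t n x - g x)) \<longlonglongrightarrow> 0"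
proof -
  from assms have fg: "f \<in> L2 M" "g \<in> L2 N"
    and ex: "\<exists>s t. (\<forall>n. (s n, t n) \<in> T \<and> s n \<in> L2 M \<and> t n \<in> L2 N) \<and>
      (\<lambda>n. l2_norm M (\<lambda>x. s n x - f x)) \<longlonglongrightarrow> 0 \<and> (\<lambda>n. l2_norm N (\<lambda>x. t n x - g x)) \<longlonglongrightarrow> 0"
    by (simp_all add: l2_closure_def)
  from ex obtain s t where st: "\<forall>n. (s n, t n) \<in> T \<and> s n \<in> L2 M \<and> t n \<in> L2 N"
      "(\<lambda>n. l2_norm M (\<lambda>x. s n x - f x)) \<longlonglongrightarrow> 0" "(\<lambda>n. l2_norm N (\<lambda>x. t n x - g x)) \<longlonglongrightarrow> 0"
    by (elim exE conjE)
  show ?thesis by (rule that[OF fg _ _ _ st(2,3)]) (use st(1) in auto)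
qed

section \<open>Induction over L2 from a generating system of sets\<close>

lemma l2_norm_indicator_diff_tendsto:
  assumes "\<And>n. A n \<in> sets M" "B \<in> sets M" "emeasure M B < \<infinity>" "\<And>n. A n \<subseteq> B"
    "\<And>x. x \<in> B \<Longrightarrow> (\<lambda>n. indicator (A n) x :: complex) \<longlonglongrightarrow> indicator B' x" "B' \<in> sets M" "B' \<subseteq> B"
  shows "(\<lambda>n. l2_norm M (\<lambda>x. indicator (A n) x - indicator B' x)) \<longlonglongrightarrow> 0"
proof (rule l2_norm_dominated_convergence[where c = 1])
  show "(indicator B :: _ \<Rightarrow> complex) \<in> L2 M" using assms by (intro L2_indicator)
  show "AE x in M. (\<lambda>n. indicator (A n) x :: complex) \<longlonglongrightarrow> indicator B' x"
  proof (rule AE_I2)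
    fix x show "(\<lambda>n. indicator (A n) x :: complex) \<longlonglongrightarrow> indicator B' x"
    proof (cases "x \<in> B")
      case False
      then have "x \<notin> A n" "x \<notin> B'" for n using assms(4)[of n] assms(7) by auto
      then show ?thesis by simp
    qed (use assms(5) in auto)
  qed
  show "AE x in M. cmod (indicator (A n) x - indicator B' x) \<le> 1 * cmod (indicator B x)" for n
    using assms(4)[of n] assms(7) by (intro AE_I2) (auto simp: indicator_def)
qed (use assms in auto)

text \<open>A property closed under sums, scalar multiples and L2 limits has to be checked only on
  indicators of an intersection-stable generator. A Dynkin argument extends it to measurable sets
  cut down to \<open>A n\<close>, and simple functions then reach every element of L2.\<close>

theorem L2_induct [consumes 1, case_names ind add cmult lim]:
  assumes f: "f \<in> L2 M"
    and ind: "\<And>X. X \<in> E \<Longrightarrow> P (indicator X)"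
    and add: "\<And>f g. f \<in> L2 M \<Longrightarrow> g \<in> L2 M \<Longrightarrow> P f \<Longrightarrow> P g \<Longrightarrow> P (\<lambda>x. f x + g x)"
    and cmult: "\<And>c f. f \<in> L2 M \<Longrightarrow> P f \<Longrightarrow> P (\<lambda>x. c * f x)"
    and lim: "\<And>s f. (\<And>n. s n \<in> L2 M) \<Longrightarrow> (\<And>n. P (s n)) \<Longrightarrow> f \<in> L2 M \<Longrightarrow>
       (\<lambda>n. l2_norm M (\<lambda>x. s n x - f x)) \<longlonglongrightarrow> 0 \<Longrightarrow> P f"
    and E: "Int_stable E" "E \<subseteq> Pow (space M)" "sets M = sigma_sets (space M) E"
    and A: "\<And>n::nat. A n \<in> E" "incseq A" "(\<Union>n. A n) = space M" "\<And>n. emeasure M (A n) < \<infinity>"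
  shows "P f"
proof -
  have EM: "X \<in> sets M" if "X \<in> E" for X unfolding E(3) using that by (rule sigma_sets.Basic)
  have AM: "A n \<in> sets M" for n using A(1) EM by blast
  have zero: "P (\<lambda>x. 0)" using cmult[of "indicator (A 0)" 0] ind[OF A(1)] L2_indicator[OF AM A(4)] by simp
  have sum: "P (\<lambda>x. \<Sum>i\<in>I. g i x)" if "finite I" "\<And>i. i \<in> I \<Longrightarrow> g i \<in> L2 M" "\<And>i. i \<in> I \<Longrightarrow> P (g i)"
    for I :: "'b set" and g
    using that by (induction I rule: finite_induct) (auto simp: zero intro!: add L2_sum)
  have finM: "emeasure M (X \<inter> A n) < \<infinity>" for X n
    using emeasure_mono[of "X \<inter> A n" "A n" M] AM A(4)[of n] by (auto intro: le_less_trans)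
  have L2X: "(indicator (X \<inter> A n) :: _ \<Rightarrow> complex) \<in> L2 M" if "X \<in> sets M" for X n
    using that AM finM by (intro L2_indicator) auto
  \<comment> \<open>The intersection with \<open>A n\<close> keeps all measures finite: complements
    become differences of L2 indicators, and countable disjoint unions become L2 limits of finite
    sums.\<close>
  have set: "P (indicator (X \<inter> A n))" if "X \<in> sets M" for X n
  proof -
    have "X \<in> sigma_sets (space M) E" using that E(3) by simp
    from E(1,2) this show ?thesis
    proof (induction rule: sigma_sets_induct_disjoint)
      case (basic X)
      then show ?case using ind E(1) A(1) by (auto simp: Int_stable_def)
    next
      case empty
      have "indicator ({} \<inter> A n) = (\<lambda>x. 0 :: complex)" by auto
      then show ?case using zero by simp
    next
      case (compl X)
      then have "X \<in> sets M" using E(3) by simp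
      have "P (\<lambda>x. indicator (A n) x + (- 1) * indicator (X \<inter> A n) x)"
      proof (rule add)
        show "indicator (A n) \<in> L2 M" using AM A(4) by (rule L2_indicator)
        show "(\<lambda>x. - 1 * indicator (X \<inter> A n) x) \<in> L2 M"
          using L2X[OF \<open>X \<in> sets M\<close>] by (rule L2_cmult)
        show "P (indicator (A n))" using A(1) by (rule ind)
        show "P (\<lambda>x. - 1 * indicator (X \<inter> A n) x)"
          using L2X[OF \<open>X \<in> sets M\<close>] compl(2) by (rule cmult)
      qed
      also have "(\<lambda>x. indicator (A n) x + (- 1) * indicator (X \<inter> A n) x) =
          (indicator ((space M - X) \<inter> A n) :: _ \<Rightarrow> complex)"
        using sets.sets_into_space[OF AM[of n]] by (auto simp: indicator_def fun_eq_iff)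
      finally show ?case .
    next
      case (union X)
      then have XM: "X i \<in> sets M" for i using E(3) by auto
      define s where "s k x = (\<Sum>i<k. indicator (X i \<inter> A n) x :: complex)" for k :: nat and x
      have s_ind: "s k = indicator ((\<Union>i<k. X i) \<inter> A n)" for k
      proof
        fix x
        have "s k x = indicator (\<Union>i<k. X i \<inter> A n) x"
          unfolding s_def using union(1)
          by (intro indicator_UN_disjoint[symmetric]) (auto simp: disjoint_family_on_def)
        then show "s k x = indicator ((\<Union>i<k. X i) \<inter> A n) x" by simp
      qed
      show ?case
      proof (rule lim[of s])
        show "s k \<in> L2 M" for k unfolding s_ind using XM by (intro L2X) auto
        show "P (s k)" for k unfolding s_def using union(3) L2X[OF XM] by (intro sum) auto
        show "indicator (\<Union> (range X) \<inter> A n) \<in> L2 M" using XM by (intro L2X) auto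
        show "(\<lambda>k. l2_norm M (\<lambda>x. s k x - indicator (\<Union> (range X) \<inter> A n) x)) \<longlonglongrightarrow> 0"
          unfolding s_ind
        proof (rule l2_norm_indicator_diff_tendsto[where B = "A n"])
          fix x
          have "(\<lambda>k. indicator (\<Union>i<k. X i \<inter> A n) x :: complex) \<longlonglongrightarrow> indicator (\<Union>i. X i \<inter> A n) x"
            by (rule LIMSEQ_indicator_UN)
          then show "(\<lambda>k. indicator ((\<Union>i<k. X i) \<inter> A n) x :: complex) \<longlonglongrightarrow> indicator (\<Union> (range X) \<inter> A n) x"
            by simp
        qed (use XM AM A(4) in auto)
      qed
    qed
  qed
  obtain s where s: "\<And>i. simple_function M (s i)"
    "\<And>x. x \<in> space M \<Longrightarrow> (\<lambda>i. s i x) \<longlonglongrightarrow> f x"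
    "\<And>i x. x \<in> space M \<Longrightarrow> norm (s i x) \<le> 2 * norm (f x)"
    using borel_measurable_implies_sequence_metric[OF L2_measurable[OF f], of 0]
    unfolding dist_0_norm dist_norm diff_0_right by metis
  define t where "t i x = indicator (A i) x * s i x" for i x
  have t_eq: "t i x = (\<Sum>c\<in>s i ` space M. c * indicator (s i -` {c} \<inter> space M \<inter> A i) x)" if "x \<in> space M" for i x
  proof -
    have "(\<Sum>c\<in>s i ` space M. c * indicator (s i -` {c} \<inter> space M \<inter> A i) x) =
        (\<Sum>c\<in>s i ` space M. if c = s i x then indicator (A i) x * c else 0)"
      using that by (intro sum.cong) (auto simp: indicator_def)
    also have "\<dots> = t i x"
      using that simple_functionD(1)[OF s(1)] by (simp add: t_def)
    finally show ?thesis by simp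
  qed
  \<comment> \<open>On \<open>space M\<close> this agrees with the truncation \<open>t\<close>, but
    as a finite combination of indicators it is in the form to which the closure rules for
    \<open>P\<close> apply.\<close>
  define u where "u i x = (\<Sum>c\<in>s i ` space M. c * indicator (s i -` {c} \<inter> space M \<inter> A i) x)" for i x
  have uL2: "u i \<in> L2 M" for i
    unfolding u_def using simple_functionD[OF s(1)] by (intro L2_sum L2_cmult L2X) auto
  show ?thesis
  proof (rule lim[of u])
    show "u i \<in> L2 M" for i by (rule uL2)
    show "P (u i)" for i
      unfolding u_def using simple_functionD[OF s(1)] by (intro sum cmult set L2_cmult L2X) auto
    show "f \<in> L2 M" by (rule f)
    show "(\<lambda>n. l2_norm M (\<lambda>x. u n x - f x)) \<longlonglongrightarrow> 0"
    \<comment> \<open>The simple approximants are bounded by twice \<open>f\<close>, so their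
      distance to \<open>f\<close> is at most three times \<open>f\<close>.\<close>
    proof (rule l2_norm_dominated_convergence[where c = 3 and b = f])
      show "u n \<in> borel_measurable M" for n using uL2 L2_measurable by blast
      show "AE x in M. (\<lambda>n. u n x) \<longlonglongrightarrow> f x"
      proof (rule AE_I2)
        fix x assume x: "x \<in> space M"
        then obtain N where N: "x \<in> A N" using A(3) by auto
        have "\<forall>\<^sub>F n in sequentially. s n x = u n x"
        proof (rule eventually_sequentiallyI[of N])
          fix n assume "N \<le> n"
          then have "x \<in> A n" using N A(2) by (auto simp: incseq_def)
          then have "s n x = t n x" by (simp add: t_def)
          also have "\<dots> = u n x" unfolding u_def by (rule t_eq[OF x])
          finally show "s n x = u n x" .
        qed
        then show "(\<lambda>n. u n x) \<longlonglongrightarrow> f x"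
          using s(2)[OF x] by (rule Lim_transform_eventually[rotated])
      qed
      show "AE x in M. cmod (u n x - f x) \<le> 3 * cmod (f x)" for n
      proof (rule AE_I2)
        fix x assume x: "x \<in> space M"
        have "cmod (u n x) \<le> 2 * cmod (f x)"
        proof -
          have "u n x = t n x" unfolding u_def by (rule t_eq[OF x, symmetric])
          then show ?thesis using s(3)[OF x, of n] by (simp add: t_def indicator_def)
        qed
        then show "cmod (u n x - f x) \<le> 3 * cmod (f x)"
          using norm_triangle_ineq4[of "u n x" "f x"] by linarith
      qed
    qed (use f L2_measurable in auto)
  qed
qed

text \<open>The functions orthogonal to \<open>f\<close> satisfy all closure rules of
  \<open>L2_induct\<close>, so \<open>f\<close> itself is among them and has norm zero.\<close>

lemma L2_orthogonal_zero:
  assumes f: "f \<in> L2 M"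
    and orth: "\<And>X. X \<in> E \<Longrightarrow> emeasure M X < \<infinity> \<Longrightarrow> l2_inner M (indicator X) f = 0"
    and E: "Int_stable E" "E \<subseteq> Pow (space M)" "sets M = sigma_sets (space M) E"
    and fin: "\<And>X. X \<in> E \<Longrightarrow> emeasure M X < \<infinity>"
    and A: "\<And>n::nat. A n \<in> E" "incseq A" "(\<Union>n. A n) = space M"
  shows "AE x in M. f x = 0"
proof -
  have "l2_inner M f f = 0"
    using f
  proof (rule L2_induct[where P = "\<lambda>g. l2_inner M g f = 0" and E = E and A = A])
    fix s g assume *: "\<And>n. s n \<in> L2 M" "\<And>n. l2_inner M (s n) f = 0" "g \<in> L2 M"
      "(\<lambda>n. l2_norm M (\<lambda>x. s n x - g x)) \<longlonglongrightarrow> 0"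
    have "(\<lambda>n. l2_inner M (s n) f) \<longlonglongrightarrow> l2_inner M g f" by (rule l2_inner_tendsto[OF *(1,3,4) f])
    then show "l2_inner M g f = 0" using *(2) by (simp add: LIMSEQ_const_iff)
  qed (use f E A fin orth in \<open>auto simp: l2_inner_add_left l2_inner_cmult_left\<close>)
  then have "l2_norm M f = 0" by (simp add: l2_inner_self)
  then show ?thesis using l2_norm_zero_iff[OF f] by simp
qed

lemma lborel_intervals:
  shows "Int_stable (range (\<lambda>(a, b). {a..b::real}))"
    and "range (\<lambda>(a, b). {a..b::real}) \<subseteq> Pow (space lborel)"
    and "sets lborel = sigma_sets (space lborel) (range (\<lambda>(a, b). {a..b::real}))"
    and "\<And>n. {- real n..real n} \<in> range (\<lambda>(a, b). {a..b::real})"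
    and "incseq (\<lambda>n. {- real n..real n})"
    and "(\<Union>n. {- real n..real n}) = space lborel"
    and "\<And>X. X \<in> range (\<lambda>(a, b). {a..b::real}) \<Longrightarrow> emeasure lborel X < \<infinity>"
proof -
  show "sets lborel = sigma_sets (space lborel) (range (\<lambda>(a, b). {a..b::real}))"
    by (simp add: borel_eq_atLeastAtMost)
  show "(\<Union>n. {- real n..real n}) = space lborel"
  proof -
    have "\<exists>n. - real n \<le> x \<and> x \<le> real n" for x
      using real_arch_simple[of "\<bar>x\<bar>"] by (metis abs_le_iff minus_le_iff)
    then show ?thesis by auto
  qed
  show "emeasure lborel X < \<infinity>" if "X \<in> range (\<lambda>(a, b). {a..b::real})" for X
    using that by (auto simp: emeasure_lborel_Icc_eq)
  show "Int_stable (range (\<lambda>(a, b). {a..b::real}))"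
    by (force simp: Int_stable_def)
  show "{- real n..real n} \<in> range (\<lambda>(a, b). {a..b::real})" for n
    by (rule range_eqI[of _ _ "(- real n, real n)"]) simp
  show "incseq (\<lambda>n. {- real n..real n})" by (auto simp: incseq_def)
qed auto

lemmas lborel_L2_induct [consumes 1, case_names ind add cmult lim] =
  L2_induct[OF _ _ _ _ _ lborel_intervals(1-6) lborel_intervals(7)[OF lborel_intervals(4)]]

section \<open>Smooth functions\<close>

definition smooth :: "(real \<Rightarrow> complex) \<Rightarrow> bool" where
  "smooth \<phi> \<longleftrightarrow> (\<exists>d. d 0 = \<phi> \<and> (\<forall>n x. (d n has_vector_derivative d (Suc n) x) (at x)))"

text \<open>Dependent choice builds the sequence of derivatives inside \<open>X\<close>. Smoothness
  then needs only a family that contains the function and is closed under one differentiation, with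
  no formula for higher derivatives.\<close>

lemma smooth_coinduct:
  assumes "\<phi> \<in> X" "\<And>f. f \<in> X \<Longrightarrow> \<exists>g\<in>X. \<forall>x. (f has_vector_derivative g x) (at x)"
  shows "smooth \<phi>"
proof -
  have "\<exists>d. \<forall>n. (d n \<in> X \<and> (n = 0 \<longrightarrow> d n = \<phi>)) \<and> (\<forall>x. (d n has_vector_derivative d (Suc n) x) (at x))"
    by (rule dependent_nat_choice) (use assms in auto)
  then show ?thesis unfolding smooth_def by blast
qed

lemma smooth_deriv:
  assumes "smooth f"
  obtains g where "smooth g" "\<And>x. (f has_vector_derivative g x) (at x)"
proof -
  obtain d where d: "d 0 = f" "\<And>n x. (d n has_vector_derivative d (Suc n) x) (at x)"
    using assms unfolding smooth_def by blast
  have "smooth (d 1)" unfolding smooth_def using d(2) by (intro exI[of _ "\<lambda>n. d (Suc n)"]) simp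
  then show ?thesis using that d by (metis One_nat_def)
qed

lemma smooth_imp_continuous: "smooth f \<Longrightarrow> continuous_on UNIV f"
  by (metis smooth_deriv continuous_on_vector_derivative has_vector_derivative_at_within)

text \<open>Products of smooth functions are not closed under differentiation, but their sums are,
  by the Leibniz rule. This is the invariant family for \<open>smooth_mult\<close>.\<close>

inductive_set product_span :: "(real \<Rightarrow> complex) set" where
  prod: "smooth f \<Longrightarrow> smooth g \<Longrightarrow> (\<lambda>x. f x * g x) \<in> product_span"
| add: "f \<in> product_span \<Longrightarrow> g \<in> product_span \<Longrightarrow> (\<lambda>x. f x + g x) \<in> product_span"

lemma smooth_mult:
  assumes "smooth f" "smooth g"
  shows "smooth (\<lambda>x. f x * g x)"
proof (rule smooth_coinduct[where X = product_span])
  show "(\<lambda>x. f x * g x) \<in> product_span" using assms by (rule product_span.prod)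
  show "\<exists>g\<in>product_span. \<forall>x. (h has_vector_derivative g x) (at x)" if "h \<in> product_span" for h
    using that
  proof induction
    case (prod f g)
    obtain f' where f': "smooth f'" "\<And>x. (f has_vector_derivative f' x) (at x)"
      using smooth_deriv[OF prod(1)] by blast
    obtain g' where g': "smooth g'" "\<And>x. (g has_vector_derivative g' x) (at x)"
      using smooth_deriv[OF prod(2)] by blast
    have "((\<lambda>x. f x * g x) has_vector_derivative (f x * g' x + f' x * g x)) (at x)" for x
      using f'(2) g'(2) by (rule has_vector_derivative_mult)
    moreover have "(\<lambda>x. f x * g' x + f' x * g x) \<in> product_span"
      by (intro product_span.intros prod f' g')
    ultimately show ?case by (intro bexI[of _ "\<lambda>x. f x * g' x + f' x * g x"]) auto
  next
    case (add f g)
    then obtain f' g' where "f' \<in> product_span" "g' \<in> product_span"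
      "\<And>x. (f has_vector_derivative f' x) (at x)" "\<And>x. (g has_vector_derivative g' x) (at x)"
      by blast
    then show ?case
      by (intro bexI[of _ "\<lambda>x. f' x + g' x"] allI has_vector_derivative_add product_span.add) auto
  qed
qed

lemma smooth_const: "smooth (\<lambda>x. c)"
  by (rule smooth_coinduct[where X = "range (\<lambda>c x. c)"]) (auto intro!: derivative_eq_intros)

lemma smooth_cis: "smooth (\<lambda>x. cis (a * x))"
proof (rule smooth_coinduct[where X = "range (\<lambda>c x. c * cis (a * x))"])
  show "(\<lambda>x. cis (a * x)) \<in> range (\<lambda>c x. c * cis (a * x))"
    by (rule range_eqI[of _ _ 1]) simp
  fix f assume "f \<in> range (\<lambda>c x. c * cis (a * x))"
  then obtain c where f: "f = (\<lambda>x. c * cis (a * x))" by auto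
  have "(f has_vector_derivative (c * \<i> * a) * cis (a * x)) (at x)" for x
    unfolding f cis_conv_exp of_real_mult
    by (rule has_vector_derivative_real_field) (auto intro!: derivative_eq_intros)
  then show "\<exists>g\<in>range (\<lambda>c x. c * cis (a * x)). \<forall>x. (f has_vector_derivative g x) (at x)"
    by (intro bexI[of _ "\<lambda>x. (c * \<i> * a) * cis (a * x)"]) auto
qed

lemma smooth_affine:
  assumes "smooth f"
  shows "smooth (\<lambda>x. f (a * x + b))"
proof (rule smooth_coinduct[where X = "{\<lambda>x. c * g (a * x + b) | c g. smooth g}"])
  show "(\<lambda>x. f (a * x + b)) \<in> {\<lambda>x. c * g (a * x + b) | c g. smooth g}"
    using assms by (auto intro!: exI[of _ 1])
  fix h assume "h \<in> {\<lambda>x. c * g (a * x + b) | c g. smooth g}"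
  then obtain c g where h: "h = (\<lambda>x. c * g (a * x + b))" and "smooth g" by blast
  then obtain g' where g': "smooth g'" "\<And>x. (g has_vector_derivative g' x) (at x)"
    using smooth_deriv by blast
  have "((g \<circ> (\<lambda>x. a * x + b)) has_vector_derivative a *\<^sub>R g' (a * x + b)) (at x)" for x
    by (rule vector_diff_chain_at) (auto intro!: derivative_eq_intros g' simp: has_real_derivative_iff_has_vector_derivative[symmetric])
  then have "(h has_vector_derivative c * (a *\<^sub>R g' (a * x + b))) (at x)" for x
    unfolding h by (intro has_vector_derivative_mult_right) (simp add: o_def)
  then have "(h has_vector_derivative (c * a) * g' (a * x + b)) (at x)" for x
    by (simp add: scaleR_conv_of_real mult.assoc)
  then show "\<exists>g\<in>{\<lambda>x. c * g (a * x + b) | c g. smooth g}. \<forall>x. (h has_vector_derivative g x) (at x)"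
    using g'(1) by (intro bexI[of _ "\<lambda>x. (c * a) * g' (a * x + b)"]) auto
qed

section \<open>Flat functions exp (- 1/x) with polynomial factors\<close>

definition flat :: "real poly \<Rightarrow> real \<Rightarrow> real" where
  "flat p x = (if x > 0 then poly p (1 / x) * exp (- (1 / x)) else 0)"

lemma poly_exp_tendsto_0: "((\<lambda>t::real. poly p t * exp (- t)) \<longlongrightarrow> 0) at_top"
proof -
  have "((\<lambda>t. \<Sum>i\<le>degree p. coeff p i * (t ^ i / exp t)) \<longlongrightarrow> (\<Sum>i\<le>degree p. coeff p i * 0)) at_top"
    by (intro tendsto_sum tendsto_mult tendsto_const tendsto_power_div_exp_0)
  then show ?thesis
    by (simp add: poly_altdef exp_minus sum_distrib_right divide_inverse mult.assoc)
qed

text \<open>With t = 1 / x, differentiating p(t) exp (- t) in x brings the factor - t^2, so the new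
  polynomial is t^2 (p - p'); \<open>[:0, 0, 1:]\<close> is t^2. At the origin the right difference
  quotient is t p(t) exp (- t), which tends to 0 as t grows. Allowing all polynomials makes the
  family invariant under differentiation.\<close>

lemma flat_has_derivative:
  "(flat p has_real_derivative flat ([:0, 0, 1:] * (p - pderiv p)) x) (at x)"
proof -
  let ?q = "[:0, 0, 1:] * (p - pderiv p)"
  consider "x > 0" | "x < 0" | "x = 0" by linarith
  then show ?thesis
  proof cases
    case 1
    have "((\<lambda>x. poly p (1 / x) * exp (- (1 / x))) has_real_derivative flat ?q x) (at x)"
      using 1 by (auto intro!: derivative_eq_intros poly_DERIV[THEN DERIV_chain2]
          simp: flat_def power2_eq_square field_simps)
    then show ?thesis
      by (rule has_field_derivative_transform_within_open[of _ _ _ "{0<..}"]) (use 1 in \<open>auto simp: flat_def\<close>)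
  next
    case 2
    then have "\<forall>\<^sub>F y in nhds x. flat p y = 0"
      by (intro eventually_nhds_in_open[THEN eventually_mono, of "{..<0}"]) (auto simp: flat_def)
    then show ?thesis
      using 2 by (subst DERIV_cong_ev[OF refl _ refl, of _ "\<lambda>_. 0"]) (auto simp: flat_def)
  next
    case 3
    have "((\<lambda>h. flat p h / h) \<longlongrightarrow> 0) (at_right 0)"
    proof -
      have "((\<lambda>t::real. poly ([:0, 1:] * p) t * exp (- t)) \<longlongrightarrow> 0) at_top"
        by (rule poly_exp_tendsto_0)
      then have "((\<lambda>h. poly ([:0, 1:] * p) (inverse h) * exp (- inverse h)) \<longlongrightarrow> 0) (at_right (0::real))"
        by (rule filterlim_compose) (rule filterlim_inverse_at_top_right)
      moreover have "\<forall>\<^sub>F h in at_right 0. poly ([:0, 1:] * p) (inverse h) * exp (- inverse h) = flat p h / h"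
        using eventually_at_right_less[of "0::real"]
        by eventually_elim (auto simp: flat_def field_simps)
      ultimately show ?thesis by (rule Lim_transform_eventually)
    qed
    moreover have "((\<lambda>h. flat p h / h) \<longlongrightarrow> 0) (at_left 0)"
    proof -
      have "\<forall>\<^sub>F h in at_left 0. 0 = flat p h / h"
        using eventually_at_left_real[of "-1::real" 0] by (auto elim!: eventually_mono simp: flat_def)
      then show ?thesis by (rule Lim_transform_eventually[OF tendsto_const])
    qed
    ultimately have "((\<lambda>h. flat p h / h) \<longlongrightarrow> 0) (at 0)"
      by (simp add: filterlim_split_at)
    then show ?thesis using 3 by (simp add: DERIV_def flat_def)
  qed
qed

lemma smooth_flat: "smooth (\<lambda>x. of_real (flat p x))"
proof (rule smooth_coinduct[where X = "range (\<lambda>p x. of_real (flat p x))"])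
  fix f :: "real \<Rightarrow> complex" assume "f \<in> range (\<lambda>p x. of_real (flat p x))"
  then obtain p where f: "f = (\<lambda>x. of_real (flat p x))" by auto
  have "(f has_vector_derivative of_real (flat ([:0, 0, 1:] * (p - pderiv p)) x)) (at x)" for x
    unfolding f using flat_has_derivative[of p x]
    by (intro has_vector_derivative_of_real) (simp add: has_real_derivative_iff_has_vector_derivative)
  then show "\<exists>g\<in>range (\<lambda>p x. of_real (flat p x)). \<forall>x. (f has_vector_derivative g x) (at x)"
    by (intro bexI[of _ "\<lambda>x. of_real (flat ([:0, 0, 1:] * (p - pderiv p)) x)"]) auto
qed auto

definition hump :: "real \<Rightarrow> real" where "hump = flat 1"

lemma hump: "hump x = (if x > 0 then exp (- (1 / x)) else 0)"
  by (simp add: hump_def flat_def)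

lemma smooth_hump: "smooth (\<lambda>x. of_real (hump (a * x + b)))"
  using smooth_affine[OF smooth_flat, of 1 a b] by (simp add: hump_def)

section \<open>Test functions: stability, approximation of intervals, cutoffs\<close>

lemma test_funs_iff: "\<phi> \<in> test_funs \<longleftrightarrow> smooth \<phi> \<and> bounded {x. \<phi> x \<noteq> 0}"
proof -
  have "compact (closure {x. \<phi> x \<noteq> 0}) \<longleftrightarrow> bounded {x. \<phi> x \<noteq> 0}"
    using bounded_subset[OF compact_imp_bounded closure_subset] compact_closure by blast
  then show ?thesis by (auto simp: test_funs_def smooth_def)
qed

lemma test_funs_mult: "\<phi> \<in> test_funs \<Longrightarrow> smooth \<psi> \<Longrightarrow> (\<lambda>x. \<psi> x * \<phi> x) \<in> test_funs"
  unfolding test_funs_iff by (auto intro: smooth_mult elim!: bounded_subset)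

lemma smooth_add:
  assumes "smooth f" "smooth g"
  shows "smooth (\<lambda>x. f x + g x)"
proof (rule smooth_coinduct[where X = "{\<lambda>x. f x + g x | f g. smooth f \<and> smooth g}"])
  fix h assume "h \<in> {\<lambda>x. f x + g x | f g. smooth f \<and> smooth g}"
  then obtain f g where h: "h = (\<lambda>x. f x + g x)" and "smooth f" "smooth g" by blast
  then obtain f' g' where "smooth f'" "smooth g'" "\<And>x. (f has_vector_derivative f' x) (at x)"
    "\<And>x. (g has_vector_derivative g' x) (at x)" using smooth_deriv by metis
  then show "\<exists>g\<in>{\<lambda>x. f x + g x | f g. smooth f \<and> smooth g}. \<forall>x. (h has_vector_derivative g x) (at x)"
    unfolding h by (intro bexI[of _ "\<lambda>x. f' x + g' x"] allI has_vector_derivative_add) auto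
qed (use assms in blast)

lemma test_funs_add:
  assumes "\<phi> \<in> test_funs" "\<psi> \<in> test_funs"
  shows "(\<lambda>x. \<phi> x + \<psi> x) \<in> test_funs"
proof -
  have "{x. \<phi> x + \<psi> x \<noteq> 0} \<subseteq> {x. \<phi> x \<noteq> 0} \<union> {x. \<psi> x \<noteq> 0}" by auto
  moreover have "bounded ({x. \<phi> x \<noteq> 0} \<union> {x. \<psi> x \<noteq> 0})"
    using assms by (simp add: test_funs_iff bounded_Un)
  ultimately have "bounded {x. \<phi> x + \<psi> x \<noteq> 0}" by (rule bounded_subset[rotated])
  then show ?thesis using assms by (simp add: test_funs_iff smooth_add)
qed

lemma test_funs_cmult: "\<phi> \<in> test_funs \<Longrightarrow> (\<lambda>x. c * \<phi> x) \<in> test_funs"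
  by (rule test_funs_mult[OF _ smooth_const])

lemma test_funs_cases:
  assumes "\<phi> \<in> test_funs"
  obtains R \<phi>' where "R > 0" "\<And>x. \<bar>x\<bar> > R \<Longrightarrow> \<phi> x = 0" "\<And>x. (\<phi> has_vector_derivative \<phi>' x) (at x)"
    "continuous_on UNIV \<phi>" "continuous_on UNIV \<phi>'" "\<And>x. \<bar>x\<bar> > R \<Longrightarrow> \<phi>' x = 0"
proof -
  obtain R where R: "R > 0" "\<And>x. \<phi> x \<noteq> 0 \<Longrightarrow> \<bar>x\<bar> \<le> R"
    using assms unfolding test_funs_iff bounded_pos by auto
  obtain \<phi>' where \<phi>': "smooth \<phi>'" "\<And>x. (\<phi> has_vector_derivative \<phi>' x) (at x)"
    using assms smooth_deriv unfolding test_funs_iff by blast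
  have "\<phi>' x = 0" if "\<bar>x\<bar> > R" for x
  proof -
    have "open {y::real. \<bar>y\<bar> > R}" by (intro open_Collect_less continuous_intros)
    then have "((\<lambda>_. 0) has_vector_derivative \<phi>' x) (at x)"
      using has_vector_derivative_transform_within_open[OF \<phi>'(2) \<open>open {y. \<bar>y\<bar> > R}\<close>, of x "\<lambda>_. 0"] that R
      by force
    then show ?thesis
      using vector_derivative_unique_at[OF _ has_vector_derivative_const] by blast
  qed
  then show ?thesis
    using that[of R \<phi>'] R \<phi>' assms smooth_imp_continuous unfolding test_funs_iff by force
qed

text \<open>The product of two humps, in n (x - a) and in n (b - x), lives on the interval. Since
  exp (- 1/s) tends to 1 as s grows, steepening the arguments makes the product tend to 1 at every
  interior point.\<close>

lemma test_funs_approx_Icc: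
  assumes "a \<le> b"
  obtains \<phi> where "\<And>n. \<phi> n \<in> test_funs" "\<And>n x. cmod (\<phi> n x) \<le> 1" "\<And>n x. x \<notin> {a..b} \<Longrightarrow> \<phi> n x = 0"
    "\<And>x. x \<in> {a<..<b} \<Longrightarrow> (\<lambda>n. \<phi> n x) \<longlonglongrightarrow> 1"
proof -
  define \<phi> :: "nat \<Rightarrow> real \<Rightarrow> complex" where "\<phi> n x = of_real (hump (real (Suc n) * x + (- real (Suc n) * a))) *
      of_real (hump ((- real (Suc n)) * x + real (Suc n) * b))" for n x
  have eq: "\<phi> n x = of_real (hump (real (Suc n) * (x - a)) * hump (real (Suc n) * (b - x)))" for n x
  proof -
    have "real (Suc n) * (x - a) = real (Suc n) * x + (- real (Suc n) * a)"
      "real (Suc n) * (b - x) = (- real (Suc n)) * x + real (Suc n) * b"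
      by (simp_all add: right_diff_distrib del: of_nat_Suc)
    then show ?thesis by (simp only: \<phi>_def of_real_mult)
  qed
  have hump01: "0 \<le> hump x" "hump x \<le> 1" for x by (auto simp: hump)
  have zero: "\<phi> n x = 0" if "x \<notin> {a..b}" for n x
    using that unfolding eq by (auto simp: hump zero_less_mult_iff)
  have sm: "smooth (\<phi> n)" for n unfolding \<phi>_def by (intro smooth_mult smooth_hump)
  have "bounded {x. \<phi> n x \<noteq> 0}" for n
  proof (rule bounded_subset[of "{a..b}"])
    show "{x. \<phi> n x \<noteq> 0} \<subseteq> {a..b}" using zero[of _ n] by blast
  qed simp
  with sm have t: "\<phi> n \<in> test_funs" for n by (simp add: test_funs_iff)
  have le: "cmod (\<phi> n x) \<le> 1" for n x
    unfolding eq norm_of_real using hump01 by (auto simp: abs_mult intro: mult_le_one)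
  have lim: "(\<lambda>n. \<phi> n x) \<longlonglongrightarrow> 1" if "x \<in> {a<..<b}" for x
  proof -
    have h: "(\<lambda>n. hump (real (Suc n) * t)) \<longlonglongrightarrow> 1" if "t > 0" for t
    proof -
      have "(\<lambda>n. exp (- (inverse (real (Suc n)) * (1 / t)))) \<longlonglongrightarrow> exp (- (0 * (1 / t)))"
        by (intro tendsto_intros LIMSEQ_inverse_real_of_nat)
      moreover have "exp (- (inverse (real (Suc n)) * (1 / t))) = hump (real (Suc n) * t)" for n
        using that by (simp add: hump divide_inverse del: of_nat_Suc)
      ultimately show ?thesis by (simp only: mult_zero_left minus_zero exp_zero)
    qed
    have "(\<lambda>n. hump (real (Suc n) * (x - a)) * hump (real (Suc n) * (b - x))) \<longlonglongrightarrow> 1 * 1"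
      using that by (intro tendsto_mult h) auto
    from tendsto_of_real[OF this] show ?thesis unfolding eq by (simp only: mult_1 of_real_1)
  qed
  show ?thesis by (rule that[OF t le zero lim])
qed

text \<open>A single bump with value 1 at the origin is stretched by the factor n + 1. The values
  then converge to the value at 0, and the chain rule puts the factor 1 / (n + 1) on the
  derivatives, so they stay bounded and tend to 0.\<close>

lemma test_funs_cutoff:
  obtains \<eta> \<eta>' :: "nat \<Rightarrow> real \<Rightarrow> complex" and C where
    "\<And>n. \<eta> n \<in> test_funs" "\<And>n x. (\<eta> n has_vector_derivative \<eta>' n x) (at x)"
    "\<And>n x. cmod (\<eta> n x) \<le> C" "\<And>n x. cmod (\<eta>' n x) \<le> C" "C \<ge> 0"
    "\<And>n. continuous_on UNIV (\<eta> n)" "\<And>n. continuous_on UNIV (\<eta>' n)"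
    "\<And>x. (\<lambda>n. \<eta> n x) \<longlonglongrightarrow> 1" "\<And>x. (\<lambda>n. \<eta>' n x) \<longlonglongrightarrow> 0"
    "\<And>n. \<exists>R>0. \<forall>x. \<bar>x\<bar> > R \<longrightarrow> \<eta> n x = 0 \<and> \<eta>' n x = 0"
proof -
  \<comment> \<open>The factor \<open>exp 2\<close> normalises the bump to 1 at the origin, where
    each hump has the value exp (- 1).\<close>
  define b where "b x = of_real (exp 2) * (of_real (hump (1 * x + 1)) * of_real (hump ((- 1) * x + 1)) :: complex)" for x
  have sm: "smooth b" unfolding b_def by (intro smooth_mult smooth_hump smooth_const)
  have zero: "b x = 0" if "\<bar>x\<bar> > 1" for x using that by (auto simp: b_def hump)
  have bt: "b \<in> test_funs"
  proof -
    have "{x. b x \<noteq> 0} \<subseteq> {-1..1}" using zero by (force simp: abs_if split: if_splits)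
    then show ?thesis unfolding test_funs_iff using sm bounded_subset bounded_closed_interval by blast
  qed
  obtain R b' where R: "R > 0" "\<And>x. \<bar>x\<bar> > R \<Longrightarrow> b x = 0" and b': "\<And>x. (b has_vector_derivative b' x) (at x)"
    and cont: "continuous_on UNIV b" "continuous_on UNIV b'" and b'0: "\<And>x. \<bar>x\<bar> > R \<Longrightarrow> b' x = 0"
    by (rule test_funs_cases[OF bt]) blast
  have bdd: "\<exists>C\<ge>0. \<forall>x. cmod (f x) \<le> C" if "continuous_on UNIV f" "\<And>x. \<bar>x\<bar> > R \<Longrightarrow> f x = 0" for f :: "real \<Rightarrow> complex"
  proof -
    have "compact (f ` {-R..R})"
      using that(1) by (intro compact_continuous_image) (auto intro: continuous_on_subset)
    then obtain C where "\<forall>y\<in>f ` {-R..R}. cmod y \<le> C" "C > 0"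
      using compact_imp_bounded[THEN bounded_pos[THEN iffD1]] by blast
    then have "cmod (f x) \<le> C" for x
      using that(2)[of x] by (cases "\<bar>x\<bar> > R") (auto simp: not_less abs_le_iff minus_le_iff)
    then show ?thesis using \<open>C > 0\<close> by (intro exI[of _ C]) auto
  qed
  obtain C1 where C1: "C1 \<ge> 0" "\<And>x. cmod (b x) \<le> C1" using bdd[OF cont(1) R(2)] by blast
  obtain C2 where C2: "C2 \<ge> 0" "\<And>x. cmod (b' x) \<le> C2" using bdd[OF cont(2) b'0] by blast
  define \<eta> where "\<eta> n x = b (inverse (real (Suc n)) * x + 0)" for n x
  define \<eta>' where "\<eta>' n x = inverse (real (Suc n)) *\<^sub>R b' (inverse (real (Suc n)) * x)" for n x
  have zero': "\<eta> n x = 0 \<and> \<eta>' n x = 0" if "\<bar>x\<bar> > real (Suc n) * R" for n x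
  proof -
    have "\<bar>inverse (real (Suc n)) * x\<bar> > R"
      using that by (simp add: abs_mult field_simps)
    then show ?thesis using R(2) b'0 by (simp add: \<eta>_def \<eta>'_def)
  qed
  have lim0: "(\<lambda>n. inverse (real (Suc n)) * x) \<longlonglongrightarrow> 0" for x
    using tendsto_mult[OF LIMSEQ_inverse_real_of_nat tendsto_const[of x]] by simp
  show ?thesis
  proof (rule that[of \<eta> \<eta>' "max C1 C2"])
    show "\<eta> n \<in> test_funs" for n
    proof -
      have "bounded {x. \<eta> n x \<noteq> 0}"
      proof (rule bounded_subset[of "{- (real (Suc n) * R)..real (Suc n) * R}"])
        show "{x. \<eta> n x \<noteq> 0} \<subseteq> {- (real (Suc n) * R)..real (Suc n) * R}"
        proof
          fix x assume "x \<in> {x. \<eta> n x \<noteq> 0}"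
          then have "\<bar>x\<bar> \<le> real (Suc n) * R" using zero'[of n x] by force
          then show "x \<in> {- (real (Suc n) * R)..real (Suc n) * R}" unfolding atLeastAtMost_iff abs_le_iff by linarith
        qed
      qed simp
      moreover have "smooth (\<eta> n)" unfolding \<eta>_def by (rule smooth_affine[OF sm])
      ultimately show ?thesis by (simp add: test_funs_iff)
    qed
    have "((b \<circ> (\<lambda>x. inverse (real (Suc n)) * x)) has_vector_derivative \<eta>' n x) (at x)" for n x
      unfolding \<eta>'_def
      by (rule vector_diff_chain_at)
        (auto intro!: derivative_eq_intros b' simp: has_real_derivative_iff_has_vector_derivative[symmetric])
    then show "(\<eta> n has_vector_derivative \<eta>' n x) (at x)" for n x
      by (simp add: \<eta>_def[abs_def] o_def)
    show "cmod (\<eta> n x) \<le> max C1 C2" for n x unfolding \<eta>_def using C1(2) by (simp add: le_max_iff_disj)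
    show "cmod (\<eta>' n x) \<le> max C1 C2" for n x
    proof -
      have "cmod (\<eta>' n x) = inverse (real (Suc n)) * cmod (b' (inverse (real (Suc n)) * x))"
        by (simp add: \<eta>'_def)
      also have "\<dots> \<le> 1 * C2" by (intro mult_mono C2) (auto simp: field_simps)
      finally show ?thesis by simp
    qed
    show "continuous_on UNIV (\<eta> n)" for n unfolding \<eta>_def
      by (intro continuous_on_compose2[OF cont(1)] continuous_intros) auto
    show "continuous_on UNIV (\<eta>' n)" for n unfolding \<eta>'_def
      by (intro continuous_intros continuous_on_compose2[OF cont(2)]) auto
    have "b 0 = 1" by (simp add: b_def hump flip: of_real_mult exp_add)
    moreover have "(\<lambda>n. \<eta> n x) \<longlonglongrightarrow> b 0" for x
      unfolding \<eta>_def
      by (rule isCont_tendsto_compose[of 0 b]) (use cont(1) lim0 in \<open>auto simp: continuous_on_eq_continuous_at\<close>)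
    ultimately show "(\<lambda>n. \<eta> n x) \<longlonglongrightarrow> 1" for x by simp
    show "(\<lambda>n. \<eta>' n x) \<longlonglongrightarrow> 0" for x
    proof (rule Lim_null_comparison)
      show "\<forall>\<^sub>F n in sequentially. norm (\<eta>' n x) \<le> inverse (real (Suc n)) * C2"
        unfolding \<eta>'_def using C2 by (auto intro!: mult_left_mono simp del: of_nat_Suc)
      show "(\<lambda>n. inverse (real (Suc n)) * C2) \<longlonglongrightarrow> 0" by (rule lim0)
    qed
    show "\<exists>R>0. \<forall>x. \<bar>x\<bar> > R \<longrightarrow> \<eta> n x = 0 \<and> \<eta>' n x = 0" for n
      using zero' R(1) by (intro exI[of _ "real (Suc n) * R"]) auto
  qed (use C1 in auto)
qed

section \<open>Plancherel's theorem on the line\<close>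

lemma lborel_real_affine_L2:
  assumes "f \<in> L2 lborel" "c \<noteq> 0"
  shows "(\<lambda>x::real. f (t + c * x)) \<in> L2 lborel"
    and "l2_norm lborel f = sqrt \<bar>c\<bar> * l2_norm lborel (\<lambda>x. f (t + c * x))"
proof -
  have [measurable]: "f \<in> borel_measurable borel" using L2_measurable[OF assms(1)] by simp
  show "(\<lambda>x. f (t + c * x)) \<in> L2 lborel"
    using lborel_integrable_real_affine[OF L2_integrable[OF assms(1)] assms(2)] by (simp add: L2_def)
  show "l2_norm lborel f = sqrt \<bar>c\<bar> * l2_norm lborel (\<lambda>x. f (t + c * x))"
    unfolding l2_norm_def by (subst lborel_integral_real_affine[OF assms(2), of _ t]) (simp add: real_sqrt_mult)
qed

lemma translate_L2:
  assumes "f \<in> L2 lborel"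
  shows "(\<lambda>x::real. f (x + t)) \<in> L2 lborel" and "l2_norm lborel (\<lambda>x. f (x + t)) = l2_norm lborel f"
  using lborel_real_affine_L2[OF assms, of 1 t] by (simp_all add: add.commute)

text \<open>By \<open>lborel_L2_induct\<close> only intervals need a computation, where convergence
  fails at most at the two endpoints. The bound 1 on the shifts supplies the common dominating
  interval \<open>{a - 1..b + 1}\<close>.\<close>

lemma translation_continuous_L2:
  assumes "u \<in> L2 lborel" "t \<longlonglongrightarrow> 0" "\<And>n::nat. \<bar>t n\<bar> \<le> 1"
  shows "(\<lambda>n. l2_norm lborel (\<lambda>x::real. u (x + t n) - u x)) \<longlonglongrightarrow> 0"
  using assms(1)
proof (rule lborel_L2_induct)
  fix X assume "X \<in> range (\<lambda>(a, b). {a..b::real})"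
  then obtain a b where X: "X = {a..b}" by auto
  show "(\<lambda>n. l2_norm lborel (\<lambda>x. indicator X (x + t n) - indicator X x)) \<longlonglongrightarrow> 0"
  proof (rule l2_norm_dominated_convergence[where c = 1])
    show "(indicator {a - 1..b + 1} :: real \<Rightarrow> complex) \<in> L2 lborel"
      by (rule L2_indicator) (auto simp: emeasure_lborel_Icc_eq)
    have "AE x in lborel. x \<noteq> a" "AE x in lborel. x \<noteq> b" by (rule AE_lborel_singleton)+
    then show "AE x in lborel. (\<lambda>n. indicator X (x + t n) :: complex) \<longlonglongrightarrow> indicator X x"
    proof eventually_elim
      case (elim x)
      have lim: "(\<lambda>n. x + t n) \<longlonglongrightarrow> x" using tendsto_add[OF tendsto_const assms(2)] by simp
      have "\<forall>\<^sub>F n in sequentially. indicator X (x + t n) = (indicator X x :: complex)"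
      proof (cases "x \<in> {a..b}")
        case True
        then have "a < x" "x < b" using elim by auto
        then have "\<forall>\<^sub>F n in sequentially. a < x + t n" "\<forall>\<^sub>F n in sequentially. x + t n < b"
          using lim order_tendstoD by blast+
        then show ?thesis by eventually_elim (use True in \<open>auto simp: X\<close>)
      next
        case False
        then consider "x < a" | "b < x" by force
        then show ?thesis
        proof cases
          case 1
          then have "\<forall>\<^sub>F n in sequentially. x + t n < a" using lim order_tendstoD by blast
          then show ?thesis by eventually_elim (use False in \<open>auto simp: X\<close>)
        next
          case 2
          then have "\<forall>\<^sub>F n in sequentially. b < x + t n" using lim order_tendstoD by blast
          then show ?thesis by eventually_elim (use False in \<open>auto simp: X\<close>)
        qed
      qed
      then show ?case by (rule tendsto_eventually)
    qed
    show "AE x in lborel. cmod (indicator X (x + t n) - indicator X x) \<le> 1 * cmod (indicator {a - 1..b + 1} x)" for n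
      using assms(3)[of n] by (intro AE_I2) (auto simp: X indicator_def)
  qed (auto simp: X)
next
  fix f g :: "real \<Rightarrow> complex" assume *: "f \<in> L2 lborel" "g \<in> L2 lborel"
    "(\<lambda>n. l2_norm lborel (\<lambda>x. f (x + t n) - f x)) \<longlonglongrightarrow> 0"
    "(\<lambda>n. l2_norm lborel (\<lambda>x. g (x + t n) - g x)) \<longlonglongrightarrow> 0"
  show "(\<lambda>n. l2_norm lborel (\<lambda>x. f (x + t n) + g (x + t n) - (f x + g x))) \<longlonglongrightarrow> 0"
  proof (rule Lim_null_comparison[OF always_eventually])
    show "\<forall>n. norm (l2_norm lborel (\<lambda>x. f (x + t n) + g (x + t n) - (f x + g x)))
      \<le> l2_norm lborel (\<lambda>x. f (x + t n) - f x) + l2_norm lborel (\<lambda>x. g (x + t n) - g x)"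
    proof
      fix n
      show "norm (l2_norm lborel (\<lambda>x. f (x + t n) + g (x + t n) - (f x + g x)))
        \<le> l2_norm lborel (\<lambda>x. f (x + t n) - f x) + l2_norm lborel (\<lambda>x. g (x + t n) - g x)"
        using l2_norm_triangle[OF L2_diff[OF translate_L2(1)[OF *(1)] *(1), of "t n"] L2_diff[OF translate_L2(1)[OF *(2)] *(2), of "t n"]]
        by (simp add: add_diff_add)
    qed
    show "(\<lambda>n. l2_norm lborel (\<lambda>x. f (x + t n) - f x) + l2_norm lborel (\<lambda>x. g (x + t n) - g x)) \<longlonglongrightarrow> 0"
      using tendsto_add[OF *(3,4)] by simp
  qed
next
  fix c and f :: "real \<Rightarrow> complex" assume "(\<lambda>n. l2_norm lborel (\<lambda>x. f (x + t n) - f x)) \<longlonglongrightarrow> 0"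
  from tendsto_mult[OF tendsto_const[of "cmod c"] this]
  show "(\<lambda>n. l2_norm lborel (\<lambda>x. c * f (x + t n) - c * f x)) \<longlonglongrightarrow> 0"
    by (simp add: l2_norm_cmult flip: right_diff_distrib)
next
  fix s and f :: "real \<Rightarrow> complex" assume *: "\<And>n::nat. s n \<in> L2 lborel"
    "\<And>k. (\<lambda>n. l2_norm lborel (\<lambda>x. s k (x + t n) - s k x)) \<longlonglongrightarrow> 0" "f \<in> L2 lborel"
    "(\<lambda>n. l2_norm lborel (\<lambda>x. s n x - f x)) \<longlonglongrightarrow> 0"
  show "(\<lambda>n. l2_norm lborel (\<lambda>x. f (x + t n) - f x)) \<longlonglongrightarrow> 0"
  proof (rule LIMSEQ_I)
    fix e :: real assume "e > 0"
    then obtain k where k: "l2_norm lborel (\<lambda>x. s k x - f x) < e / 3"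
      using LIMSEQ_D[OF *(4), of "e/3"] by force
    obtain N where N: "\<And>n. n \<ge> N \<Longrightarrow> l2_norm lborel (\<lambda>x. s k (x + t n) - s k x) < e / 3"
      using LIMSEQ_D[OF *(2)[of k], of "e/3"] \<open>e > 0\<close> by force
    have "norm (l2_norm lborel (\<lambda>x. f (x + t n) - f x) - 0) < e" if "n \<ge> N" for n
    proof -
      have "l2_norm lborel (\<lambda>x. f (x + t n) - f x) \<le>
          l2_norm lborel (\<lambda>x. f (x + t n) - s k (x + t n)) + l2_norm lborel (\<lambda>x. s k (x + t n) - f x)"
        by (rule l2_norm_triangle_diff) (use * translate_L2 in auto)
      moreover have "l2_norm lborel (\<lambda>x. s k (x + t n) - f x) \<le>
          l2_norm lborel (\<lambda>x. s k (x + t n) - s k x) + l2_norm lborel (\<lambda>x. s k x - f x)"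
        by (rule l2_norm_triangle_diff) (use * translate_L2 in auto)
      moreover have "l2_norm lborel (\<lambda>x. f (x + t n) - s k (x + t n)) = l2_norm lborel (\<lambda>x. f x - s k x)"
        using translate_L2(2)[OF L2_diff[OF *(3) *(1)]] .
      moreover have "l2_norm lborel (\<lambda>x. f x - s k x) = l2_norm lborel (\<lambda>x. s k x - f x)"
        by (rule l2_norm_diff_commute)
      ultimately show ?thesis using k N[OF that] by simp
    qed
    then show "\<exists>no. \<forall>n\<ge>no. norm (l2_norm lborel (\<lambda>x. f (x + t n) - f x) - 0) < e" by blast
  qed
qed

lemma integrable_pair_mult:
  fixes f g :: "_ \<Rightarrow> complex"
  assumes "sigma_finite_measure M" "sigma_finite_measure N" "integrable M f" "integrable N g"
  shows "integrable (M \<Otimes>\<^sub>M N) (\<lambda>p. f (fst p) * g (snd p))"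
proof -
  interpret pair_sigma_finite M N using assms by (simp add: pair_sigma_finite_def)
  have [measurable]: "f \<in> borel_measurable M" "g \<in> borel_measurable N" using assms by auto
  show ?thesis
    by (rule Fubini_integrable) (use assms in \<open>auto simp: norm_mult\<close>)
qed

text \<open>The integral is read off from the characteristic function of the standard normal law
  after rescaling. The result is phrased with \<open>std_normal_density\<close> because its total
  mass 1 later identifies the limit as the width tends to 0.\<close>

lemma gaussian_integral:
  assumes "\<sigma> > 0"
  shows "(LINT \<xi>|lborel. of_real (exp (- (\<sigma> * \<xi>)\<^sup>2 / 2)) * cis (s * \<xi>)) =
    of_real (2 * pi / \<sigma> * std_normal_density (s / \<sigma>))"
proof -
  have "of_real (exp (- t\<^sup>2 / 2)) = (LINT x|lborel. of_real (std_normal_density x) * cis (t * x))" for t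
    using fun_cong[OF char_std_normal_distribution, of t, symmetric]
    by (simp add: char_def integral_density scaleR_conv_of_real cis_conv_exp mult_ac)
  moreover have "(LINT x|lborel. of_real (std_normal_density x) * cis (t * x)) =
      of_real (1 / sqrt (2 * pi)) * (LINT x|lborel. of_real (exp (- x\<^sup>2 / 2)) * cis (t * x))" for t
    unfolding integral_mult_right_zero[symmetric] std_normal_density_def of_real_mult mult.assoc ..
  ultimately have *: "of_real (exp (- t\<^sup>2 / 2)) = of_real (1 / sqrt (2 * pi)) * (LINT x|lborel. of_real (exp (- x\<^sup>2 / 2)) * cis (t * x))" for t
    by (rule trans)
  have "(LINT \<xi>|lborel. of_real (exp (- (\<sigma> * \<xi>)\<^sup>2 / 2)) * cis (s * \<xi>)) =
      of_real (1 / \<sigma>) * (LINT \<xi>|lborel. of_real (exp (- \<xi>\<^sup>2 / 2)) * cis (s / \<sigma> * \<xi>))"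
    using assms by (subst lborel_integral_real_affine[of "1/\<sigma>" _ 0]) (simp_all add: scaleR_conv_of_real)
  also have "(LINT \<xi>|lborel. of_real (exp (- \<xi>\<^sup>2 / 2)) * cis (s / \<sigma> * \<xi>)) = of_real (sqrt (2 * pi)) * of_real (exp (- (s / \<sigma>)\<^sup>2 / 2))"
    unfolding *[of "s / \<sigma>"] by simp
  also have "of_real (1 / \<sigma>) * (of_real (sqrt (2 * pi)) * of_real (exp (- (s / \<sigma>)\<^sup>2 / 2))) =
      complex_of_real (2 * pi / \<sigma> * std_normal_density (s / \<sigma>))"
  proof -
    have "1 / \<sigma> * (q * E) = (q * q) / \<sigma> * (1 / q * E)" if "q \<noteq> 0" for q E
      using that by (simp add: field_simps)
    from this[of "sqrt (2 * pi)"]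
    have "1 / \<sigma> * (sqrt (2 * pi) * exp (- (s / \<sigma>)\<^sup>2 / 2)) = 2 * pi / \<sigma> * std_normal_density (s / \<sigma>)"
      unfolding std_normal_density_def by (simp only: real_sqrt_mult_self) simp
    then show ?thesis by (simp only: of_real_mult[symmetric])
  qed
  finally show ?thesis .
qed

lemma gaussian_integrable:
  assumes "\<sigma> > 0"
  shows "integrable lborel (\<lambda>\<xi>. complex_of_real (exp (- (\<sigma> * \<xi>)\<^sup>2 / 2)))"
proof -
  have "integrable lborel (\<lambda>\<xi>. complex_of_real (sqrt (2 * pi) * std_normal_density \<xi>))"
    by (intro integrable_of_real integrable_mult_right integrable_normal_density) simp
  moreover have "sqrt (2 * pi) * std_normal_density \<xi> = exp (- \<xi>\<^sup>2 / 2)" for \<xi>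
    by (simp add: std_normal_density_def)
  ultimately have "integrable lborel (\<lambda>\<xi>. complex_of_real (exp (- \<xi>\<^sup>2 / 2)))" by (simp only:)
  from lborel_integrable_real_affine[OF this, of \<sigma> 0] show ?thesis using assms by simp
qed

definition ft1 :: "(real \<Rightarrow> complex) \<Rightarrow> real \<Rightarrow> complex" where
  "ft1 u \<xi> = of_real (1 / sqrt (2 * pi)) * (LINT x|lborel. u x * cis (- (x * \<xi>)))"

lemma integrable_mult_cis:
  assumes "integrable lborel u"
  shows "integrable lborel (\<lambda>x. u x * cis (a * x))"
  using assms by (rule Bochner_Integration.integrable_bound) (use assms in \<open>auto simp: norm_mult\<close>)

lemma ft1_measurable [measurable]:
  assumes [measurable]: "u \<in> borel_measurable borel"
  shows "ft1 u \<in> borel_measurable borel"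
  unfolding ft1_def by measurable

text \<open>
  The Gaussian weight makes Fubini applicable to \<open>|ft1 u|\<^sup>2\<close> and turns its integral into a Gaussian
  average of the autocorrelation of \<open>u\<close>, which converges by continuity of translations.
\<close>
lemma ft1_regularized:
  assumes u: "integrable lborel u" "u \<in> L2 lborel" and \<sigma>: "\<sigma> > 0"
  shows "(LINT \<xi>|lborel. of_real (exp (- (\<sigma> * \<xi>)\<^sup>2 / 2)) * (ft1 u \<xi> * cnj (ft1 u \<xi>))) =
    (LINT \<tau>|lborel. of_real (std_normal_density \<tau>) * l2_inner lborel u (\<lambda>x. u (x + \<sigma> * \<tau>)))"
proof -
  have um [measurable]: "u \<in> borel_measurable borel" using u by auto
  let ?w = "\<lambda>\<xi>. complex_of_real (exp (- (\<sigma> * \<xi>)\<^sup>2 / 2))"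
  let ?n = "\<lambda>\<tau>. complex_of_real (std_normal_density \<tau>)"
  let ?M = "lborel \<Otimes>\<^sub>M (lborel :: real measure)"
  have sfM: "sigma_finite_measure ?M" unfolding lborel_prod by (rule sigma_finite_lborel)
  interpret P: pair_sigma_finite "lborel :: real measure" ?M
    by (intro pair_sigma_finite.intro sfM sigma_finite_lborel)
  have cu: "integrable lborel (\<lambda>x. cnj (u x))" using u by simp
  have int2: "integrable ?M (\<lambda>p. u (fst p) * cnj (u (snd p)))"
    using integrable_pair_mult[OF sigma_finite_lborel sigma_finite_lborel u(1) cu] .
  define H where "H \<xi> p = ?w \<xi> * (u (fst p) * cnj (u (snd p))) * cis ((snd p - fst p) * \<xi>)" for \<xi> and p :: "real \<times> real"
  have Hm [measurable]: "(\<lambda>(\<xi>, p). H \<xi> p) \<in> borel_measurable (lborel \<Otimes>\<^sub>M ?M)"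
    unfolding H_def cis_conv_exp by measurable
  have intH: "integrable (lborel \<Otimes>\<^sub>M ?M) (\<lambda>(\<xi>, p). H \<xi> p)"
  proof (rule Bochner_Integration.integrable_bound)
    show "integrable (lborel \<Otimes>\<^sub>M ?M) (\<lambda>q. ?w (fst q) * (\<lambda>p. u (fst p) * cnj (u (snd p))) (snd q))"
      by (rule integrable_pair_mult[OF sigma_finite_lborel sfM gaussian_integrable[OF \<sigma>] int2])
  qed (auto simp: H_def norm_mult)
  have 1: "2 * pi * (ft1 u \<xi> * cnj (ft1 u \<xi>)) * ?w \<xi> = (LINT p|?M. H \<xi> p)" for \<xi>
  proof -
    have "integrable ?M (\<lambda>p. (u (fst p) * cis (- \<xi> * fst p)) * (cnj (u (snd p)) * cis (\<xi> * snd p)))"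
      by (rule integrable_pair_mult[OF sigma_finite_lborel sigma_finite_lborel
            integrable_mult_cis[OF u(1)] integrable_mult_cis[OF cu]])
    then have i: "integrable ?M (\<lambda>(x, x'). (u x * cis (- \<xi> * x)) * (cnj (u x') * cis (\<xi> * x')))"
      by (simp add: case_prod_unfold)
    have "(LINT p|?M. H \<xi> p) = ?w \<xi> * (LINT p|?M. (u (fst p) * cis (- \<xi> * fst p)) * (cnj (u (snd p)) * cis (\<xi> * snd p)))"
      unfolding H_def
    proof (subst Bochner_Integration.integral_mult_right_zero[symmetric], rule Bochner_Integration.integral_cong)
      fix p :: "real \<times> real"
      have "cis ((snd p - fst p) * \<xi>) = cis (- \<xi> * fst p) * cis (\<xi> * snd p)"
        unfolding cis_mult by (simp add: algebra_simps)
      then show "?w \<xi> * (u (fst p) * cnj (u (snd p))) * cis ((snd p - fst p) * \<xi>) =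
          ?w \<xi> * (u (fst p) * cis (- \<xi> * fst p) * (cnj (u (snd p)) * cis (\<xi> * snd p)))"
        by (simp only: mult_ac)
    qed simp
    also have "(LINT p|?M. (u (fst p) * cis (- \<xi> * fst p)) * (cnj (u (snd p)) * cis (\<xi> * snd p))) =
        (LINT x|lborel. LINT x'|lborel. (u x * cis (- \<xi> * x)) * (cnj (u x') * cis (\<xi> * x')))"
      using lborel_pair.integral_fst[OF i] by (simp add: case_prod_unfold)
    also have "\<dots> = (LINT x|lborel. u x * cis (- \<xi> * x)) * (LINT x'|lborel. cnj (u x') * cis (\<xi> * x'))"
      by simp
    also have "(LINT x'|lborel. cnj (u x') * cis (\<xi> * x')) = cnj (LINT x|lborel. u x * cis (- \<xi> * x))"
      by (subst Bochner_Integration.integral_cnj[symmetric]) (simp add: cis_cnj)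
    finally show ?thesis
      unfolding ft1_def by (simp add: mult_ac flip: of_real_mult)
  qed
  \<comment> \<open>Integrating over the frequency first leaves a Gaussian of width
    \<open>\<sigma>\<close> in the difference of the two positions: an approximate identity.\<close>
  have 2: "(LINT \<xi>|lborel. H \<xi> p) = u (fst p) * cnj (u (snd p)) * of_real (2 * pi / \<sigma> * std_normal_density ((snd p - fst p) / \<sigma>))" for p
  proof -
    have "(LINT \<xi>|lborel. H \<xi> p) = (LINT \<xi>|lborel. (u (fst p) * cnj (u (snd p))) * (?w \<xi> * cis ((snd p - fst p) * \<xi>)))"
      unfolding H_def by (intro Bochner_Integration.integral_cong) (auto simp: mult_ac)
    then show ?thesis using gaussian_integral[OF \<sigma>, of "snd p - fst p"] by simp
  qed
  have int3: "integrable ?M (\<lambda>p. LINT \<xi>|lborel. H \<xi> p)" by (rule P.integrable_snd[OF intH])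
  have inner: "(LINT x'|lborel. LINT \<xi>|lborel. H \<xi> (x, x')) =
      2 * pi * (LINT \<tau>|lborel. ?n \<tau> * (u x * cnj (u (x + \<sigma> * \<tau>))))" for x
  proof -
    \<comment> \<open>The substitution x' = x + \<open>\<sigma>\<close> \<open>\<tau>\<close>
      absorbs the factor 1 / \<open>\<sigma>\<close>, and the remaining weight no longer depends on
      \<open>\<sigma>\<close>.\<close>
    define f where "f x' = u x * cnj (u x') * of_real (2 * pi / \<sigma> * std_normal_density ((x' - x) / \<sigma>))" for x'
    have "f (x + \<sigma> * \<tau>) = of_real (2 * pi / \<sigma>) * (?n \<tau> * (u x * cnj (u (x + \<sigma> * \<tau>))))" for \<tau>
      using \<sigma> by (simp add: f_def)
    then have "(LINT x'|lborel. f x') =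
        \<bar>\<sigma>\<bar> *\<^sub>R (LINT \<tau>|lborel. of_real (2 * pi / \<sigma>) * (?n \<tau> * (u x * cnj (u (x + \<sigma> * \<tau>)))))"
      using \<sigma> by (subst lborel_integral_real_affine[of \<sigma> _ x]) simp_all
    also have "\<dots> = 2 * pi * (LINT \<tau>|lborel. ?n \<tau> * (u x * cnj (u (x + \<sigma> * \<tau>))))"
      unfolding integral_mult_right_zero using \<sigma> by (simp add: scaleR_conv_of_real)
    finally show ?thesis unfolding 2 f_def by simp
  qed
  have "2 * pi * (LINT \<xi>|lborel. ?w \<xi> * (ft1 u \<xi> * cnj (ft1 u \<xi>))) = (LINT \<xi>|lborel. LINT p|?M. H \<xi> p)"
    unfolding 1[symmetric] by (simp add: mult_ac flip: integral_mult_right_zero)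
  also have "\<dots> = (LINT p|?M. LINT \<xi>|lborel. H \<xi> p)"
    by (rule P.Fubini_integral[OF intH, symmetric])
  also have "\<dots> = (LINT x|lborel. LINT x'|lborel. LINT \<xi>|lborel. H \<xi> (x, x'))"
    using lborel_pair.integral_fst'[OF int3] by simp
  also have "\<dots> = 2 * pi * (LINT x|lborel. LINT \<tau>|lborel. ?n \<tau> * (u x * cnj (u (x + \<sigma> * \<tau>))))"
    unfolding inner by simp
  also have "(LINT x|lborel. LINT \<tau>|lborel. ?n \<tau> * (u x * cnj (u (x + \<sigma> * \<tau>)))) =
      (LINT \<tau>|lborel. LINT x|lborel. ?n \<tau> * (u x * cnj (u (x + \<sigma> * \<tau>))))"
  proof (rule lborel_pair.Fubini_integral)
    \<comment> \<open>By Cauchy-Schwarz and translation invariance the autocorrelation of the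
      absolute values is bounded uniformly in the shift, which gives the integrability needed for
      exchanging the integrals.\<close>
    have nu: "(LINT x|lborel. cmod (u x) * cmod (u (x + t))) \<le> (l2_norm lborel u)\<^sup>2" for t
      using integral_cmod_mult_le[OF u(2) translate_L2(1)[OF u(2)]] translate_L2(2)[OF u(2)]
      by (simp add: power2_eq_square)
    show "integrable ?M (\<lambda>(\<tau>, x). ?n \<tau> * (u x * cnj (u (x + \<sigma> * \<tau>))))"
    proof (rule lborel_pair.Fubini_integrable)
      show "integrable lborel (\<lambda>\<tau>. LINT x|lborel. norm (case (\<tau>, x) of (\<tau>, x) \<Rightarrow> ?n \<tau> * (u x * cnj (u (x + \<sigma> * \<tau>)))))"
      proof (rule Bochner_Integration.integrable_bound)
        show "integrable lborel (\<lambda>\<tau>. std_normal_density \<tau> * (l2_norm lborel u)\<^sup>2)" by simp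
        show "AE \<tau> in lborel. norm (LINT x|lborel. norm (case (\<tau>, x) of (\<tau>, x) \<Rightarrow> ?n \<tau> * (u x * cnj (u (x + \<sigma> * \<tau>)))))
            \<le> norm (std_normal_density \<tau> * (l2_norm lborel u)\<^sup>2)"
        proof (rule AE_I2)
          fix \<tau> :: real
          have "(LINT x|lborel. norm (?n \<tau> * (u x * cnj (u (x + \<sigma> * \<tau>))))) =
              std_normal_density \<tau> * (LINT x|lborel. cmod (u x) * cmod (u (x + \<sigma> * \<tau>)))"
            by (simp add: norm_mult)
          also have "\<dots> \<le> std_normal_density \<tau> * (l2_norm lborel u)\<^sup>2"
            using nu by (intro mult_left_mono) auto
          finally have "(LINT x|lborel. norm (?n \<tau> * (u x * cnj (u (x + \<sigma> * \<tau>))))) \<le> std_normal_density \<tau> * (l2_norm lborel u)\<^sup>2" .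
          moreover have "0 \<le> (LINT x|lborel. norm (?n \<tau> * (u x * cnj (u (x + \<sigma> * \<tau>)))))" by simp
          ultimately show "norm (LINT x|lborel. norm (case (\<tau>, x) of (\<tau>, x) \<Rightarrow> ?n \<tau> * (u x * cnj (u (x + \<sigma> * \<tau>)))))
            \<le> norm (std_normal_density \<tau> * (l2_norm lborel u)\<^sup>2)" by simp
        qed
      qed simp
      show "AE \<tau> in lborel. integrable lborel (\<lambda>x. case (\<tau>, x) of (\<tau>, x) \<Rightarrow> ?n \<tau> * (u x * cnj (u (x + \<sigma> * \<tau>))))"
        using integrable_L2_cnj[OF u(2) translate_L2(1)[OF u(2)]] by (intro AE_I2) simp
    qed measurable
  qed
  also have "\<dots> = (LINT \<tau>|lborel. ?n \<tau> * l2_inner lborel u (\<lambda>x. u (x + \<sigma> * \<tau>)))"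
    by (simp add: l2_inner_def)
  finally show ?thesis by simp
qed

text \<open>Let \<open>\<sigma>\<close> decrease to 0 in \<open>ft1_regularized\<close>. The
  right-hand side converges to the squared norm of \<open>u\<close> by dominated convergence. On the
  left the weights increase to 1, so monotone convergence yields integrability of the squared
  transform together with its integral.\<close>

theorem plancherel_line:
  assumes u: "integrable lborel u" "u \<in> L2 lborel"
  shows "ft1 u \<in> L2 lborel" "l2_norm lborel (ft1 u) = l2_norm lborel u"
proof -
  have um [measurable]: "u \<in> borel_measurable borel" using u by auto
  define \<sigma> where "\<sigma> n = inverse (real (Suc n))" for n
  have \<sigma>: "\<sigma> n > 0" "\<sigma> n \<le> 1" for n by (auto simp: \<sigma>_def field_simps)
  have \<sigma>0: "\<sigma> \<longlonglongrightarrow> 0" unfolding \<sigma>_def by (rule LIMSEQ_inverse_real_of_nat)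
  have \<sigma>mono: "\<sigma> (Suc n) \<le> \<sigma> n" for n by (simp add: \<sigma>_def field_simps)
  let ?A = "\<lambda>t. l2_inner lborel u (\<lambda>x. u (x + t))"
  have A: "cmod (?A t) \<le> (l2_norm lborel u)\<^sup>2" for t
    using l2_Cauchy_Schwarz[OF u(2) translate_L2(1)[OF u(2)]] translate_L2(2)[OF u(2)]
    by (simp add: power2_eq_square)
  have Alim: "(\<lambda>n. ?A (\<sigma> n * \<tau>)) \<longlonglongrightarrow> of_real ((l2_norm lborel u)\<^sup>2)" for \<tau>
  proof -
    have t0: "(\<lambda>n. \<sigma> n * \<tau>) \<longlonglongrightarrow> 0" using tendsto_mult_right[OF \<sigma>0, of \<tau>] by simp
    \<comment> \<open>\<open>translation_continuous_L2\<close> expects shifts of size at most 1, so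
      finitely many initial indices are dropped.\<close>
    then obtain N where N: "\<And>n. n \<ge> N \<Longrightarrow> \<bar>\<sigma> n * \<tau>\<bar> \<le> 1"
      using LIMSEQ_D[OF t0, of 1] by force
    have "(\<lambda>n. l2_norm lborel (\<lambda>x. u (x + \<sigma> (n + N) * \<tau>) - u x)) \<longlonglongrightarrow> 0"
      by (rule translation_continuous_L2[OF u(2) LIMSEQ_ignore_initial_segment[OF t0]]) (use N in auto)
    then have "(\<lambda>n. ?A (\<sigma> (n + N) * \<tau>)) \<longlonglongrightarrow> l2_inner lborel u u"
      by (intro l2_inner_tendsto_right translate_L2 u)
    then have "(\<lambda>n. ?A (\<sigma> n * \<tau>)) \<longlonglongrightarrow> l2_inner lborel u u" by (rule LIMSEQ_offset)
    then show ?thesis by (simp add: l2_inner_self)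
  qed
  have "(\<lambda>n. LINT \<tau>|lborel. of_real (std_normal_density \<tau>) * ?A (\<sigma> n * \<tau>)) \<longlonglongrightarrow>
      (LINT \<tau>|lborel. of_real (std_normal_density \<tau>) * of_real ((l2_norm lborel u)\<^sup>2))"
  proof (rule integral_dominated_convergence)
    show "integrable lborel (\<lambda>\<tau>. std_normal_density \<tau> * (l2_norm lborel u)\<^sup>2)" by simp
    show "AE x in lborel. (\<lambda>n. complex_of_real (std_normal_density x) * ?A (\<sigma> n * x)) \<longlonglongrightarrow>
        of_real (std_normal_density x) * of_real ((l2_norm lborel u)\<^sup>2)"
      using Alim by (intro AE_I2 tendsto_mult tendsto_const)
    show "AE x in lborel. norm (complex_of_real (std_normal_density x) * ?A (\<sigma> n * x)) \<le> std_normal_density x * (l2_norm lborel u)\<^sup>2" for n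
      using A by (intro AE_I2) (auto simp: norm_mult intro!: mult_left_mono)
  qed (auto simp: l2_inner_def)
  also have "(LINT \<tau>|lborel. of_real (std_normal_density \<tau>) * of_real ((l2_norm lborel u)\<^sup>2)) = complex_of_real ((l2_norm lborel u)\<^sup>2)"
    unfolding of_real_mult[symmetric] integral_complex_of_real by simp
  finally have lim: "(\<lambda>n. LINT \<xi>|lborel. of_real (exp (- (\<sigma> n * \<xi>)\<^sup>2 / 2)) * (ft1 u \<xi> * cnj (ft1 u \<xi>))) \<longlonglongrightarrow> of_real ((l2_norm lborel u)\<^sup>2)"
    by (simp only: ft1_regularized[OF u \<sigma>(1)])
  define h where "h n \<xi> = exp (- (\<sigma> n * \<xi>)\<^sup>2 / 2) * (cmod (ft1 u \<xi>))\<^sup>2" for n \<xi>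
  have hc: "of_real (h n \<xi>) = of_real (exp (- (\<sigma> n * \<xi>)\<^sup>2 / 2)) * (ft1 u \<xi> * cnj (ft1 u \<xi>))" for n \<xi>
    by (simp only: h_def of_real_mult complex_norm_square)
  have [measurable]: "h n \<in> borel_measurable borel" for n unfolding h_def by measurable
  have bdd: "cmod (ft1 u \<xi>) \<le> 1 / sqrt (2 * pi) * (LINT x|lborel. cmod (u x))" for \<xi>
  proof -
    have "cmod (LINT x|lborel. u x * cis (- (x * \<xi>))) \<le> (LINT x|lborel. cmod (u x * cis (- (x * \<xi>))))"
      by (rule integral_norm_bound)
    also have "\<dots> = (LINT x|lborel. cmod (u x))" by (simp add: norm_mult)
    finally show ?thesis unfolding ft1_def by (simp add: norm_mult norm_divide divide_right_mono)
  qed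
  \<comment> \<open>The transform of an integrable function is bounded by a multiple of its L1 norm,
    so the Gaussian weight alone ensures integrability.\<close>
  have hint: "integrable lborel (h n)" for n
  proof (rule Bochner_Integration.integrable_bound)
    show "integrable lborel (\<lambda>\<xi>. complex_of_real (exp (- (\<sigma> n * \<xi>)\<^sup>2 / 2)) * of_real ((1 / sqrt (2 * pi) * (LINT x|lborel. cmod (u x)))\<^sup>2))"
      using gaussian_integrable[OF \<sigma>(1)] by (rule integrable_mult_left)
    show "AE x in lborel. norm (h n x) \<le> norm (complex_of_real (exp (- (\<sigma> n * x)\<^sup>2 / 2)) * of_real ((1 / sqrt (2 * pi) * (LINT x|lborel. cmod (u x)))\<^sup>2))"
      unfolding h_def norm_mult norm_of_real using bdd
      by (intro AE_I2) (auto simp: abs_mult intro!: mult_left_mono power_mono simp del: power_mult_distrib)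
  qed simp
  have "(\<lambda>n. complex_of_real (LINT \<xi>|lborel. h n \<xi>)) \<longlonglongrightarrow> of_real ((l2_norm lborel u)\<^sup>2)"
    using lim unfolding hc[symmetric] integral_complex_of_real .
  from tendsto_Re[OF this] have hlim: "(\<lambda>n. LINT \<xi>|lborel. h n \<xi>) \<longlonglongrightarrow> (l2_norm lborel u)\<^sup>2" by simp
  have hptw: "(\<lambda>n. h n \<xi>) \<longlonglongrightarrow> (cmod (ft1 u \<xi>))\<^sup>2" for \<xi>
  proof -
    have "(\<lambda>n. h n \<xi>) \<longlonglongrightarrow> exp (- (0 * \<xi>)\<^sup>2 / 2) * (cmod (ft1 u \<xi>))\<^sup>2"
      unfolding h_def by (intro tendsto_intros \<sigma>0) simp
    then show ?thesis by simp
  qed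
  have mono: "mono (\<lambda>n. h n \<xi>)" for \<xi>
  proof (rule incseq_SucI)
    fix n
    have "(\<sigma> (Suc n) * \<xi>)\<^sup>2 \<le> (\<sigma> n * \<xi>)\<^sup>2"
      unfolding power_mult_distrib using \<sigma> \<sigma>mono by (intro mult_right_mono power_mono) (auto simp: less_imp_le)
    then show "h n \<xi> \<le> h (Suc n) \<xi>" unfolding h_def by (intro mult_right_mono) auto
  qed
  have "has_bochner_integral lborel (\<lambda>\<xi>. (cmod (ft1 u \<xi>))\<^sup>2) ((l2_norm lborel u)\<^sup>2)"
    by (rule has_bochner_integral_monotone_convergence[OF hint _ _ hlim])
       (use mono hptw in auto)
  then have "integrable lborel (\<lambda>\<xi>. (cmod (ft1 u \<xi>))\<^sup>2)" "(LINT \<xi>|lborel. (cmod (ft1 u \<xi>))\<^sup>2) = (l2_norm lborel u)\<^sup>2"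
    by (auto simp: has_bochner_integral_iff)
  then show "ft1 u \<in> L2 lborel" "l2_norm lborel (ft1 u) = l2_norm lborel u"
    by (auto simp: L2_def l2_norm_def)
qed

section \<open>Fourier transform on the strip\<close>

lemma space_strip [simp]: "space strip_M = UNIV \<times> {0..1}"
  by (simp add: space_pair_measure)

lemma finite_unit_M: "finite_measure unit_M"
  by (rule finite_measureI) (simp add: emeasure_restrict_space)

interpretation unit_M: finite_measure unit_M
  by (rule finite_unit_M)

interpretation strip: pair_sigma_finite "lborel :: real measure" unit_M
  by (intro pair_sigma_finite.intro sigma_finite_lborel unit_M.sigma_finite_measure_axioms)

lemma slice_measurable:
  "f \<in> measurable strip_M N \<Longrightarrow> y \<in> {0..1} \<Longrightarrow> (\<lambda>x. f (x, y)) \<in> measurable borel N"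
  using measurable_compose[OF measurable_Pair2'[of y unit_M lborel], of f N] by simp

lemma nn_integral_strip:
  "f \<in> borel_measurable strip_M \<Longrightarrow> (\<integral>\<^sup>+p. f p \<partial>strip_M) = (\<integral>\<^sup>+y. (\<integral>\<^sup>+x. f (x, y) \<partial>lborel) \<partial>unit_M)"
  by (rule strip.nn_integral_snd[symmetric])

lemma AE_strip_I:
  assumes "AE y in unit_M. P y" shows "AE p in strip_M. P (snd p)"
proof -
  obtain N where N: "N \<in> null_sets unit_M" "{y \<in> space unit_M. \<not> P y} \<subseteq> N"
    using assms unfolding eventually_ae_filter by blast
  show ?thesis
  proof (rule AE_I')
    show "UNIV \<times> N \<in> null_sets strip_M"
      using unit_M.times_in_null_sets2[OF _ N(1), of UNIV "lborel :: real measure"] by simp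
    show "{p \<in> space strip_M. \<not> P (snd p)} \<subseteq> UNIV \<times> N" using N(2) by auto
  qed
qed

lemma AE_integrable_slice:
  fixes f :: "_ \<Rightarrow> 'b :: {banach, second_countable_topology}"
  assumes "integrable strip_M f"
  shows "AE y in unit_M. integrable lborel (\<lambda>x. f (x, y))"
  by (rule strip.AE_integrable_snd) (use assms in \<open>simp add: case_prod_unfold\<close>)

lemma AE_L2_slice:
  assumes "f \<in> L2 strip_M"
  shows "AE y in unit_M. (\<lambda>x. f (x, y)) \<in> L2 lborel"
  using AE_integrable_slice[OF L2_integrable[OF assms]] AE_space
proof eventually_elim
  case (elim y)
  then show ?case using slice_measurable[OF L2_measurable[OF assms], of y] by (simp add: L2_def)
qed

lemma integral_strip:
  fixes f :: "_ \<Rightarrow> 'b :: {banach, second_countable_topology}"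
  assumes "integrable strip_M f"
  shows "(LINT p|strip_M. f p) = (LINT y|unit_M. LINT x|lborel. f (x, y))"
  using strip.integral_snd[of "\<lambda>x y. f (x, y)"] assms by (simp add: case_prod_unfold)

lemma l2_inner_strip:
  assumes "f \<in> L2 strip_M" "g \<in> L2 strip_M"
  shows "l2_inner strip_M f g = (LINT y|unit_M. l2_inner lborel (\<lambda>x. f (x, y)) (\<lambda>x. g (x, y)))"
  unfolding l2_inner_def by (rule integral_strip[OF integrable_L2_cnj[OF assms]])

text \<open>The first side is an interval so that its indicator can be approximated by test
  functions. The second is an arbitrary measurable set, so that pairings localise in the second
  variable.\<close>

definition rectangles :: "(real \<times> real) set set" where
  "rectangles = {{a..b} \<times> B | a b B. B \<in> sets unit_M}"

lemma rectangles:
  shows "Int_stable rectangles"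
    and "rectangles \<subseteq> Pow (space strip_M)"
    and "sets strip_M = sigma_sets (space strip_M) rectangles"
    and "\<And>n. {- real n..real n} \<times> {0..1} \<in> rectangles"
    and "incseq (\<lambda>n. {- real n..real n} \<times> {0..1::real})"
    and "(\<Union>n. {- real n..real n} \<times> {0..1}) = space strip_M"
    and "\<And>X. X \<in> rectangles \<Longrightarrow> emeasure strip_M X < \<infinity>"
proof -
  have un: "{0..1} \<in> sets unit_M" using sets.top[of unit_M] by simp
  show n: "{- real n..real n} \<times> {0..1} \<in> rectangles" for n
    unfolding rectangles_def using un by blast
  have sub: "B \<subseteq> {0..1}" if "B \<in> sets unit_M" for B
    using sets.sets_into_space[OF that] by simp
  then show "rectangles \<subseteq> Pow (space strip_M)" by (auto simp: rectangles_def)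
  show "incseq (\<lambda>n. {- real n..real n} \<times> {0..1::real})" by (auto simp: incseq_def)
  have "(\<Union>n. {- real n..real n} \<times> {0..1::real}) = (\<Union>n. {- real n..real n}) \<times> {0..1}" by blast
  then show "(\<Union>n. {- real n..real n} \<times> {0..1}) = space strip_M" using lborel_intervals(6) by simp
  show "emeasure strip_M X < \<infinity>" if X: "X \<in> rectangles" for X
  proof -
    obtain a b B where X: "X = {a..b} \<times> B" "B \<in> sets unit_M" using X by (auto simp: rectangles_def)
    have "emeasure strip_M X = emeasure lborel {a..b} * emeasure unit_M B"
      unfolding X(1) by (rule unit_M.emeasure_pair_measure_Times) (use X in auto)
    also have "\<dots> < \<infinity>"
      using unit_M.emeasure_finite[of B] unfolding infinity_ennreal_def less_top
      by (simp add: ennreal_mult_less_top emeasure_lborel_Icc_eq)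
    finally show ?thesis .
  qed
  show "Int_stable rectangles"
  proof (rule Int_stableI)
    fix X Y assume "X \<in> rectangles" "Y \<in> rectangles"
    then obtain a b B a' b' B' where *: "X = {a..b} \<times> B" "B \<in> sets unit_M" "Y = {a'..b'} \<times> B'" "B' \<in> sets unit_M"
      unfolding rectangles_def by blast
    have "X \<inter> Y = {max a a'..min b b'} \<times> (B \<inter> B')" unfolding * by auto
    then show "X \<inter> Y \<in> rectangles" unfolding rectangles_def using * sets.Int by blast
  qed
  have "sets strip_M = sets (sigma (space lborel \<times> space unit_M)
      {a \<times> b | a b. a \<in> range (\<lambda>(a, b). {a..b::real}) \<and> b \<in> sets unit_M})"
  proof (rule sets_pair_eq)
    show "range (\<lambda>n. {- real n..real n}) \<subseteq> range (\<lambda>(a, b). {a..b})" using lborel_intervals(4) by blast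
    show "sets unit_M \<subseteq> Pow (space unit_M)" by (rule sets.space_closed)
    show "sets unit_M = sigma_sets (space unit_M) (sets unit_M)" by (rule sets.sigma_sets_eq[symmetric])
    show "{space unit_M} \<subseteq> sets unit_M" using un by simp
  qed (use lborel_intervals in auto)
  also have "{a \<times> b | a b. a \<in> range (\<lambda>(a, b). {a..b::real}) \<and> b \<in> sets unit_M} = rectangles"
    unfolding rectangles_def by fast
  also have "sets (sigma (space lborel \<times> space unit_M) rectangles) = sigma_sets (space strip_M) rectangles"
    using \<open>rectangles \<subseteq> Pow (space strip_M)\<close> by (subst sets_measure_of) auto
  finally show "sets strip_M = sigma_sets (space strip_M) rectangles" .
qed

lemma strip_orthogonal_zero:
  assumes "f \<in> L2 strip_M" "\<And>X. X \<in> rectangles \<Longrightarrow> l2_inner strip_M (indicator X) f = 0"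
  shows "AE p in strip_M. f p = 0"
  by (rule L2_orthogonal_zero[OF assms(1) assms(2) rectangles(1-3) rectangles(7) rectangles(4-6)])

lemma rectangle_L2: "X \<in> rectangles \<Longrightarrow> (indicator X :: _ \<Rightarrow> complex) \<in> L2 strip_M"
  using rectangles(3,7) by (intro L2_indicator) auto

text \<open>A rectangle has finite measure, so its indicator is in L2, and the product of two L2
  functions is integrable. This puts frequency-limited functions within reach of the integral
  formula for \<open>ift\<close>.\<close>

lemma integrable_bounded_support:
  assumes "f \<in> L2 strip_M" "\<And>x y. \<bar>x\<bar> > R \<Longrightarrow> f (x, y) = 0"
  shows "integrable strip_M f"
proof -
  obtain n where n: "R \<le> real n" using real_arch_simple by blast
  let ?X = "{- real n..real n} \<times> {0..1::real}"
  have "integrable strip_M (\<lambda>p. indicator ?X p * f p)"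
    using rectangle_L2[OF rectangles(4)] assms(1) by (rule integrable_L2_mult)
  moreover have "indicator ?X p * f p = f p" if "p \<in> space strip_M" for p
  proof (cases "\<bar>fst p\<bar> > R")
    case True
    then show ?thesis using assms(2)[of "fst p" "snd p"] by simp
  next
    case False
    then have "fst p \<in> {- real n..real n}" using n by (auto simp: not_less abs_le_iff)
    then show ?thesis using that by (cases p) auto
  qed
  then have "integrable strip_M (\<lambda>p. indicator ?X p * f p) = integrable strip_M f"
    by (intro Bochner_Integration.integrable_cong) auto
  ultimately show ?thesis by simp
qed

definition ft :: "(real \<times> real \<Rightarrow> complex) \<Rightarrow> real \<times> real \<Rightarrow> complex" where
  "ft u p = ft1 (\<lambda>x. u (x, snd p)) (fst p)"

text \<open>Conjugating before and after turns the kernel of \<open>ft\<close> into that of the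
  inverse transform. Plancherel's identity, additivity and measurability carry over directly;
  \<open>ift_eq\<close> gives the usual integral.\<close>

definition ift :: "(real \<times> real \<Rightarrow> complex) \<Rightarrow> real \<times> real \<Rightarrow> complex" where
  "ift k p = cnj (ft (\<lambda>q. cnj (k q)) p)"

lemma ift_eq: "ift k (x, y) = of_real (1 / sqrt (2 * pi)) * (LINT \<xi>|lborel. k (\<xi>, y) * cis (x * \<xi>))"
proof -
  have "cnj (LINT \<xi>|lborel. cnj (k (\<xi>, y)) * cis (- (\<xi> * x))) = (LINT \<xi>|lborel. k (\<xi>, y) * cis (x * \<xi>))"
    by (subst Bochner_Integration.integral_cnj[symmetric]) (simp add: cis_cnj mult.commute)
  then show ?thesis by (simp add: ift_def ft_def ft1_def)
qed

lemma ft_measurable [measurable]: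
  assumes [measurable]: "u \<in> borel_measurable strip_M"
  shows "ft u \<in> borel_measurable strip_M"
proof -
  have 1: "(\<lambda>q. (snd q, snd (fst q))) \<in> measurable (strip_M \<Otimes>\<^sub>M lborel) strip_M" by measurable
  have "(\<lambda>q. u (snd q, snd (fst q))) \<in> borel_measurable (strip_M \<Otimes>\<^sub>M lborel)"
    using measurable_compose[OF 1 assms] .
  moreover have "(\<lambda>q. cis (- (snd q * fst (fst q)))) \<in> borel_measurable (strip_M \<Otimes>\<^sub>M lborel)"
    by (rule borel_measurable_cis) measurable
  ultimately have "(\<lambda>(p, x). u (x, snd p) * cis (- (x * fst p))) \<in> borel_measurable (strip_M \<Otimes>\<^sub>M lborel)"
    unfolding case_prod_unfold by (rule borel_measurable_times)
  then have "(\<lambda>p. LINT x|lborel. u (x, snd p) * cis (- (x * fst p))) \<in> borel_measurable strip_M"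
    by (rule lborel.borel_measurable_lebesgue_integral)
  then show ?thesis unfolding ft_def[abs_def] ft1_def by (intro borel_measurable_times) auto
qed

lemma ift_measurable [measurable]:
  "u \<in> borel_measurable strip_M \<Longrightarrow> ift u \<in> borel_measurable strip_M"
  unfolding ift_def[abs_def] by (intro borel_measurable_cnj ft_measurable)

text \<open>Tonelli reduces the claim to \<open>plancherel_line\<close> on almost every slice.
  Nonnegative integrals are compared because \<open>ft u\<close> is not known to be in L2
  beforehand.\<close>

theorem plancherel_strip:
  assumes u: "integrable strip_M u" "u \<in> L2 strip_M"
  shows "ft u \<in> L2 strip_M" "l2_norm strip_M (ft u) = l2_norm strip_M u"
proof -
  have um: "u \<in> borel_measurable strip_M" using u by auto
  have sq: "(\<lambda>p. ennreal ((cmod (f p))\<^sup>2)) \<in> borel_measurable strip_M" if "f \<in> borel_measurable strip_M" for f :: "_ \<Rightarrow> complex"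
    using that by simp
  have "(\<integral>\<^sup>+p. ennreal ((cmod (ft u p))\<^sup>2) \<partial>strip_M) =
      (\<integral>\<^sup>+y. (\<integral>\<^sup>+x. ennreal ((cmod (ft1 (\<lambda>x. u (x, y)) x))\<^sup>2) \<partial>lborel) \<partial>unit_M)"
    using nn_integral_strip[OF sq[OF ft_measurable[OF um]]] by (simp add: ft_def)
  also have "\<dots> = (\<integral>\<^sup>+y. (\<integral>\<^sup>+x. ennreal ((cmod (u (x, y)))\<^sup>2) \<partial>lborel) \<partial>unit_M)"
  proof (rule nn_integral_cong_AE)
    show "AE y in unit_M. (\<integral>\<^sup>+x. ennreal ((cmod (ft1 (\<lambda>x. u (x, y)) x))\<^sup>2) \<partial>lborel) =
        (\<integral>\<^sup>+x. ennreal ((cmod (u (x, y)))\<^sup>2) \<partial>lborel)"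
      using AE_integrable_slice[OF u(1)] AE_L2_slice[OF u(2)]
    proof eventually_elim
      case (elim y)
      then show ?case using plancherel_line[of "\<lambda>x. u (x, y)"] by (simp add: nn_integral_L2)
    qed
  qed
  also have "\<dots> = (\<integral>\<^sup>+p. ennreal ((cmod (u p))\<^sup>2) \<partial>strip_M)"
    using nn_integral_strip[OF sq[OF um]] by simp
  finally have eq: "(\<integral>\<^sup>+p. ennreal ((cmod (ft u p))\<^sup>2) \<partial>strip_M) = (\<integral>\<^sup>+p. ennreal ((cmod (u p))\<^sup>2) \<partial>strip_M)" .
  then show L2: "ft u \<in> L2 strip_M"
    using u(2) ft_measurable[OF um] by (simp add: L2_iff_nn_integral)
  show "l2_norm strip_M (ft u) = l2_norm strip_M u"
    using eq unfolding nn_integral_L2[OF L2] nn_integral_L2[OF u(2)] by (simp add: power2_eq_iff_nonneg)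
qed

lemma ift_L2:
  assumes "integrable strip_M k" "k \<in> L2 strip_M"
  shows "ift k \<in> L2 strip_M" "l2_norm strip_M (ift k) = l2_norm strip_M k"
proof -
  have *: "integrable strip_M (\<lambda>q. cnj (k q))" "(\<lambda>q. cnj (k q)) \<in> L2 strip_M"
    using assms by (auto intro: L2_cnj)
  show "ift k \<in> L2 strip_M" unfolding ift_def[abs_def] by (intro L2_cnj plancherel_strip *)
  show "l2_norm strip_M (ift k) = l2_norm strip_M k"
    using plancherel_strip(2)[OF *] by (simp add: ift_def l2_norm_def)
qed

lemma ft1_add:
  assumes "integrable lborel u" "integrable lborel v"
  shows "ft1 (\<lambda>x. u x + c * v x) \<xi> = ft1 u \<xi> + c * ft1 v \<xi>"
proof -
  have *: "x * \<xi> = \<xi> * x" for x by simp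
  have "(LINT x|lborel. (u x + c * v x) * cis (- \<xi> * x)) =
      (LINT x|lborel. u x * cis (- \<xi> * x) + c * (v x * cis (- \<xi> * x)))"
    by (intro Bochner_Integration.integral_cong) (auto simp: algebra_simps)
  also have "\<dots> = (LINT x|lborel. u x * cis (- \<xi> * x)) + (LINT x|lborel. c * (v x * cis (- \<xi> * x)))"
    by (intro Bochner_Integration.integral_add integrable_mult_right integrable_mult_cis assms)
  also have "\<dots> = (LINT x|lborel. u x * cis (- \<xi> * x)) + c * (LINT x|lborel. v x * cis (- \<xi> * x))"
    by (simp only: integral_mult_right_zero)
  finally show ?thesis by (simp add: ft1_def * distrib_left)
qed

text \<open>Almost everywhere only: on a slice that is not integrable the integral takes its default
  value 0, and additivity may fail there.\<close>

lemma ft_add: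
  assumes "integrable strip_M u" "integrable strip_M v"
  shows "AE p in strip_M. ft (\<lambda>q. u q + c * v q) p = ft u p + c * ft v p"
proof -
  have "AE y in unit_M. \<forall>\<xi>. ft1 (\<lambda>x. u (x, y) + c * v (x, y)) \<xi> = ft1 (\<lambda>x. u (x, y)) \<xi> + c * ft1 (\<lambda>x. v (x, y)) \<xi>"
    using assms[THEN AE_integrable_slice] by eventually_elim (simp add: ft1_add)
  from AE_strip_I[OF this] show ?thesis by eventually_elim (simp add: ft_def)
qed

lemma ft_diff:
  assumes "integrable strip_M u" "integrable strip_M v"
  shows "AE p in strip_M. ft u p - ft v p = ft (\<lambda>q. u q - v q) p"
  using ft_add[OF assms, of "-1"] by eventually_elim simp

lemma ift_add:
  assumes "integrable strip_M u" "integrable strip_M v"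
  shows "AE p in strip_M. ift (\<lambda>q. u q + c * v q) p = ift u p + c * ift v p"
  using ft_add[of "\<lambda>q. cnj (u q)" "\<lambda>q. cnj (v q)" "cnj c"] assms by (auto simp: ift_def)

lemma ift_inner:
  assumes "integrable strip_M k" "k \<in> L2 strip_M" "integrable strip_M k'" "k' \<in> L2 strip_M"
  shows "l2_inner strip_M (ift k) (ift k') = l2_inner strip_M k k'"
proof (rule l2_inner_eq_of_norm_eq)
  fix c
  have *: "integrable strip_M (\<lambda>x. k x + c * k' x)" "(\<lambda>x. k x + c * k' x) \<in> L2 strip_M"
    using assms by (auto intro: L2_add L2_cmult)
  have "l2_norm strip_M (\<lambda>x. ift k x + c * ift k' x) = l2_norm strip_M (ift (\<lambda>x. k x + c * k' x))"
    using assms * L2_measurable[OF assms(2)] L2_measurable[OF assms(4)] ift_add[OF assms(1,3), of c]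
    by (intro l2_norm_AE_cong) (auto intro!: ift_measurable borel_measurable_add borel_measurable_times)
  then show "l2_norm strip_M (\<lambda>x. ift k x + c * ift k' x) = l2_norm strip_M (\<lambda>x. k x + c * k' x)"
    using ift_L2(2)[OF *] by simp
qed (use assms ift_L2 in auto)

text \<open>The kernel is symmetric in position and frequency, so Fubini moves the transform from
  one factor to the other. The conjugate is placed so that the slices integrate to the adjointness
  of \<open>ft\<close> and \<open>ift\<close>.\<close>

lemma ft1_multiplication:
  assumes "integrable lborel u" "integrable lborel k"
  shows "(LINT \<xi>|lborel. ft1 u \<xi> * cnj (k \<xi>)) = (LINT x|lborel. u x * ft1 (\<lambda>\<xi>. cnj (k \<xi>)) x)"
proof -
  have um [measurable]: "u \<in> borel_measurable borel" "k \<in> borel_measurable borel" using assms by auto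
  let ?f = "\<lambda>x \<xi>. u x * cnj (k \<xi>) * cis (- (x * \<xi>))"
  have "integrable (lborel \<Otimes>\<^sub>M lborel) (\<lambda>(x, \<xi>). ?f x \<xi>)"
  proof (rule Bochner_Integration.integrable_bound)
    show "integrable (lborel \<Otimes>\<^sub>M lborel) (\<lambda>p. u (fst p) * (\<lambda>\<xi>. cnj (k \<xi>)) (snd p))"
      using assms by (intro integrable_pair_mult sigma_finite_lborel) auto
  qed (auto simp: norm_mult)
  then have "(LINT \<xi>|lborel. LINT x|lborel. ?f x \<xi>) = (LINT x|lborel. LINT \<xi>|lborel. ?f x \<xi>)"
    by (rule lborel_pair.Fubini_integral)
  moreover have "(LINT \<xi>|lborel. ft1 u \<xi> * cnj (k \<xi>)) = of_real (1 / sqrt (2 * pi)) * (LINT \<xi>|lborel. LINT x|lborel. ?f x \<xi>)"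
  proof -
    have "ft1 u \<xi> * cnj (k \<xi>) = of_real (1 / sqrt (2 * pi)) * (LINT x|lborel. ?f x \<xi>)" for \<xi>
    proof -
      have "(LINT x|lborel. ?f x \<xi>) = (LINT x|lborel. u x * cis (- (x * \<xi>)) * cnj (k \<xi>))"
        by (intro Bochner_Integration.integral_cong) (auto simp: mult_ac)
      then show ?thesis by (simp add: ft1_def)
    qed
    then show ?thesis by (simp only: integral_mult_right_zero)
  qed
  moreover have "(LINT x|lborel. u x * ft1 (\<lambda>\<xi>. cnj (k \<xi>)) x) = of_real (1 / sqrt (2 * pi)) * (LINT x|lborel. LINT \<xi>|lborel. ?f x \<xi>)"
  proof -
    have "u x * ft1 (\<lambda>\<xi>. cnj (k \<xi>)) x = of_real (1 / sqrt (2 * pi)) * (LINT \<xi>|lborel. ?f x \<xi>)" for x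
    proof -
      have "(LINT \<xi>|lborel. ?f x \<xi>) = (LINT \<xi>|lborel. u x * (cnj (k \<xi>) * cis (- (\<xi> * x))))"
        by (intro Bochner_Integration.integral_cong) (auto simp: mult_ac)
      then show ?thesis by (simp add: ft1_def)
    qed
    then show ?thesis by (simp only: integral_mult_right_zero)
  qed
  ultimately show ?thesis by simp
qed

lemma ft_ift_adjoint:
  assumes "integrable strip_M u" "u \<in> L2 strip_M" "integrable strip_M k" "k \<in> L2 strip_M"
  shows "l2_inner strip_M (ft u) k = l2_inner strip_M u (ift k)"
  unfolding l2_inner_strip[OF plancherel_strip(1)[OF assms(1,2)] assms(4)]
    l2_inner_strip[OF assms(2) ift_L2(1)[OF assms(3,4)]]
proof (rule integral_cong_AE)
  have m: "(\<lambda>y. l2_inner lborel (\<lambda>x. f (x, y)) (\<lambda>x. g (x, y))) \<in> borel_measurable unit_M"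
    if "f \<in> L2 strip_M" "g \<in> L2 strip_M" for f g
    using strip.integrable_snd[of "\<lambda>x y. f (x, y) * cnj (g (x, y))"] integrable_L2_cnj[OF that]
    unfolding l2_inner_def by (simp add: case_prod_unfold borel_measurable_integrable)
  show "(\<lambda>y. l2_inner lborel (\<lambda>x. ft u (x, y)) (\<lambda>x. k (x, y))) \<in> borel_measurable unit_M"
    "(\<lambda>y. l2_inner lborel (\<lambda>x. u (x, y)) (\<lambda>x. ift k (x, y))) \<in> borel_measurable unit_M"
    using assms by (auto intro!: m plancherel_strip ift_L2)
  show "AE y in unit_M. l2_inner lborel (\<lambda>x. ft u (x, y)) (\<lambda>x. k (x, y)) = l2_inner lborel (\<lambda>x. u (x, y)) (\<lambda>x. ift k (x, y))"
    using assms(1,3)[THEN AE_integrable_slice]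
    by eventually_elim (simp add: l2_inner_def ft_def ift_def ft1_multiplication)
qed

lemma fourier_eq: "fourier = l2_closure strip_M strip_M {(u, ft u) | u. u \<in> L2 strip_M \<and> integrable strip_M u}"
  unfolding fourier_def
  by (intro arg_cong[where f = "l2_closure strip_M strip_M"] Collect_cong)
     (simp add: ft_def[abs_def] ft1_def case_prod_unfold)

text \<open>Fourier inversion by duality. As \<open>ift k\<close> need not be integrable, it is
  truncated to bounded rectangles. By Plancherel the transforms of the truncations are Cauchy, and
  their limit is identified with \<open>k\<close> by testing.\<close>

theorem fourier_ift:
  assumes k: "integrable strip_M k" "k \<in> L2 strip_M"
  shows "(ift k, k) \<in> fourier"
proof -
  define h where "h = ift k"
  have h: "h \<in> L2 strip_M" unfolding h_def using ift_L2[OF k] by blast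
  define u where "u n p = indicator ({- real n..real n} \<times> {0..1}) p * h p" for n p
  have uL2: "u n \<in> L2 strip_M" for n
    unfolding u_def using rectangle_L2[OF rectangles(4)[of n], THEN L2_measurable]
    by (rule L2_mult_bounded[OF h, where c = 1]) (simp add: indicator_def)
  have uint: "integrable strip_M (u n)" for n
    unfolding u_def using rectangle_L2[OF rectangles(4)] h by (rule integrable_L2_mult)
  have ulim: "(\<lambda>n. l2_norm strip_M (\<lambda>x. u n x - h x)) \<longlonglongrightarrow> 0"
  proof (rule l2_norm_dominated_convergence[where b = h and c = 1])
    show "AE p in strip_M. (\<lambda>n. u n p) \<longlonglongrightarrow> h p"
    proof (rule AE_I2)
      fix p assume p: "p \<in> space strip_M"
      then have "p \<in> (\<Union>n. {- real n..real n} \<times> {0..1})" unfolding rectangles(6) .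
      then obtain N where N: "p \<in> {- real N..real N} \<times> {0..1}" by blast
      have "\<forall>\<^sub>F n in sequentially. u n p = h p"
        by (rule eventually_sequentiallyI[of N]) (use N in \<open>auto simp: u_def\<close>)
      then show "(\<lambda>n. u n p) \<longlonglongrightarrow> h p" by (rule tendsto_eventually)
    qed
    show "AE p in strip_M. cmod (u n p - h p) \<le> 1 * cmod (h p)" for n
      by (intro AE_I2) (auto simp: u_def indicator_def)
  qed (use h uL2 L2_measurable in blast)+
  have vL2: "ft (u n) \<in> L2 strip_M" for n by (rule plancherel_strip[OF uint uL2])
  have diff: "l2_norm strip_M (\<lambda>x. ft (u m) x - ft (u n) x) = l2_norm strip_M (\<lambda>x. u m x - u n x)" for m n
  proof -
    have "l2_norm strip_M (\<lambda>x. ft (u m) x - ft (u n) x) = l2_norm strip_M (ft (\<lambda>x. u m x - u n x))"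
      using vL2[THEN L2_measurable] uL2[THEN L2_measurable]
      by (intro l2_norm_AE_cong ft_diff uint) auto
    then show ?thesis
      using plancherel_strip(2)[of "\<lambda>x. u m x - u n x"] uint L2_diff[OF uL2 uL2] by simp
  qed
  obtain q where q: "q \<in> L2 strip_M" "(\<lambda>n. l2_norm strip_M (\<lambda>x. ft (u n) x - q x)) \<longlonglongrightarrow> 0"
    using L2_complete[of "\<lambda>n. ft (u n)" strip_M] vL2 l2_Cauchy[OF uL2 h ulim] unfolding diff by blast
  \<comment> \<open>Pairing with the indicator of a rectangle moves the transform to the other side
    as \<open>ift\<close>. There the isometry of \<open>ift\<close> turns the pairing of
    \<open>ift k\<close> into that of \<open>k\<close>.\<close>
  have "AE p in strip_M. q p - k p = 0"
  proof (rule strip_orthogonal_zero)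
    fix X assume X: "X \<in> rectangles"
    let ?X = "indicator X :: _ \<Rightarrow> complex"
    have XL2: "?X \<in> L2 strip_M" using rectangle_L2[OF X] .
    have "(\<lambda>p. ?X p * ?X p) = ?X" by (auto simp: indicator_def)
    then have Xint: "integrable strip_M ?X" using integrable_L2_mult[OF XL2 XL2] by simp
    have "(\<lambda>n. l2_inner strip_M (ft (u n)) ?X) \<longlonglongrightarrow> l2_inner strip_M q ?X"
      by (rule l2_inner_tendsto[OF vL2 q XL2])
    moreover have "(\<lambda>n. l2_inner strip_M (ft (u n)) ?X) \<longlonglongrightarrow> l2_inner strip_M h (ift ?X)"
      unfolding ft_ift_adjoint[OF uint uL2 Xint XL2]
      by (rule l2_inner_tendsto[OF uL2 h ulim ift_L2(1)[OF Xint XL2]])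
    ultimately have "l2_inner strip_M q ?X = l2_inner strip_M h (ift ?X)" by (rule LIMSEQ_unique)
    also have "\<dots> = l2_inner strip_M k ?X" unfolding h_def by (rule ift_inner[OF k Xint XL2])
    finally have "l2_inner strip_M (\<lambda>p. q p - k p) ?X = 0"
      using q(1) k(2) XL2 by (simp add: l2_inner_diff_left)
    then show "l2_inner strip_M ?X (\<lambda>p. q p - k p) = 0" by (subst l2_inner_commute) simp
  qed (use q k L2_diff in auto)
  then have "l2_norm strip_M (\<lambda>x. ft (u n) x - q x) = l2_norm strip_M (\<lambda>x. ft (u n) x - k x)" for n
    using vL2[of n, THEN L2_measurable] q(1)[THEN L2_measurable] k(2)[THEN L2_measurable]
    by (intro l2_norm_AE_cong) auto
  then have "(\<lambda>n. l2_norm strip_M (\<lambda>x. ft (u n) x - k x)) \<longlonglongrightarrow> 0" using q(2) by simp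
  then show ?thesis
    unfolding fourier_eq h_def[symmetric] using uL2 uint
    by (intro l2_closureI[of _ _ _ _ u "\<lambda>n. ft (u n)"] h k vL2 ulim) auto
qed

text \<open>Plancherel makes the distance of two approximants equal to the distance of their
  transforms, and both transforms tend to the same limit. Hence the converse of
  \<open>fourier\<close> inside \<open>interp\<close> fixes its value up to null sets.\<close>

lemma fourier_unique:
  assumes "(h, q) \<in> fourier" "(h', q) \<in> fourier"
  shows "AE p in strip_M. h p = h' p"
proof -
  have *: "\<exists>s. (\<forall>n. s n \<in> L2 strip_M \<and> integrable strip_M (s n) \<and> ft (s n) \<in> L2 strip_M) \<and>
      (\<lambda>n. l2_norm strip_M (\<lambda>x. s n x - h x)) \<longlonglongrightarrow> 0 \<and> (\<lambda>n. l2_norm strip_M (\<lambda>x. ft (s n) x - q x)) \<longlonglongrightarrow> 0"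
    if hq: "(h, q) \<in> fourier" for h
  proof -
    obtain s t where st: "\<And>n. (s n, t n) \<in> {(u, ft u) | u. u \<in> L2 strip_M \<and> integrable strip_M u}"
        "\<And>n. s n \<in> L2 strip_M" "\<And>n. t n \<in> L2 strip_M"
      "(\<lambda>n. l2_norm strip_M (\<lambda>x. s n x - h x)) \<longlonglongrightarrow> 0" "(\<lambda>n. l2_norm strip_M (\<lambda>x. t n x - q x)) \<longlonglongrightarrow> 0"
      using hq[unfolded fourier_eq] by (rule l2_closureE) blast
    have "t n = ft (s n)" "integrable strip_M (s n)" for n
      using st(1)[of n] by auto
    then show ?thesis using st(2-5) by (intro exI[of _ s]) simp
  qed
  obtain s where s: "\<And>n. s n \<in> L2 strip_M" "\<And>n. integrable strip_M (s n)" "\<And>n. ft (s n) \<in> L2 strip_M"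
    "(\<lambda>n. l2_norm strip_M (\<lambda>x. s n x - h x)) \<longlonglongrightarrow> 0" "(\<lambda>n. l2_norm strip_M (\<lambda>x. ft (s n) x - q x)) \<longlonglongrightarrow> 0"
    using *[OF assms(1)] by blast
  obtain s' where s': "\<And>n. s' n \<in> L2 strip_M" "\<And>n. integrable strip_M (s' n)" "\<And>n. ft (s' n) \<in> L2 strip_M"
    "(\<lambda>n. l2_norm strip_M (\<lambda>x. s' n x - h' x)) \<longlonglongrightarrow> 0" "(\<lambda>n. l2_norm strip_M (\<lambda>x. ft (s' n) x - q x)) \<longlonglongrightarrow> 0"
    using *[OF assms(2)] by blast
  have L2: "h \<in> L2 strip_M" "h' \<in> L2 strip_M" "q \<in> L2 strip_M"
    using assms by (auto simp: fourier_eq elim: l2_closureE)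
  have "l2_norm strip_M (\<lambda>x. ft (s n) x - ft (s' n) x) = l2_norm strip_M (ft (\<lambda>x. s n x - s' n x))" for n
    using s(1,3)[THEN L2_measurable] s'(1,3)[THEN L2_measurable]
    by (intro l2_norm_AE_cong ft_diff s s') auto
  then have eq: "l2_norm strip_M (\<lambda>x. s n x - s' n x) = l2_norm strip_M (\<lambda>x. ft (s n) x - ft (s' n) x)" for n
    using plancherel_strip(2)[of "\<lambda>x. s n x - s' n x"] s s' L2_diff[OF s(1) s'(1)] by simp
  have "(\<lambda>n. l2_norm strip_M (\<lambda>x. ft (s n) x - q x) + l2_norm strip_M (\<lambda>x. ft (s' n) x - q x) +
      (l2_norm strip_M (\<lambda>x. s n x - h x) + l2_norm strip_M (\<lambda>x. s' n x - h' x))) \<longlonglongrightarrow> 0 + 0 + (0 + 0)"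
    by (intro tendsto_add s s')
  moreover have "l2_norm strip_M (\<lambda>x. h x - h' x) \<le> l2_norm strip_M (\<lambda>x. ft (s n) x - q x) + l2_norm strip_M (\<lambda>x. ft (s' n) x - q x) +
      (l2_norm strip_M (\<lambda>x. s n x - h x) + l2_norm strip_M (\<lambda>x. s' n x - h' x))" for n
    using l2_norm_triangle_diff[OF L2(1) s(1)[of n] L2(2)] l2_norm_triangle_diff[OF s(1)[of n] s'(1)[of n] L2(2)]
      l2_norm_triangle_diff[OF s(3)[of n] L2(3) s'(3)[of n]] eq[of n]
      l2_norm_diff_commute[of strip_M h "s n"] l2_norm_diff_commute[of strip_M q "ft (s' n)"]
    by linarith
  ultimately have "l2_norm strip_M (\<lambda>x. h x - h' x) \<le> 0"
    by (intro tendsto_lowerbound[where F = sequentially]) auto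
  then have "l2_norm strip_M (\<lambda>x. h x - h' x) = 0" using l2_norm_nonneg by (metis order_antisym)
  then show ?thesis using l2_norm_zero_iff[OF L2_diff[OF L2(1,2)]] by simp
qed

section \<open>Density of test functions\<close>

lemma test_funs_L2:
  assumes "\<phi> \<in> test_funs" shows "\<phi> \<in> L2 lborel"
proof -
  obtain R \<phi>' where R: "R > 0" "\<And>x. \<bar>x\<bar> > R \<Longrightarrow> \<phi> x = 0" "continuous_on UNIV \<phi>"
    by (rule test_funs_cases[OF assms]) blast
  have [measurable]: "\<phi> \<in> borel_measurable borel" using R(3) by (rule borel_measurable_continuous_onI)
  have "bounded (\<phi> ` {-R..R})"
    using R(3) by (intro compact_imp_bounded compact_continuous_image) (auto intro: continuous_on_subset)
  then obtain C where C: "\<forall>y\<in>\<phi> ` {-R..R}. cmod y \<le> C" using bounded_iff by blast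
  have "(indicator {-R..R} :: real \<Rightarrow> complex) \<in> L2 lborel"
    by (rule L2_indicator) (auto simp: emeasure_lborel_Icc_eq)
  then show ?thesis
  proof (rule L2_bound[rotated])
    show "AE x in lborel. cmod (\<phi> x) \<le> C * cmod (indicator {-R..R} x)"
    proof (rule AE_I2)
      fix x show "cmod (\<phi> x) \<le> C * cmod (indicator {-R..R} x)"
      proof (cases "x \<in> {-R..R}")
        case False
        then have "\<bar>x\<bar> > R" by auto
        then show ?thesis using R(2) False by simp
      qed (use C in auto)
    qed
  qed simp
qed

text \<open>The induction is run on the statement with an arbitrary tolerance, for which the limit
  step is a triangle inequality. A sequence is chosen only at the end.\<close>

lemma test_funs_dense:
  assumes "F \<in> L2 lborel"
  obtains s where "\<And>n::nat. s n \<in> test_funs" "(\<lambda>n. l2_norm lborel (\<lambda>x. s n x - F x)) \<longlonglongrightarrow> 0"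
proof -
  have *: "\<forall>e>0. \<exists>\<phi>\<in>test_funs. l2_norm lborel (\<lambda>x. \<phi> x - F x) < e"
    using assms
  proof (rule lborel_L2_induct)
    fix X assume "X \<in> range (\<lambda>(a, b). {a..b::real})"
    then obtain a b where X: "X = {a..b}" by auto
    show "\<forall>e>0. \<exists>\<phi>\<in>test_funs. l2_norm lborel (\<lambda>x. \<phi> x - indicator X x) < e"
    proof (cases "a \<le> b")
      case True
      then obtain \<phi> where \<phi>: "\<And>n. \<phi> n \<in> test_funs" "\<And>n x. cmod (\<phi> n x) \<le> 1" "\<And>n x. x \<notin> {a..b} \<Longrightarrow> \<phi> n x = 0"
        "\<And>x. x \<in> {a<..<b} \<Longrightarrow> (\<lambda>n. \<phi> n x) \<longlonglongrightarrow> 1"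
        using test_funs_approx_Icc by blast
      have "(\<lambda>n. l2_norm lborel (\<lambda>x. \<phi> n x - indicator X x)) \<longlonglongrightarrow> 0"
      proof (rule l2_norm_dominated_convergence[where c = 2])
        show "\<phi> n \<in> borel_measurable lborel" for n using test_funs_L2[OF \<phi>(1)] L2_measurable by blast
        show "(indicator X :: real \<Rightarrow> complex) \<in> L2 lborel"
          unfolding X by (rule L2_indicator) (auto simp: emeasure_lborel_Icc_eq)
        have "AE x in lborel. x \<noteq> a" "AE x in lborel. x \<noteq> b" by (rule AE_lborel_singleton)+
        then show "AE x in lborel. (\<lambda>n. \<phi> n x) \<longlonglongrightarrow> indicator X x"
        proof eventually_elim
          case (elim x)
          then consider "x \<in> {a<..<b}" | "x \<notin> {a..b}" by force
          then show ?case
          proof cases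
            case 2
            then show ?thesis using \<phi>(3) by (simp add: X)
          qed (use \<phi>(4) in \<open>simp add: X\<close>)
        qed
        show "AE x in lborel. cmod (\<phi> n x - indicator X x) \<le> 2 * cmod (indicator X x)" for n
        proof (rule AE_I2)
          fix x show "cmod (\<phi> n x - indicator X x) \<le> 2 * cmod (indicator X x)"
          proof (cases "x \<in> {a..b}")
            case True
            then have "indicator X x = (1 :: complex)" by (simp add: X)
            then show ?thesis using \<phi>(2)[of n x] norm_triangle_ineq4[of "\<phi> n x" 1] by simp
          next
            case False
            then show ?thesis using \<phi>(3) by (simp add: X)
          qed
        qed
      qed (simp add: X)
      then have "\<exists>n. l2_norm lborel (\<lambda>x. \<phi> n x - indicator X x) < e" if "e > 0" for e
        using LIMSEQ_D[OF _ that] by force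
      then show ?thesis using \<phi>(1) by blast
    next
      case False
      then have "X = {}" by (simp add: X)
      moreover have "(\<lambda>x. 0) \<in> test_funs" by (simp add: test_funs_iff smooth_const)
      ultimately show ?thesis by (intro allI impI bexI[of _ "\<lambda>x. 0"]) (simp_all add: l2_norm_def)
    qed
  next
    fix f g :: "real \<Rightarrow> complex"
    assume *: "f \<in> L2 lborel" "g \<in> L2 lborel"
      and f: "\<forall>e>0. \<exists>\<phi>\<in>test_funs. l2_norm lborel (\<lambda>x. \<phi> x - f x) < e"
      and g: "\<forall>e>0. \<exists>\<phi>\<in>test_funs. l2_norm lborel (\<lambda>x. \<phi> x - g x) < e"
    show "\<forall>e>0. \<exists>\<phi>\<in>test_funs. l2_norm lborel (\<lambda>x. \<phi> x - (f x + g x)) < e"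
    proof (intro allI impI)
      fix e :: real assume "e > 0"
      then have "e / 2 > 0" by simp
      then obtain \<phi> \<psi> where \<phi>: "\<phi> \<in> test_funs" "l2_norm lborel (\<lambda>x. \<phi> x - f x) < e / 2"
        and \<psi>: "\<psi> \<in> test_funs" "l2_norm lborel (\<lambda>x. \<psi> x - g x) < e / 2" using f g by meson
      have "l2_norm lborel (\<lambda>x. (\<phi> x - f x) + (\<psi> x - g x)) < e"
        using l2_norm_triangle[OF L2_diff[OF test_funs_L2[OF \<phi>(1)] *(1)] L2_diff[OF test_funs_L2[OF \<psi>(1)] *(2)]] \<phi> \<psi>
        by linarith
      then show "\<exists>\<phi>\<in>test_funs. l2_norm lborel (\<lambda>x. \<phi> x - (f x + g x)) < e"
        by (intro bexI[OF _ test_funs_add[OF \<phi>(1) \<psi>(1)]]) (simp add: add_diff_add)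
    qed
  next
    fix c and f :: "real \<Rightarrow> complex"
    assume f: "\<forall>e>0. \<exists>\<phi>\<in>test_funs. l2_norm lborel (\<lambda>x. \<phi> x - f x) < e"
    show "\<forall>e>0. \<exists>\<phi>\<in>test_funs. l2_norm lborel (\<lambda>x. \<phi> x - c * f x) < e"
    proof (intro allI impI)
      fix e :: real assume "e > 0"
      \<comment> \<open>Adding 1 keeps the tolerance meaningful for c = 0.\<close>
      then have e': "e / (cmod c + 1) > 0" by (simp add: add_nonneg_pos)
      then obtain \<phi> where \<phi>: "\<phi> \<in> test_funs" "l2_norm lborel (\<lambda>x. \<phi> x - f x) < e / (cmod c + 1)" using f by meson
      have "l2_norm lborel (\<lambda>x. c * \<phi> x - c * f x) = cmod c * l2_norm lborel (\<lambda>x. \<phi> x - f x)"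
        by (simp only: right_diff_distrib[symmetric] l2_norm_cmult)
      also have "\<dots> \<le> cmod c * (e / (cmod c + 1))" using \<phi>(2) by (intro mult_left_mono) auto
      also have "\<dots> < (cmod c + 1) * (e / (cmod c + 1))" using e' by (intro mult_strict_right_mono) auto
      also have "\<dots> = e" using add_nonneg_pos[OF norm_ge_zero[of c] zero_less_one] by simp
      finally show "\<exists>\<phi>\<in>test_funs. l2_norm lborel (\<lambda>x. \<phi> x - c * f x) < e"
        by (intro bexI[of _ "\<lambda>x. c * \<phi> x"] test_funs_cmult[OF \<phi>(1)])
    qed
  next
    fix s and f :: "real \<Rightarrow> complex"
    assume s: "\<And>n::nat. s n \<in> L2 lborel" "f \<in> L2 lborel" "(\<lambda>n. l2_norm lborel (\<lambda>x. s n x - f x)) \<longlonglongrightarrow> 0"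
      "\<And>n. \<forall>e>0. \<exists>\<phi>\<in>test_funs. l2_norm lborel (\<lambda>x. \<phi> x - s n x) < e"
    show "\<forall>e>0. \<exists>\<phi>\<in>test_funs. l2_norm lborel (\<lambda>x. \<phi> x - f x) < e"
    proof (intro allI impI)
      fix e :: real assume "e > 0"
      then have e: "e / 2 > 0" by simp
      obtain n where n: "l2_norm lborel (\<lambda>x. s n x - f x) < e / 2"
        using LIMSEQ_D[OF s(3) e] by force
      obtain \<phi> where \<phi>: "\<phi> \<in> test_funs" "l2_norm lborel (\<lambda>x. \<phi> x - s n x) < e / 2" using s(4) e by meson
      have "l2_norm lborel (\<lambda>x. \<phi> x - f x) < e"
        using l2_norm_triangle_diff[OF test_funs_L2[OF \<phi>(1)] s(1)[of n] s(2)] n \<phi>(2) by linarith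
      then show "\<exists>\<phi>\<in>test_funs. l2_norm lborel (\<lambda>x. \<phi> x - f x) < e" using \<phi>(1) by blast
    qed
  qed
  have "\<forall>n. \<exists>\<phi>. \<phi> \<in> test_funs \<and> l2_norm lborel (\<lambda>x. \<phi> x - F x) < inverse (real (Suc n))"
    using * by (metis inverse_positive_iff_positive of_nat_0_less_iff zero_less_Suc)
  then obtain s where s: "\<And>n. s n \<in> test_funs" "\<And>n. l2_norm lborel (\<lambda>x. s n x - F x) < inverse (real (Suc n))"
    by metis
  have "(\<lambda>n. l2_norm lborel (\<lambda>x. s n x - F x)) \<longlonglongrightarrow> 0"
    by (rule Lim_null_comparison[OF _ LIMSEQ_inverse_real_of_nat])
      (simp add: less_imp_le[OF s(2)] del: of_nat_Suc)
  then show ?thesis using that s(1) by blast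
qed

section \<open>The Gelfand transform\<close>

text \<open>Half-open cells partition the line, while \<open>unit_M\<close> lives on the closed
  interval. The two sides differ in one endpoint, a null set.\<close>

lemma real_cell:
  fixes f :: "real \<Rightarrow> complex" and l :: int
  assumes [measurable]: "f \<in> borel_measurable borel"
  shows "integrable lborel (\<lambda>x. indicator {of_int l..<of_int l + 1} x *\<^sub>R f x) \<longleftrightarrow> integrable unit_M (\<lambda>y. f (y + of_int l))"
    and "(LINT x|lborel. indicator {of_int l..<of_int l + 1} x *\<^sub>R f x) = (LINT y|unit_M. f (y + of_int l))"
proof -
  let ?g = "\<lambda>x. indicator {of_int l..<of_int l + 1} x *\<^sub>R f x"
  have AE: "AE y in lborel. ?g (of_int l + 1 * y) = indicator {0..1} y *\<^sub>R f (y + of_int l)"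
    using AE_lborel_singleton[of 1] by eventually_elim (auto simp: indicator_def add.commute)
  have "integrable lborel ?g \<longleftrightarrow> integrable lborel (\<lambda>y. ?g (of_int l + 1 * y))"
    by (rule lborel_integrable_real_affine_iff[symmetric]) simp
  also have "\<dots> \<longleftrightarrow> integrable lborel (\<lambda>y. indicator {0..1} y *\<^sub>R f (y + of_int l))"
    using AE by (intro integrable_cong_AE) simp_all
  also have "\<dots> \<longleftrightarrow> integrable unit_M (\<lambda>y. f (y + of_int l))"
    by (subst integrable_restrict_space) simp_all
  finally show "integrable lborel ?g \<longleftrightarrow> integrable unit_M (\<lambda>y. f (y + of_int l))" .
  have "(LINT x|lborel. ?g x) = (LINT y|lborel. ?g (of_int l + 1 * y))"
    by (subst lborel_integral_real_affine[of 1 _ "of_int l"]) simp_all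
  also have "\<dots> = (LINT y|lborel. indicator {0..1} y *\<^sub>R f (y + of_int l))"
    using AE by (intro integral_cong_AE) simp_all
  also have "\<dots> = (LINT y|unit_M. f (y + of_int l))"
    by (subst integral_restrict_space) simp_all
  finally show "(LINT x|lborel. ?g x) = (LINT y|unit_M. f (y + of_int l))" .
qed

text \<open>A point lies in exactly one cell, the one indexed by its floor. The cells from -N to N
  therefore fill \<open>{- N..<N + 1}\<close>, and this interval is the shape of all later
  truncations.\<close>

lemma indicator_cells:
  "(\<Sum>l\<in>{-int N..int N}. indicator {real_of_int l..<of_int l + 1} x) = (indicator {- real N..<real N + 1} x :: real)"
proof -
  have "indicator {real_of_int l..<of_int l + 1} x = (if l = \<lfloor>x\<rfloor> then 1 else 0 :: real)" for l
  proof -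
    have "(l = \<lfloor>x\<rfloor>) = (real_of_int l \<le> x \<and> x < of_int l + 1)" by linarith
    then show ?thesis by (simp add: indicator_def)
  qed
  then have "(\<Sum>l\<in>{-int N..int N}. indicator {real_of_int l..<of_int l + 1} x) = (if \<lfloor>x\<rfloor> \<in> {-int N..int N} then 1 else 0 :: real)"
    by simp
  also have "\<dots> = indicator {- real N..<real N + 1} x"
    by (auto simp: indicator_def le_floor_iff floor_le_iff)
  finally show ?thesis .
qed

lemma integral_cells:
  fixes f :: "real \<Rightarrow> complex"
  assumes [measurable]: "f \<in> borel_measurable borel"
    and int: "\<And>l::int. integrable unit_M (\<lambda>y. f (y + of_int l))"
  shows "integrable lborel (\<lambda>x. indicator {- real N..<real N + 1} x *\<^sub>R f x)"
    and "(LINT x|lborel. indicator {- real N..<real N + 1} x *\<^sub>R f x) = (\<Sum>l\<in>{-int N..int N}. LINT y|unit_M. f (y + of_int l))"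
proof -
  have eq: "indicator {- real N..<real N + 1} x *\<^sub>R f x = (\<Sum>l\<in>{-int N..int N}. indicator {of_int l..<of_int l + 1} x *\<^sub>R f x)" for x
    unfolding indicator_cells[symmetric] scaleR_sum_left ..
  have i: "integrable lborel (\<lambda>x. indicator {of_int l..<of_int l + 1} x *\<^sub>R f x)" for l :: int
    using real_cell(1)[OF assms(1)] int by blast
  show "integrable lborel (\<lambda>x. indicator {- real N..<real N + 1} x *\<^sub>R f x)"
    unfolding eq by (intro Bochner_Integration.integrable_sum i)
  show "(LINT x|lborel. indicator {- real N..<real N + 1} x *\<^sub>R f x) = (\<Sum>l\<in>{-int N..int N}. LINT y|unit_M. f (y + of_int l))"
    unfolding eq using i real_cell(2)[OF assms(1)] by (subst Bochner_Integration.integral_sum) simp_all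
qed

text \<open>The exceptional set on the line is contained in the union of the integer translates of
  the exceptional set in the unit interval, a countable union of null sets.\<close>

lemma AE_real_of_unit:
  assumes "AE y in unit_M. P y" shows "AE x in lborel. P (frac x)"
proof -
  obtain N where N: "N \<in> null_sets unit_M" "{y \<in> space unit_M. \<not> P y} \<subseteq> N"
    using assms unfolding eventually_ae_filter by blast
  have "N \<in> null_sets lborel"
    using N(1) by (auto simp: null_sets_restrict_space)
  then have "{x. x - of_int l \<in> N} \<in> null_sets lborel" for l :: int
    by (rule null_sets_translation)
  then have "(\<Union>l::int. {x. x - of_int l \<in> N}) \<in> null_sets lborel" by (intro null_sets_UN) auto
  then show ?thesis
  proof (rule AE_I')
    show "{x \<in> space lborel. \<not> P (frac x)} \<subseteq> (\<Union>l::int. {x. x - of_int l \<in> N})"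
    proof
      fix x assume "x \<in> {x \<in> space lborel. \<not> P (frac x)}"
      then have "frac x \<in> N" using N(2) frac_lt_1[of x] frac_ge_0[of x] by (auto intro: less_imp_le)
      then show "x \<in> (\<Union>l::int. {x. x - of_int l \<in> N})" by (auto simp: frac_def)
    qed
  qed
qed

section \<open>Band-limited functions and the adjoint Gelfand transform\<close>

definition band :: "(real \<times> real \<Rightarrow> complex) set" where
  "band = {k \<in> L2 strip_M. \<forall>\<theta> y. \<bar>\<theta>\<bar> > pi \<longrightarrow> k (\<theta>, y) = 0}"

text \<open>
  The adjoint of the Gelfand transform \<open>U\<close>: the Fourier coefficients of \<open>k(\<cdot>, y)\<close> are the values of
  its inverse Fourier transform at the points \<open>y + l\<close>. The finite sum \<open>gelfand_sum N F\<close> is \<open>U F\<close>,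
  extended by zero, if \<open>F\<close> vanishes outside \<open>[-N, N + 1)\<close>.
\<close>
definition gelfand_adj :: "(real \<times> real \<Rightarrow> complex) \<Rightarrow> real \<Rightarrow> complex" where
  "gelfand_adj k x = ift k (x, frac x)"

definition gelfand_sum :: "nat \<Rightarrow> (real \<Rightarrow> complex) \<Rightarrow> real \<times> real \<Rightarrow> complex" where
  "gelfand_sum N F p = (if \<bar>fst p\<bar> \<le> pi then of_real (1 / sqrt (2 * pi)) *
     (\<Sum>l\<in>{-int N..int N}. F (snd p + of_int l) * cis (- (fst p * (snd p + of_int l)))) else 0)"

lemma band_L2: "k \<in> band \<Longrightarrow> k \<in> L2 strip_M"
  by (simp add: band_def)

lemma band_zero: "k \<in> band \<Longrightarrow> \<bar>\<theta>\<bar> > pi \<Longrightarrow> k (\<theta>, y) = 0"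
  by (simp add: band_def)

lemma band_integrable: "k \<in> band \<Longrightarrow> integrable strip_M k"
  by (rule integrable_bounded_support[of k pi]) (auto simp: band_def)

lemma band_add: "k \<in> band \<Longrightarrow> k' \<in> band \<Longrightarrow> (\<lambda>p. k p + c * k' p) \<in> band"
  by (auto simp: band_def intro: L2_add L2_cmult)

lemma band_diff: "k \<in> band \<Longrightarrow> k' \<in> band \<Longrightarrow> (\<lambda>p. k p - k' p) \<in> band"
  by (auto simp: band_def intro: L2_diff)

lemma id_unit_measurable: "(\<lambda>y. y) \<in> borel_measurable unit_M"
  by (rule measurable_restrict_space1) simp

lemma snd_strip_measurable: "snd \<in> borel_measurable strip_M"
  by (rule measurable_compose[OF measurable_snd id_unit_measurable])

lemma gelfand_adj_measurable:
  assumes "k \<in> borel_measurable strip_M"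
  shows "gelfand_adj k \<in> borel_measurable borel"
proof -
  have f: "frac \<in> borel_measurable (borel :: real measure)"
    unfolding frac_def[abs_def] by (intro borel_measurable_diff borel_measurable_real_floor) simp_all
  have "frac \<in> measurable borel unit_M"
    using f order_less_imp_le[OF frac_lt_1] by (intro measurable_restrict_space2) auto
  then have "(\<lambda>x::real. (x, frac x)) \<in> measurable borel strip_M" by measurable
  from measurable_compose[OF this ift_measurable[OF assms]] show ?thesis
    unfolding gelfand_adj_def[abs_def] .
qed

text \<open>Cauchy-Schwarz against the indicator of [-pi, pi], whose norm sqrt (2 pi) cancels the
  normalising factor. The bound is uniform in \<open>x\<close>.\<close>

lemma ift_slice_bound:
  assumes f: "f \<in> L2 lborel" "\<And>\<theta>. \<bar>\<theta>\<bar> > pi \<Longrightarrow> f \<theta> = 0"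
  shows "cmod (of_real (1 / sqrt (2 * pi)) * (LINT \<theta>|lborel. f \<theta> * cis (x * \<theta>))) \<le> l2_norm lborel f"
proof -
  let ?I = "indicator {-pi..pi} :: real \<Rightarrow> complex"
  have I: "?I \<in> L2 lborel" by (rule L2_indicator) (auto simp: emeasure_lborel_Icc_eq)
  have "(LINT \<theta>|lborel. (cmod (?I \<theta>))\<^sup>2) = (LINT \<theta>|lborel. indicator {-pi..pi} \<theta>)"
    by (intro Bochner_Integration.integral_cong) (auto simp: indicator_def)
  then have nI: "l2_norm lborel ?I = sqrt (2 * pi)" by (simp add: l2_norm_def)
  have "cmod (LINT \<theta>|lborel. f \<theta> * cis (x * \<theta>)) \<le> (LINT \<theta>|lborel. cmod (f \<theta> * cis (x * \<theta>)))"
    by (rule integral_norm_bound)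
  also have "\<dots> = (LINT \<theta>|lborel. cmod (?I \<theta>) * cmod (f \<theta>))"
  proof (rule Bochner_Integration.integral_cong[OF refl])
    fix \<theta> show "cmod (f \<theta> * cis (x * \<theta>)) = cmod (?I \<theta>) * cmod (f \<theta>)"
      using f(2)[of \<theta>] by (cases "\<bar>\<theta>\<bar> > pi") (auto simp: norm_mult indicator_def abs_if split: if_splits)
  qed
  also have "\<dots> \<le> sqrt (2 * pi) * l2_norm lborel f"
    using integral_cmod_mult_le[OF I f(1)] nI by simp
  finally show ?thesis by (simp add: norm_mult norm_divide field_simps)
qed

lemma L2_cell:
  assumes "F \<in> L2 lborel"
  shows "(\<lambda>y. F (y + of_int l)) \<in> L2 unit_M"
proof -
  have [measurable]: "F \<in> borel_measurable borel" using L2_measurable[OF assms] by simp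
  have "integrable lborel (\<lambda>x. indicator {of_int l..<of_int l + 1} x *\<^sub>R complex_of_real ((cmod (F x))\<^sup>2))"
    using L2_integrable[OF assms] by (intro integrable_mult_indicator integrable_of_real) auto
  then have "integrable unit_M (\<lambda>y. complex_of_real ((cmod (F (y + of_int l)))\<^sup>2))"
    using real_cell(1)[of "\<lambda>x. complex_of_real ((cmod (F x))\<^sup>2)" l] by simp
  from integrable_norm[OF this] show ?thesis
    by (simp add: L2_def norm_power measurable_compose[OF measurable_compose[OF id_unit_measurable] \<open>F \<in> borel_measurable borel\<close>])
qed

lemma L2_of_cells:
  assumes "F \<in> borel_measurable borel" "\<And>l::int. (\<lambda>y. F (y + of_int l)) \<in> L2 unit_M"
  shows "(\<lambda>x. indicator {- real N..<real N + 1} x * F x) \<in> L2 lborel"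
proof -
  have "integrable lborel (\<lambda>x. indicator {- real N..<real N + 1} x *\<^sub>R complex_of_real ((cmod (F x))\<^sup>2))"
  proof (rule integral_cells(1))
    show "integrable unit_M (\<lambda>y. complex_of_real ((cmod (F (y + of_int l)))\<^sup>2))" for l :: int
      using L2_integrable[OF assms(2)[of l]] by (rule integrable_of_real)
  qed (use assms(1) in measurable)
  from integrable_norm[OF this]
  have "integrable lborel (\<lambda>x. indicator {- real N..<real N + 1} x * (cmod (F x))\<^sup>2)" by (simp add: norm_power)
  moreover have "indicator {- real N..<real N + 1} x * (cmod (F x))\<^sup>2 = (cmod (indicator {- real N..<real N + 1} x * F x))\<^sup>2" for x
    by (simp add: indicator_def)
  ultimately show ?thesis using assms(1) by (simp add: L2_def)
qed

text \<open>The only exception is y = 1, where the fractional part jumps back to 0.\<close>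

lemma gelfand_adj_cell_AE: "AE y in unit_M. gelfand_adj k (y + of_int l) = ift k (y + of_int l, y)"
proof -
  have "AE y in lborel. y \<in> {0..1} \<longrightarrow> gelfand_adj k (y + of_int l) = ift k (y + of_int l, y)"
    using AE_lborel_singleton[of 1]
  proof eventually_elim
    case (elim y)
    show ?case
    proof
      assume "y \<in> {0..1}"
      then have "frac (y + of_int l) = y" using elim by (simp add: frac_unique_iff)
      then show "gelfand_adj k (y + of_int l) = ift k (y + of_int l, y)" by (simp add: gelfand_adj_def)
    qed
  qed
  then show ?thesis by (subst AE_restrict_space_iff) auto
qed

text \<open>On each cell the values are dominated by the norm of the slice of \<open>k\<close>,
  which is square integrable over \<open>y\<close>. The bound is the same for every cell and thus
  gives no control of the sum over cells; that is left to
  \<open>gelfand_adj_bounded\<close>.\<close>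

lemma gelfand_adj_cell_L2:
  assumes k: "k \<in> band"
  shows "(\<lambda>y. gelfand_adj k (y + of_int l)) \<in> L2 unit_M"
proof -
  define n :: "real \<Rightarrow> complex" where "n y = of_real (l2_norm lborel (\<lambda>\<theta>. k (\<theta>, y)))" for y
  have n2: "(cmod (n y))\<^sup>2 = (LINT \<theta>|lborel. (cmod (k (\<theta>, y)))\<^sup>2)" for y
    by (simp add: n_def l2_norm_sq)
  have int: "integrable unit_M (\<lambda>y. LINT \<theta>|lborel. (cmod (k (\<theta>, y)))\<^sup>2)"
    by (rule strip.integrable_snd) (use L2_integrable[OF band_L2[OF k]] in \<open>simp add: case_prod_unfold\<close>)
  have nm: "n \<in> borel_measurable unit_M"
    unfolding n_def l2_norm_def using borel_measurable_integrable[OF int] by measurable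
  have "n \<in> L2 unit_M" using nm int by (simp add: L2_def n2)
  then show ?thesis
  proof (rule L2_bound[rotated])
    show "(\<lambda>y. gelfand_adj k (y + of_int l)) \<in> borel_measurable unit_M"
      by (rule measurable_compose[OF _ gelfand_adj_measurable[OF L2_measurable[OF band_L2[OF k]]]])
        (intro borel_measurable_add id_unit_measurable borel_measurable_const)
    show "AE y in unit_M. cmod (gelfand_adj k (y + of_int l)) \<le> 1 * cmod (n y)"
      using gelfand_adj_cell_AE[of k l] AE_L2_slice[OF band_L2[OF k]]
    proof eventually_elim
      case (elim y)
      show ?case
        using ift_slice_bound[OF elim(2), of "y + of_int l"] band_zero[OF k]
        by (simp add: elim(1) ift_eq n_def)
    qed
  qed
qed

lemma gelfand_sum_band:
  assumes "F \<in> L2 lborel" shows "gelfand_sum N F \<in> band"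
proof -
  have Fm: "F \<in> borel_measurable borel" using L2_measurable[OF assms] by simp
  let ?t = "\<lambda>l p. if \<bar>fst p\<bar> \<le> pi then F (snd p + of_int l) * cis (- (fst p * (snd p + of_int l))) else 0"
  have t: "?t l \<in> L2 strip_M" for l
  proof -
    note [measurable] = snd_strip_measurable
    have 1: "(\<lambda>p. F (snd p + of_int l)) \<in> borel_measurable strip_M"
      by (rule measurable_compose[OF _ Fm]) (intro borel_measurable_add snd_strip_measurable borel_measurable_const)
    have fst: "fst \<in> borel_measurable strip_M" using measurable_fst[of lborel unit_M] by simp
    have "{p \<in> space strip_M. \<bar>fst p\<bar> \<le> pi} \<in> sets strip_M"
      using fst by (intro borel_measurable_le borel_measurable_abs borel_measurable_const)
    then have m: "?t l \<in> borel_measurable strip_M"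
      using 1 fst snd_strip_measurable
      by (intro measurable_If borel_measurable_times borel_measurable_cis borel_measurable_uminus borel_measurable_add borel_measurable_const)
    have "integrable unit_M (\<lambda>y. complex_of_real ((cmod (F (y + of_int l)))\<^sup>2))"
      using L2_integrable[OF L2_cell[OF assms]] by (rule integrable_of_real)
    moreover have "integrable lborel (\<lambda>\<theta>. indicator {-pi..pi} \<theta> *\<^sub>R (1::complex))"
      using borel_integrable_atLeastAtMost'[of "-pi" pi "\<lambda>_. 1::complex"] by (simp add: set_integrable_def)
    ultimately have "integrable strip_M (\<lambda>p. indicator {-pi..pi} (fst p) *\<^sub>R (1::complex) * complex_of_real ((cmod (F (snd p + of_int l)))\<^sup>2))"
      using integrable_pair_mult[OF sigma_finite_lborel unit_M.sigma_finite_measure_axioms] by blast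
    from integrable_norm[OF this]
    have "integrable strip_M (\<lambda>p. (cmod (?t l p))\<^sup>2)"
      by (rule Bochner_Integration.integrable_bound) (use m in \<open>auto simp: norm_mult norm_power indicator_def abs_if split: if_splits\<close>)
    then show ?thesis using m by (simp add: L2_def)
  qed
  have "gelfand_sum N F = (\<lambda>p. of_real (1 / sqrt (2 * pi)) * (\<Sum>l\<in>{-int N..int N}. ?t l p))"
    by (auto simp: gelfand_sum_def fun_eq_iff)
  also have "\<dots> \<in> L2 strip_M" using t by (intro L2_cmult L2_sum) auto
  finally show ?thesis by (auto simp: band_def gelfand_sum_def)
qed

text \<open>On almost every slice each term of the finite sum pairs with \<open>k\<close> to a value
  of \<open>ift k\<close> at \<open>y + l\<close>, that is, to \<open>gelfand_adj k\<close> on the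
  cell \<open>l\<close>. Summing over the cells reassembles the integral over the line.\<close>

lemma gelfand_sum_inner:
  assumes F: "F \<in> L2 lborel" "\<And>x. x \<notin> {- real N..<real N + 1} \<Longrightarrow> F x = 0" and k: "k \<in> band"
  shows "l2_inner strip_M (gelfand_sum N F) k = l2_inner lborel F (gelfand_adj k)"
proof -
  note [measurable] = gelfand_adj_measurable[OF L2_measurable[OF band_L2[OF k]]]
  have [measurable]: "F \<in> borel_measurable borel" using L2_measurable[OF F(1)] by simp
  let ?c = "of_real (1 / sqrt (2 * pi)) :: complex"
  have i: "integrable unit_M (\<lambda>y. F (y + of_int l) * cnj (gelfand_adj k (y + of_int l)))" for l
    using L2_cell[OF F(1)] gelfand_adj_cell_L2[OF k] by (rule integrable_L2_cnj)
  have 1: "AE y in unit_M. l2_inner lborel (\<lambda>\<theta>. gelfand_sum N F (\<theta>, y)) (\<lambda>\<theta>. k (\<theta>, y)) =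
      (\<Sum>l\<in>{-int N..int N}. F (y + of_int l) * cnj (ift k (y + of_int l, y)))"
    using AE_integrable_slice[OF band_integrable[OF k]]
  proof eventually_elim
    case (elim y)
    have "gelfand_sum N F (\<theta>, y) * cnj (k (\<theta>, y)) =
        (\<Sum>l\<in>{-int N..int N}. F (y + of_int l) * (?c * cnj (k (\<theta>, y) * cis ((y + of_int l) * \<theta>))))" for \<theta>
    proof (cases "\<bar>\<theta>\<bar> > pi")
      case False
      then show ?thesis
        by (simp add: gelfand_sum_def sum_distrib_left sum_distrib_right cis_cnj mult_ac)
    qed (simp add: band_zero[OF k])
    then have "l2_inner lborel (\<lambda>\<theta>. gelfand_sum N F (\<theta>, y)) (\<lambda>\<theta>. k (\<theta>, y)) =
        (LINT \<theta>|lborel. (\<Sum>l\<in>{-int N..int N}. F (y + of_int l) * (?c * cnj (k (\<theta>, y) * cis ((y + of_int l) * \<theta>)))))"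
      by (simp add: l2_inner_def)
    also have "\<dots> = (\<Sum>l\<in>{-int N..int N}. LINT \<theta>|lborel. F (y + of_int l) * (?c * cnj (k (\<theta>, y) * cis ((y + of_int l) * \<theta>))))"
    proof (rule Bochner_Integration.integral_sum)
      fix l :: int
      have "integrable lborel (\<lambda>\<theta>. cnj (k (\<theta>, y) * cis ((y + of_int l) * \<theta>)))"
        using integrable_mult_cis[OF elim, of "y + of_int l"] by (simp only: integrable_cnj)
      then show "integrable lborel (\<lambda>\<theta>. F (y + of_int l) * (?c * cnj (k (\<theta>, y) * cis ((y + of_int l) * \<theta>))))"
        by (intro integrable_mult_right)
    qed
    also have "\<dots> = (\<Sum>l\<in>{-int N..int N}. F (y + of_int l) * cnj (ift k (y + of_int l, y)))"
    proof (rule sum.cong[OF refl])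
      fix l :: int
      show "(LINT \<theta>|lborel. F (y + of_int l) * (?c * cnj (k (\<theta>, y) * cis ((y + of_int l) * \<theta>)))) =
          F (y + of_int l) * cnj (ift k (y + of_int l, y))"
        unfolding ift_eq integral_mult_right_zero Bochner_Integration.integral_cnj by simp
    qed
    finally show ?case .
  qed
  have 2: "AE y in unit_M. \<forall>l. gelfand_adj k (y + of_int l) = ift k (y + of_int l, y)"
    using gelfand_adj_cell_AE[of k] by (subst AE_all_countable) auto
  have m: "(\<lambda>y. l2_inner lborel (\<lambda>x. gelfand_sum N F (x, y)) (\<lambda>x. k (x, y))) \<in> borel_measurable unit_M"
    using strip.integrable_snd[of "\<lambda>x y. gelfand_sum N F (x, y) * cnj (k (x, y))"] integrable_L2_cnj[OF band_L2[OF gelfand_sum_band[OF F(1)]] band_L2[OF k]]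
    unfolding l2_inner_def by (simp add: case_prod_unfold borel_measurable_integrable)
  have "l2_inner strip_M (gelfand_sum N F) k = (LINT y|unit_M. l2_inner lborel (\<lambda>\<theta>. gelfand_sum N F (\<theta>, y)) (\<lambda>\<theta>. k (\<theta>, y)))"
    by (rule l2_inner_strip[OF band_L2[OF gelfand_sum_band[OF F(1)]] band_L2[OF k]])
  also have "\<dots> = (LINT y|unit_M. (\<Sum>l\<in>{-int N..int N}. F (y + of_int l) * cnj (gelfand_adj k (y + of_int l))))"
  proof (rule integral_cong_AE[OF m])
    show "AE y in unit_M. l2_inner lborel (\<lambda>\<theta>. gelfand_sum N F (\<theta>, y)) (\<lambda>\<theta>. k (\<theta>, y)) =
        (\<Sum>l\<in>{-int N..int N}. F (y + of_int l) * cnj (gelfand_adj k (y + of_int l)))"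
      using 1 2 by eventually_elim simp
    show "(\<lambda>y. \<Sum>l\<in>{-int N..int N}. F (y + of_int l) * cnj (gelfand_adj k (y + of_int l))) \<in> borel_measurable unit_M"
      using i by (intro borel_measurable_sum borel_measurable_integrable)
  qed
  also have "\<dots> = (\<Sum>l\<in>{-int N..int N}. LINT y|unit_M. F (y + of_int l) * cnj (gelfand_adj k (y + of_int l)))"
    by (rule Bochner_Integration.integral_sum) (rule i)
  also have "\<dots> = (LINT x|lborel. indicator {- real N..<real N + 1} x *\<^sub>R (F x * cnj (gelfand_adj k x)))"
    by (rule integral_cells(2)[symmetric]) (use i in \<open>simp_all\<close>)
  also have "\<dots> = l2_inner lborel F (gelfand_adj k)"
    unfolding l2_inner_def
  proof (rule Bochner_Integration.integral_cong[OF refl])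
    fix x show "indicator {- real N..<real N + 1} x *\<^sub>R (F x * cnj (gelfand_adj k x)) = F x * cnj (gelfand_adj k x)"
      using F(2)[of x] by (cases "x \<in> {- real N..<real N + 1}") (simp_all add: indicator_def)
  qed
  finally show ?thesis .
qed

lemma integral_cis_period:
  "(LINT \<theta>|lborel. indicator {-pi..pi} \<theta> *\<^sub>R cis (of_int n * \<theta>)) = (if n = 0 then of_real (2 * pi) else 0)"
proof (cases "n = 0")
  case True
  have "(LINT \<theta>|lborel. indicator {-pi..pi} \<theta> *\<^sub>R (1::complex)) = of_real (LINT \<theta>|lborel. indicator {-pi..pi} \<theta>)"
    unfolding integral_complex_of_real[symmetric] by (simp add: scaleR_conv_of_real)
  then show ?thesis using True by simp
next
  case False
  have "(LINT \<theta>|lborel. indicator {-pi..pi} \<theta> *\<^sub>R cis (of_int n * \<theta>)) =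
      cis (of_int n * pi) / (\<i> * of_int n) - cis (of_int n * (- pi)) / (\<i> * of_int n)"
  proof (rule integral_FTC_Icc)
    fix x :: real
    have "((\<lambda>z. exp (\<i> * (of_int n * z)) / (\<i> * of_int n)) has_field_derivative exp (\<i> * (of_int n * of_real x))) (at (of_real x))"
      using False by (auto intro!: derivative_eq_intros simp: mult_ac)
    from has_vector_derivative_real_field[OF this]
    show "((\<lambda>\<theta>. cis (of_int n * \<theta>) / (\<i> * of_int n)) has_vector_derivative cis (of_int n * x)) (at x within {-pi..pi})"
      by (simp add: cis_conv_exp)
  qed (auto intro!: continuous_intros)
  moreover have "cis (of_int n * pi) = cis (of_int n * (- pi))"
    by (simp add: complex_eq_iff sin_int_times_real mult.commute)
  ultimately show ?thesis using False by simp
qed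

text \<open>Orthogonality of the characters over one period keeps only the term whose index is the
  floor of \<open>x\<close>, where \<open>frac x + of_int l\<close> is \<open>x\<close> again. For
  finite sums this left-inverse identity holds at every point.\<close>

lemma gelfand_adj_sum:
  assumes F: "F \<in> L2 lborel" "\<And>x. x \<notin> {- real N..<real N + 1} \<Longrightarrow> F x = 0"
  shows "gelfand_adj (gelfand_sum N F) x = F x"
proof -
  let ?c = "of_real (1 / sqrt (2 * pi)) :: complex"
  let ?y = "frac x"
  have eq: "gelfand_sum N F (\<theta>, ?y) * cis (x * \<theta>) =
      (\<Sum>l\<in>{-int N..int N}. ?c * F (?y + of_int l) * (indicator {-pi..pi} \<theta> *\<^sub>R cis (of_int (\<lfloor>x\<rfloor> - l) * \<theta>)))" for \<theta>
  proof -
    have c: "cis (- (\<theta> * (?y + of_int l))) * cis (x * \<theta>) = cis (of_int (\<lfloor>x\<rfloor> - l) * \<theta>)" for l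
      unfolding cis_mult by (simp add: frac_def algebra_simps)
    show ?thesis
    proof (cases "\<bar>\<theta>\<bar> \<le> pi")
      case True
      then have "\<theta> \<in> {-pi..pi}" by auto
      then show ?thesis using True by (simp add: gelfand_sum_def sum_distrib_left sum_distrib_right c mult.assoc)
    next
      case False
      then have "\<theta> \<notin> {-pi..pi}" by auto
      then show ?thesis using False by (simp add: gelfand_sum_def)
    qed
  qed
  have "(LINT \<theta>|lborel. gelfand_sum N F (\<theta>, ?y) * cis (x * \<theta>)) =
      (\<Sum>l\<in>{-int N..int N}. LINT \<theta>|lborel. ?c * F (?y + of_int l) * (indicator {-pi..pi} \<theta> *\<^sub>R cis (of_int (\<lfloor>x\<rfloor> - l) * \<theta>)))"
    unfolding eq
    by (intro Bochner_Integration.integral_sum integrable_mult_right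
        borel_integrable_atLeastAtMost'[unfolded set_integrable_def] continuous_intros)
  also have "\<dots> = (\<Sum>l\<in>{-int N..int N}. if l = \<lfloor>x\<rfloor> then ?c * F (?y + of_int l) * of_real (2 * pi) else 0)"
    unfolding integral_mult_right_zero integral_cis_period by (intro sum.cong) auto
  also have "\<dots> = ?c * F x * of_real (2 * pi)"
  proof (cases "\<lfloor>x\<rfloor> \<in> {-int N..int N}")
    case True
    then show ?thesis by (simp add: frac_def)
  next
    case False
    then have "x \<notin> {- real N..<real N + 1}" by (auto simp: le_floor_iff floor_le_iff)
    then show ?thesis using False F(2) by auto
  qed
  finally have "gelfand_adj (gelfand_sum N F) x = (?c * ?c * of_real (2 * pi)) * F x"
    by (simp only: gelfand_adj_def ift_eq mult_ac)
  also have "?c * ?c * of_real (2 * pi) = 1"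
    unfolding of_real_mult[symmetric] by simp
  finally show ?thesis by simp
qed

text \<open>
  Pairing \<open>k\<close> with the Gelfand sum of a truncation of \<open>gelfand_adj k\<close> takes the place of the Bessel
  inequality.
\<close>
theorem gelfand_adj_bounded:
  assumes k: "k \<in> band"
  shows "gelfand_adj k \<in> L2 lborel" "l2_norm lborel (gelfand_adj k) \<le> l2_norm strip_M k"
proof -
  have m: "gelfand_adj k \<in> borel_measurable borel" by (rule gelfand_adj_measurable[OF L2_measurable[OF band_L2[OF k]]])
  define H where "H N x = indicator {- real N..<real N + 1} x * gelfand_adj k x" for N :: nat and x
  have H: "H N \<in> L2 lborel" for N unfolding H_def by (rule L2_of_cells[OF m gelfand_adj_cell_L2[OF k]])
  have H0: "H N x = 0" if "x \<notin> {- real N..<real N + 1}" for N x using that by (simp add: H_def)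
  have norm: "l2_norm lborel (H N) \<le> l2_norm strip_M k" for N
  proof -
    let ?g = "gelfand_sum N (H N)"
    have g: "?g \<in> band" by (rule gelfand_sum_band[OF H])
    have "l2_inner strip_M ?g ?g = l2_inner lborel (H N) (gelfand_adj ?g)" by (rule gelfand_sum_inner[OF H H0 g])
    also have "gelfand_adj ?g = H N" using gelfand_adj_sum[OF H H0] by blast
    finally have n: "l2_norm strip_M ?g = l2_norm lborel (H N)"
      by (simp add: l2_inner_self power2_eq_iff_nonneg flip: of_real_power)
    \<comment> \<open>The pairing of \<open>?g\<close> with \<open>k\<close> equals the squared norm
      of \<open>H N\<close>, and \<open>?g\<close> has the same norm as \<open>H N\<close>.
      Cauchy-Schwarz gives the claim once one factor is cancelled.\<close>
    have "l2_inner strip_M ?g k = l2_inner lborel (H N) (gelfand_adj k)" by (rule gelfand_sum_inner[OF H H0 k])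
    also have "\<dots> = l2_inner lborel (H N) (H N)"
      unfolding l2_inner_def by (intro Bochner_Integration.integral_cong) (auto simp: H_def indicator_def)
    finally have "(l2_norm lborel (H N))\<^sup>2 = cmod (l2_inner strip_M ?g k)" by (simp add: l2_inner_self norm_power)
    also have "\<dots> \<le> l2_norm lborel (H N) * l2_norm strip_M k"
      using l2_Cauchy_Schwarz[OF band_L2[OF g] band_L2[OF k]] n by simp
    finally have "l2_norm lborel (H N) * l2_norm lborel (H N) \<le> l2_norm lborel (H N) * l2_norm strip_M k"
      by (simp add: power2_eq_square)
    then show ?thesis
      using l2_norm_nonneg[of lborel "H N"] l2_norm_nonneg[of strip_M k] mult_le_cancel_left_pos
      by (cases "l2_norm lborel (H N) = 0") (auto simp: less_le)
  qed
  \<comment> \<open>The truncated bounds are uniform in \<open>N\<close>, so Fatou's lemma passes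
    them to the whole line.\<close>
  have "(\<integral>\<^sup>+x. ennreal ((cmod (gelfand_adj k x))\<^sup>2) \<partial>lborel) = (\<integral>\<^sup>+x. liminf (\<lambda>N. ennreal ((cmod (H N x))\<^sup>2)) \<partial>lborel)"
  proof (rule nn_integral_cong)
    fix x
    obtain N where N: "\<bar>x\<bar> \<le> real N" using real_arch_simple by blast
    have "\<forall>\<^sub>F n in sequentially. ennreal ((cmod (H n x))\<^sup>2) = ennreal ((cmod (gelfand_adj k x))\<^sup>2)"
      by (rule eventually_sequentiallyI[of N]) (use N in \<open>auto simp: H_def indicator_def abs_le_iff\<close>)
    then have "(\<lambda>N. ennreal ((cmod (H N x))\<^sup>2)) \<longlonglongrightarrow> ennreal ((cmod (gelfand_adj k x))\<^sup>2)" by (rule tendsto_eventually)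
    then show "ennreal ((cmod (gelfand_adj k x))\<^sup>2) = liminf (\<lambda>N. ennreal ((cmod (H N x))\<^sup>2))"
      by (intro lim_imp_Liminf[symmetric]) auto
  qed
  also have "\<dots> \<le> liminf (\<lambda>N. \<integral>\<^sup>+x. ennreal ((cmod (H N x))\<^sup>2) \<partial>lborel)"
    by (rule nn_integral_liminf) (use H[THEN L2_measurable] in simp)
  also have "\<dots> \<le> limsup (\<lambda>N. \<integral>\<^sup>+x. ennreal ((cmod (H N x))\<^sup>2) \<partial>lborel)"
    by (rule Liminf_le_Limsup) simp
  also have "\<dots> \<le> ennreal ((l2_norm strip_M k)\<^sup>2)"
    by (rule Limsup_bounded, rule always_eventually)
       (auto simp: nn_integral_L2[OF H] intro!: ennreal_leI power_mono norm)
  finally have *: "(\<integral>\<^sup>+x. ennreal ((cmod (gelfand_adj k x))\<^sup>2) \<partial>lborel) \<le> ennreal ((l2_norm strip_M k)\<^sup>2)" .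
  then show L2: "gelfand_adj k \<in> L2 lborel" using m by (auto simp: L2_iff_nn_integral intro: le_less_trans)
  show "l2_norm lborel (gelfand_adj k) \<le> l2_norm strip_M k"
    using * unfolding nn_integral_L2[OF L2] by (intro power2_le_imp_le[OF _ l2_norm_nonneg]) simp
qed

lemma gelfand_adj_add:
  assumes "k \<in> band" "k' \<in> band"
  shows "AE x in lborel. gelfand_adj (\<lambda>p. k p + c * k' p) x = gelfand_adj k x + c * gelfand_adj k' x"
proof -
  have "AE y in unit_M. \<forall>x. ift (\<lambda>p. k p + c * k' p) (x, y) = ift k (x, y) + c * ift k' (x, y)"
    using assms[THEN band_integrable, THEN AE_integrable_slice]
  proof eventually_elim
    case (elim y)
    show ?case
      using ft1_add[of "\<lambda>x. cnj (k (x, y))" "\<lambda>x. cnj (k' (x, y))" "cnj c"] elim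
      by (simp add: ift_def ft_def)
  qed
  from AE_real_of_unit[OF this] show ?thesis by eventually_elim (simp add: gelfand_adj_def)
qed

lemma gelfand_adj_diff:
  assumes "k \<in> band" "k' \<in> band"
  shows "AE x in lborel. gelfand_adj (\<lambda>p. k p - k' p) x = gelfand_adj k x - gelfand_adj k' x"
  using gelfand_adj_add[OF assms, of "-1"] by simp

section \<open>Zero extension from the zone and the Gelfand transform as a closure\<close>

lemma zone_measurable:
  assumes "k \<in> borel_measurable strip_M"
  shows "k \<in> borel_measurable zone_M"
proof -
  have id: "(\<lambda>x. x) \<in> borel_measurable (restrict_space lborel {-pi..pi})"
    by (rule measurable_restrict_space1) simp
  have "fst \<in> measurable zone_M lborel"
    using measurable_compose[OF measurable_fst id, of unit_M] by simp
  then have "(\<lambda>p. (fst p, snd p)) \<in> measurable zone_M strip_M"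
    by (rule measurable_Pair[OF _ measurable_snd])
  from measurable_compose[OF this assms] show ?thesis by simp
qed

lemma ext_zero_apply: "ext_zero g p = (if fst p \<in> {-pi..pi} then g p else 0)"
  by (cases p) (simp add: ext_zero_def)

lemma ext_zero_measurable:
  assumes "g \<in> borel_measurable zone_M"
  shows "ext_zero g \<in> borel_measurable strip_M"
proof -
  let ?A = "{-pi..pi} \<times> {0..1::real}"
  have A: "?A \<inter> space strip_M \<in> sets strip_M"
  proof -
    have "{0..1} \<in> sets unit_M" using sets.top[of unit_M] by simp
    then have "?A \<in> rectangles" unfolding rectangles_def by blast
    then have "?A \<in> sets strip_M" unfolding rectangles(3) by (rule sigma_sets.Basic)
    then show ?thesis by (rule sets.Int[OF _ sets.top])
  qed
  have f: "fst \<in> measurable (restrict_space strip_M ?A) (restrict_space lborel {-pi..pi})"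
  proof (rule measurable_restrict_space2)
    show "fst \<in> measurable (restrict_space strip_M ?A) lborel"
      by (rule measurable_restrict_space1) (rule measurable_fst)
  qed (auto simp: space_restrict_space)
  have s: "snd \<in> measurable (restrict_space strip_M ?A) unit_M"
    by (rule measurable_restrict_space1) (rule measurable_snd)
  have "(\<lambda>p. (fst p, snd p)) \<in> measurable (restrict_space strip_M ?A) zone_M"
    using f s by (rule measurable_Pair)
  then have "(\<lambda>p. g (fst p, snd p)) \<in> borel_measurable (restrict_space strip_M ?A)"
    using assms by (rule measurable_compose)
  then have "(\<lambda>p. if p \<in> ?A then g p else 0) \<in> borel_measurable strip_M"
  proof (subst measurable_If_restrict_space_iff)
    have "{p \<in> space strip_M. p \<in> ?A} = ?A \<inter> space strip_M" by auto
    then show "{p \<in> space strip_M. p \<in> ?A} \<in> sets strip_M" using A by simp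
    have "{p. p \<in> ?A} = ?A" by simp
    then show "g \<in> borel_measurable (restrict_space strip_M {p. p \<in> ?A}) \<and> (\<lambda>p. 0) \<in> borel_measurable (restrict_space strip_M {p. p \<notin> ?A})"
      if "(\<lambda>p. g (fst p, snd p)) \<in> borel_measurable (restrict_space strip_M ?A)"
      using that by simp
  qed
  then show ?thesis
    by (rule measurable_cong[THEN iffD1, rotated]) (auto simp: ext_zero_apply)
qed

lemma nn_integral_zone:
  assumes "f \<in> borel_measurable zone_M" "f' \<in> borel_measurable strip_M"
    and "\<And>\<theta> y. y \<in> {0..1} \<Longrightarrow> f' (\<theta>, y) = f (\<theta>, y) * indicator {-pi..pi} \<theta>"
  shows "(\<integral>\<^sup>+p. f p \<partial>zone_M) = (\<integral>\<^sup>+p. f' p \<partial>strip_M)"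
proof -
  have "sigma_finite_measure (restrict_space lborel {-pi..pi})"
    by (intro finite_measure.axioms finite_measureI) (simp add: emeasure_restrict_space emeasure_lborel_Icc_eq)
  then interpret Z: pair_sigma_finite "restrict_space lborel {-pi..pi}" unit_M
    by (intro pair_sigma_finite.intro unit_M.sigma_finite_measure_axioms)
  have "(\<integral>\<^sup>+p. f p \<partial>zone_M) = (\<integral>\<^sup>+y. (\<integral>\<^sup>+\<theta>. f (\<theta>, y) \<partial>restrict_space lborel {-pi..pi}) \<partial>unit_M)"
    by (rule Z.nn_integral_snd[OF assms(1), symmetric])
  also have "\<dots> = (\<integral>\<^sup>+y. (\<integral>\<^sup>+\<theta>. f' (\<theta>, y) \<partial>lborel) \<partial>unit_M)"
    by (intro nn_integral_cong) (simp add: nn_integral_restrict_space assms(3))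
  also have "\<dots> = (\<integral>\<^sup>+p. f' p \<partial>strip_M)" by (rule nn_integral_strip[OF assms(2), symmetric])
  finally show ?thesis .
qed

lemma zone_L2:
  assumes g: "g \<in> borel_measurable zone_M"
  shows "g \<in> L2 zone_M \<longleftrightarrow> ext_zero g \<in> band"
    and "g \<in> L2 zone_M \<Longrightarrow> l2_norm zone_M g = l2_norm strip_M (ext_zero g)"
proof -
  note e = ext_zero_measurable[OF g]
  have eq: "(\<integral>\<^sup>+p. ennreal ((cmod (g p))\<^sup>2) \<partial>zone_M) = (\<integral>\<^sup>+p. ennreal ((cmod (ext_zero g p))\<^sup>2) \<partial>strip_M)"
  proof (rule nn_integral_zone)
    show "(\<lambda>p. ennreal ((cmod (g p))\<^sup>2)) \<in> borel_measurable zone_M" using g by simp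
    show "(\<lambda>p. ennreal ((cmod (ext_zero g p))\<^sup>2)) \<in> borel_measurable strip_M" using e by simp
  qed (auto simp: ext_zero_apply indicator_def)
  show 1: "g \<in> L2 zone_M \<longleftrightarrow> ext_zero g \<in> band"
    using g e eq by (auto simp: L2_iff_nn_integral band_def ext_zero_apply)
  assume "g \<in> L2 zone_M"
  moreover from this have "ext_zero g \<in> L2 strip_M" using 1 band_L2 by blast
  ultimately show "l2_norm zone_M g = l2_norm strip_M (ext_zero g)"
    using eq by (simp add: nn_integral_L2 power2_eq_iff_nonneg)
qed

lemma ext_zero_diff: "ext_zero (\<lambda>p. f p - g p) = (\<lambda>p. ext_zero f p - ext_zero g p)"
  by (auto simp: ext_zero_apply fun_eq_iff)

definition gform :: "(real \<Rightarrow> complex) \<Rightarrow> real \<times> real \<Rightarrow> complex" where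
  "gform F = (\<lambda>(\<theta>, y). of_real (1 / sqrt (2 * pi)) *
     (\<Sum>\<^sub>\<infinity>l\<in>(UNIV :: int set). F (y + of_int l) * cis (- (\<theta> * (y + of_int l)))))"

lemma gelfand_eq: "gelfand = l2_closure lborel zone_M {(F, gform F) | F. F \<in> test_funs}"
  unfolding gelfand_def gform_def ..

lemma gform_eq_sum:
  assumes "F \<in> test_funs"
  obtains N where "\<And>x. x \<notin> {- real N..<real N + 1} \<Longrightarrow> F x = 0"
    "\<And>p. p \<in> space strip_M \<Longrightarrow> ext_zero (gform F) p = gelfand_sum N F p"
proof -
  obtain R where R: "R > 0" "\<And>x. \<bar>x\<bar> > R \<Longrightarrow> F x = 0"
    by (rule test_funs_cases[OF assms]) blast
  \<comment> \<open>The margin 1 absorbs the position of \<open>y\<close> inside the cell: already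
    for l = - N - 1 the point y + l is at most - N, hence below - R.\<close>
  obtain N where N: "R + 1 \<le> real N" using real_arch_simple by blast
  show ?thesis
  proof (rule that[of N])
    show "F x = 0" if "x \<notin> {- real N..<real N + 1}" for x
      using that N R(2)[of x] by (auto simp: abs_if)
    fix p :: "real \<times> real" assume p: "p \<in> space strip_M"
    have "(\<Sum>\<^sub>\<infinity>l\<in>(UNIV :: int set). F (snd p + of_int l) * cis (- (fst p * (snd p + of_int l)))) =
        (\<Sum>\<^sub>\<infinity>l\<in>{-int N..int N}. F (snd p + of_int l) * cis (- (fst p * (snd p + of_int l))))"
    proof (rule infsum_cong_neutral)
      fix l assume "l \<in> UNIV - {-int N..int N}"
      then have "of_int l \<le> - real N - 1 \<or> real N + 1 \<le> of_int l" by (auto simp: not_le)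
      then have "\<bar>snd p + of_int l\<bar> > R" using p N by auto
      then show "F (snd p + of_int l) * cis (- (fst p * (snd p + of_int l))) = 0" using R(2) by simp
    qed auto
    then show "ext_zero (gform F) p = gelfand_sum N F p"
      by (cases p) (auto simp: ext_zero_apply gform_def gelfand_sum_def abs_le_iff)
  qed
qed

lemma gform_facts:
  assumes F: "F \<in> test_funs"
  shows "gform F \<in> L2 zone_M"
    and "\<And>k. k \<in> band \<Longrightarrow> l2_inner strip_M (ext_zero (gform F)) k = l2_inner lborel F (gelfand_adj k)"
    and "\<And>x. gelfand_adj (ext_zero (gform F)) x = F x"
proof -
  obtain N where N: "\<And>x. x \<notin> {- real N..<real N + 1} \<Longrightarrow> F x = 0"
    "\<And>p. p \<in> space strip_M \<Longrightarrow> ext_zero (gform F) p = gelfand_sum N F p"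
    using gform_eq_sum[OF F] by blast
  have FL2: "F \<in> L2 lborel" using F by (rule test_funs_L2)
  have b: "gelfand_sum N F \<in> band" by (rule gelfand_sum_band[OF FL2])
  have zone: "gform F p = gelfand_sum N F p" if "p \<in> space zone_M" for p
  proof -
    have "fst p \<in> {-pi..pi}" "p \<in> space strip_M" using that by (auto simp: space_pair_measure)
    then show ?thesis using N(2)[of p] by (simp add: ext_zero_apply)
  qed
  have m: "gform F \<in> borel_measurable zone_M"
    using zone_measurable[OF L2_measurable[OF band_L2[OF b]]] zone by (simp cong: measurable_cong)
  have "ext_zero (gform F) \<in> L2 strip_M"
    by (rule L2_AE_cong[OF band_L2[OF b] ext_zero_measurable[OF m]]) (use N(2) in \<open>auto intro!: AE_I2\<close>)
  then have eb: "ext_zero (gform F) \<in> band" by (auto simp: band_def ext_zero_apply)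
  then show "gform F \<in> L2 zone_M" using zone_L2(1)[OF m] by blast
  show "l2_inner strip_M (ext_zero (gform F)) k = l2_inner lborel F (gelfand_adj k)" if "k \<in> band" for k
  proof -
    have "l2_inner strip_M (ext_zero (gform F)) k = l2_inner strip_M (gelfand_sum N F) k"
      unfolding l2_inner_def using N(2) by (intro Bochner_Integration.integral_cong) auto
    then show ?thesis using gelfand_sum_inner[OF FL2 N(1) that] by simp
  qed
  show "gelfand_adj (ext_zero (gform F)) x = F x" for x
  proof -
    have "ext_zero (gform F) (\<theta>, frac x) = gelfand_sum N F (\<theta>, frac x)" for \<theta>
      using N(2)[of "(\<theta>, frac x)"] frac_lt_1[of x] by auto
    then show ?thesis using gelfand_adj_sum[OF FL2 N(1), where x = x] by (simp add: gelfand_adj_def ift_eq)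
  qed
qed

text \<open>Each property is known for test functions and passes to the limit, because
  \<open>gelfand_adj\<close> is a contraction from \<open>band\<close> to L2. The norm identity is
  the duality formula at k = \<open>ext_zero g\<close>, combined with the left-inverse
  property.\<close>

theorem gelfand_facts:
  assumes Fg: "(F, g) \<in> gelfand"
  shows "F \<in> L2 lborel" "ext_zero g \<in> band" "l2_norm strip_M (ext_zero g) = l2_norm lborel F"
    and "\<And>k. k \<in> band \<Longrightarrow> l2_inner strip_M (ext_zero g) k = l2_inner lborel F (gelfand_adj k)"
    and "AE x in lborel. gelfand_adj (ext_zero g) x = F x"
proof -
  obtain s t where st: "F \<in> L2 lborel" "g \<in> L2 zone_M" "\<And>n. (s n, t n) \<in> {(F, gform F) | F. F \<in> test_funs}"
    "\<And>n. s n \<in> L2 lborel" "\<And>n. t n \<in> L2 zone_M"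
    "(\<lambda>n. l2_norm lborel (\<lambda>x. s n x - F x)) \<longlonglongrightarrow> 0" "(\<lambda>n. l2_norm zone_M (\<lambda>x. t n x - g x)) \<longlonglongrightarrow> 0"
    using Fg[unfolded gelfand_eq] by (rule l2_closureE) blast
  have s: "s n \<in> test_funs" "t n = gform (s n)" for n using st(3)[of n] by auto
  show F: "F \<in> L2 lborel" by (rule st)
  show g: "ext_zero g \<in> band" using zone_L2(1) st(2) L2_measurable by blast
  have tb: "ext_zero (t n) \<in> band" for n using zone_L2(1) st(5) L2_measurable by blast
  have "l2_norm zone_M (\<lambda>x. t n x - g x) = l2_norm strip_M (\<lambda>p. ext_zero (t n) p - ext_zero g p)" for n
    using zone_L2(2)[OF L2_measurable L2_diff[OF st(5)[of n] st(2)]] L2_diff[OF st(5)[of n] st(2)]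
    by (simp add: ext_zero_diff)
  then have tlim: "(\<lambda>n. l2_norm strip_M (\<lambda>p. ext_zero (t n) p - ext_zero g p)) \<longlonglongrightarrow> 0" using st(7) by simp
  show inner: "l2_inner strip_M (ext_zero g) k = l2_inner lborel F (gelfand_adj k)" if k: "k \<in> band" for k
  proof (rule LIMSEQ_unique)
    show "(\<lambda>n. l2_inner strip_M (ext_zero (t n)) k) \<longlonglongrightarrow> l2_inner strip_M (ext_zero g) k"
      by (rule l2_inner_tendsto[OF band_L2[OF tb] band_L2[OF g] tlim band_L2[OF k]])
    have "(\<lambda>n. l2_inner lborel (s n) (gelfand_adj k)) \<longlonglongrightarrow> l2_inner lborel F (gelfand_adj k)"
      by (rule l2_inner_tendsto[OF st(4) F st(6) gelfand_adj_bounded(1)[OF k]])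
    then show "(\<lambda>n. l2_inner strip_M (ext_zero (t n)) k) \<longlonglongrightarrow> l2_inner lborel F (gelfand_adj k)"
      using gform_facts(2)[OF s(1) k] s(2) by simp
  qed
  have gL2: "gelfand_adj (ext_zero g) \<in> L2 lborel" by (rule gelfand_adj_bounded[OF g])
  have "(\<lambda>n. l2_norm lborel (\<lambda>x. s n x - gelfand_adj (ext_zero g) x)) \<longlonglongrightarrow> 0"
  proof (rule Lim_null_comparison[OF always_eventually tlim], rule allI)
    fix n
    have d: "(\<lambda>p. ext_zero (t n) p - ext_zero g p) \<in> band" by (rule band_diff[OF tb g])
    have "l2_norm lborel (\<lambda>x. s n x - gelfand_adj (ext_zero g) x) = l2_norm lborel (gelfand_adj (\<lambda>p. ext_zero (t n) p - ext_zero g p))"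
    proof (rule l2_norm_AE_cong)
      show "AE x in lborel. s n x - gelfand_adj (ext_zero g) x = gelfand_adj (\<lambda>p. ext_zero (t n) p - ext_zero g p) x"
        using gelfand_adj_diff[OF tb[of n] g] by eventually_elim (simp add: s(2) gform_facts(3)[OF s(1)])
    qed (rule L2_measurable[OF L2_diff[OF st(4) gL2]] L2_measurable[OF gelfand_adj_bounded(1)[OF d]])+
    also have "\<dots> \<le> l2_norm strip_M (\<lambda>p. ext_zero (t n) p - ext_zero g p)" by (rule gelfand_adj_bounded[OF d])
    finally show "norm (l2_norm lborel (\<lambda>x. s n x - gelfand_adj (ext_zero g) x)) \<le> l2_norm strip_M (\<lambda>p. ext_zero (t n) p - ext_zero g p)"
      by simp
  qed
  from l2_lim_unique[OF st(4) gL2 this F st(6)]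
  show AE: "AE x in lborel. gelfand_adj (ext_zero g) x = F x" .
  have "l2_inner strip_M (ext_zero g) (ext_zero g) = l2_inner lborel F F"
    unfolding inner[OF g] by (rule l2_inner_cong_right[OF F gL2 F AE])
  then show "l2_norm strip_M (ext_zero g) = l2_norm lborel F"
    by (simp add: l2_inner_self power2_eq_iff_nonneg flip: of_real_power)
qed

text \<open>Duality and the left-inverse property show that differences of \<open>gform\<close>
  values have the same norm as the differences of the test functions. A convergent sequence of test
  functions therefore has Cauchy images, and completeness supplies the limit.\<close>

theorem gelfand_exists:
  assumes F: "F \<in> L2 lborel"
  obtains g where "(F, g) \<in> gelfand"
proof -
  obtain s where s: "\<And>n::nat. s n \<in> test_funs" "(\<lambda>n. l2_norm lborel (\<lambda>x. s n x - F x)) \<longlonglongrightarrow> 0"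
    using test_funs_dense[OF F] by blast
  have sL2: "s n \<in> L2 lborel" for n by (rule test_funs_L2[OF s(1)])
  have t: "gform (s n) \<in> L2 zone_M" for n by (rule gform_facts[OF s(1)])
  have tb: "ext_zero (gform (s n)) \<in> band" for n using zone_L2(1) t L2_measurable by blast
  have eq: "l2_norm zone_M (\<lambda>x. gform (s m) x - gform (s n) x) = l2_norm lborel (\<lambda>x. s m x - s n x)" for m n
  proof -
    let ?d = "\<lambda>p. ext_zero (gform (s m)) p - ext_zero (gform (s n)) p"
    have d: "?d \<in> band" by (rule band_diff[OF tb tb])
    have AE: "AE x in lborel. gelfand_adj ?d x = s m x - s n x"
      using gelfand_adj_diff[OF tb[of m] tb[of n]] by eventually_elim (simp add: gform_facts(3)[OF s(1)])
    have "l2_inner strip_M ?d ?d = l2_inner lborel (s m) (gelfand_adj ?d) - l2_inner lborel (s n) (gelfand_adj ?d)"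
      using l2_inner_diff_left[OF band_L2[OF tb[of m]] band_L2[OF tb[of n]] band_L2[OF d]]
      by (simp add: gform_facts(2)[OF s(1) d])
    also have "\<dots> = l2_inner lborel (\<lambda>x. s m x - s n x) (gelfand_adj ?d)"
      by (rule l2_inner_diff_left[symmetric]) (use sL2 gelfand_adj_bounded[OF d] in auto)
    also have "\<dots> = l2_inner lborel (\<lambda>x. s m x - s n x) (\<lambda>x. s m x - s n x)"
      by (rule l2_inner_cong_right[OF L2_diff[OF sL2 sL2] gelfand_adj_bounded(1)[OF d] L2_diff[OF sL2 sL2] AE])
    finally have "l2_norm strip_M ?d = l2_norm lborel (\<lambda>x. s m x - s n x)"
      by (simp add: l2_inner_self power2_eq_iff_nonneg flip: of_real_power)
    then show ?thesis
      using zone_L2(2)[OF L2_measurable L2_diff[OF t[of m] t[of n]]] L2_diff[OF t[of m] t[of n]]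
      by (simp add: ext_zero_diff)
  qed
  have "\<exists>g\<in>L2 zone_M. (\<lambda>n. l2_norm zone_M (\<lambda>x. gform (s n) x - g x)) \<longlonglongrightarrow> 0"
    by (rule L2_complete[OF t]) (simp add: eq l2_Cauchy[OF sL2 F s(2)])
  then obtain g where g: "g \<in> L2 zone_M" "(\<lambda>n. l2_norm zone_M (\<lambda>x. gform (s n) x - g x)) \<longlonglongrightarrow> 0" by blast
  have "(F, g) \<in> gelfand"
    unfolding gelfand_eq
    by (rule l2_closureI[of _ _ _ _ s "\<lambda>n. gform (s n)"]) (use F g s sL2 t in auto)
  then show ?thesis by (rule that)
qed

section \<open>Weak derivatives\<close>

lemma AE_strip_fst:
  assumes "AE x in lborel. P x" shows "AE p in strip_M. P (fst p)"
proof -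
  obtain N where N: "N \<in> null_sets lborel" "{x \<in> space lborel. \<not> P x} \<subseteq> N"
    using assms unfolding eventually_ae_filter by blast
  show ?thesis
  proof (rule AE_I')
    show "N \<times> {0..1} \<in> null_sets strip_M"
      using unit_M.times_in_null_sets1[OF N(1), of "{0..1}"] sets.top[of unit_M] by simp
    show "{p \<in> space strip_M. \<not> P (fst p)} \<subseteq> N \<times> {0..1}" using N(2) by auto
  qed
qed

lemma L2_tensor:
  assumes f: "f \<in> L2 lborel" and B: "B \<in> sets unit_M"
  shows "(\<lambda>p. f (fst p) * indicator B (snd p)) \<in> L2 strip_M"
proof -
  have [measurable]: "f \<in> borel_measurable borel" using L2_measurable[OF f] by simp
  have fst: "(\<lambda>p. f (fst p)) \<in> borel_measurable strip_M"
    by (rule measurable_compose[OF measurable_fst]) simp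
  have snd: "(\<lambda>p. indicator B (snd p) :: complex) \<in> borel_measurable strip_M"
    by (rule measurable_compose[OF measurable_snd]) (use B in simp)
  have m: "(\<lambda>p. f (fst p) * indicator B (snd p)) \<in> borel_measurable strip_M"
    using fst snd by (rule borel_measurable_times)
  have "integrable strip_M (\<lambda>p. complex_of_real ((cmod (f (fst p)))\<^sup>2) * indicator B (snd p))"
  proof (rule integrable_pair_mult[OF sigma_finite_lborel unit_M.sigma_finite_measure_axioms])
    show "integrable lborel (\<lambda>x. complex_of_real ((cmod (f x))\<^sup>2))" using L2_integrable[OF f] by (rule integrable_of_real)
    have "integrable unit_M (\<lambda>y. complex_of_real (indicator B y))"
      using B unit_M.emeasure_finite[of B, unfolded infinity_ennreal_def less_top]
      by (intro integrable_of_real integrable_real_indicator) auto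
    moreover have "(\<lambda>y. complex_of_real (indicator B y)) = indicator B" by (auto simp: indicator_def)
    ultimately show "integrable unit_M (indicator B :: real \<Rightarrow> complex)" by simp
  qed
  from integrable_norm[OF this] have "integrable strip_M (\<lambda>p. (cmod (f (fst p) * indicator B (snd p)))\<^sup>2)"
  proof (rule Bochner_Integration.integrable_bound)
    show "(\<lambda>p. (cmod (f (fst p) * indicator B (snd p)))\<^sup>2) \<in> borel_measurable strip_M"
      using measurable_compose[OF m borel_measurable_norm] by (rule borel_measurable_power)
  qed (auto simp: norm_mult norm_power indicator_def)
  then show ?thesis using m by (simp add: L2_def)
qed

text \<open>The fundamental lemma of the calculus of variations with scalar test functions.
  Tensoring a test function with the indicator of a set of \<open>y\<close> values approximates
  every rectangle. Each pairing involves a single test function, so its null set of \<open>y\<close>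
  does not affect the integral.\<close>

lemma weak_dx_zero:
  assumes W: "W \<in> L2 strip_M" and zero: "\<And>\<phi>. \<phi> \<in> test_funs \<Longrightarrow> AE y in unit_M. (LINT x|lborel. \<phi> x * W (x, y)) = 0"
  shows "AE p in strip_M. W p = 0"
proof -
  let ?W = "\<lambda>p. cnj (W p)"
  have cW: "?W \<in> L2 strip_M" using W by (rule L2_cnj)
  have "AE p in strip_M. ?W p = 0"
  proof (rule strip_orthogonal_zero[OF cW])
    fix X assume "X \<in> rectangles"
    then obtain a b B where X: "X = {a..b} \<times> B" and B: "B \<in> sets unit_M" by (auto simp: rectangles_def)
    have XL2: "(indicator X :: _ \<Rightarrow> complex) \<in> L2 strip_M" using \<open>X \<in> rectangles\<close> by (rule rectangle_L2)
    show "l2_inner strip_M (indicator X) ?W = 0"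
    proof (cases "a \<le> b")
      case False
      then have "X = {}" by (simp add: X)
      then show ?thesis by (simp add: l2_inner_def)
    next
      case True
      then obtain \<phi> where \<phi>: "\<And>n. \<phi> n \<in> test_funs" "\<And>n x. cmod (\<phi> n x) \<le> 1" "\<And>n x. x \<notin> {a..b} \<Longrightarrow> \<phi> n x = 0"
        "\<And>x. x \<in> {a<..<b} \<Longrightarrow> (\<lambda>n. \<phi> n x) \<longlonglongrightarrow> 1"
        using test_funs_approx_Icc by blast
      define s where "s n p = \<phi> n (fst p) * indicator B (snd p)" for n p
      have sL2: "s n \<in> L2 strip_M" for n unfolding s_def by (rule L2_tensor[OF test_funs_L2[OF \<phi>(1)] B])
      have "(\<lambda>n. l2_norm strip_M (\<lambda>x. s n x - indicator X x)) \<longlonglongrightarrow> 0"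
      proof (rule l2_norm_dominated_convergence[OF L2_measurable[OF sL2] L2_measurable[OF XL2] XL2])
        have "AE p in strip_M. fst p \<noteq> a" "AE p in strip_M. fst p \<noteq> b"
          by (rule AE_strip_fst, rule AE_lborel_singleton)+
        then show "AE p in strip_M. (\<lambda>n. s n p) \<longlonglongrightarrow> indicator X p"
        proof eventually_elim
          case (elim p)
          then consider "fst p \<in> {a<..<b}" | "fst p \<notin> {a..b}" by force
          then show ?case
          proof cases
            case 1
            then have "(\<lambda>n. s n p) \<longlonglongrightarrow> 1 * indicator B (snd p)"
              unfolding s_def by (intro tendsto_mult tendsto_const \<phi>(4))
            then show ?thesis using 1 by (cases p) (simp add: X indicator_def)
          next
            case 2
            then have "s n p = 0" for n unfolding s_def using \<phi>(3) by simp
            moreover have "p \<notin> X" using 2 by (cases p) (auto simp: X)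
            ultimately show ?thesis by simp
          qed
        qed
        show "AE p in strip_M. cmod (s n p - indicator X p) \<le> 2 * cmod (indicator X p)" for n
        proof (rule AE_I2)
          fix p
          show "cmod (s n p - indicator X p) \<le> 2 * cmod (indicator X p)"
          proof (cases "p \<in> X")
            case True
            then have "cmod (s n p) \<le> 1" using \<phi>(2) by (cases p) (simp add: s_def X)
            then show ?thesis using True norm_triangle_ineq4[of "s n p" 1] by simp
          next
            case False
            then have "fst p \<notin> {a..b} \<or> snd p \<notin> B" by (cases p) (auto simp: X)
            then have "s n p = 0" unfolding s_def using \<phi>(3) by auto
            then show ?thesis using False by simp
          qed
        qed
      qed
      then have lim: "(\<lambda>n. l2_inner strip_M (s n) ?W) \<longlonglongrightarrow> l2_inner strip_M (indicator X) ?W"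
        by (intro l2_inner_tendsto sL2 XL2 cW)
      have "l2_inner strip_M (s n) ?W = 0" for n
      proof -
        have "l2_inner strip_M (s n) ?W = (LINT y|unit_M. l2_inner lborel (\<lambda>x. s n (x, y)) (\<lambda>x. ?W (x, y)))"
          by (rule l2_inner_strip[OF sL2 cW])
        also have "\<dots> = (LINT y|unit_M. indicator B y * (LINT x|lborel. \<phi> n x * W (x, y)))"
        proof (rule Bochner_Integration.integral_cong[OF refl])
          fix y
          have "s n (x, y) * cnj (?W (x, y)) = indicator B y * (\<phi> n x * W (x, y))" for x by (simp add: s_def)
          then show "l2_inner lborel (\<lambda>x. s n (x, y)) (\<lambda>x. ?W (x, y)) = indicator B y * (LINT x|lborel. \<phi> n x * W (x, y))"
            by (simp only: l2_inner_def integral_mult_right_zero)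
        qed
        also have "\<dots> = 0"
        proof (rule integral_eq_zero_AE)
          show "AE y in unit_M. indicator B y * (LINT x|lborel. \<phi> n x * W (x, y)) = 0"
            using zero[OF \<phi>(1)[of n]] by eventually_elim simp
        qed
        finally show ?thesis .
      qed
      with lim show ?thesis by (simp add: LIMSEQ_const_iff)
    qed
  qed
  then show ?thesis by eventually_elim simp
qed

lemma test_funs_deriv_L2:
  assumes "\<phi> \<in> test_funs"
  shows "(\<lambda>x. vector_derivative \<phi> (at x)) \<in> test_funs"
proof -
  obtain g where g: "smooth g" "\<And>x. (\<phi> has_vector_derivative g x) (at x)"
    using assms smooth_deriv unfolding test_funs_iff by blast
  obtain R \<phi>' where R: "\<And>x. (\<phi> has_vector_derivative \<phi>' x) (at x)" "\<And>x. \<bar>x\<bar> > R \<Longrightarrow> \<phi>' x = 0"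
    by (rule test_funs_cases[OF assms]) blast
  have eq: "vector_derivative \<phi> (at x) = g x" "g x = \<phi>' x" for x
    using g(2) R(1) by (auto intro: vector_derivative_at vector_derivative_unique_at)
  have "{x. g x \<noteq> 0} \<subseteq> {-R..R}" using R(2) unfolding eq(2) by (force simp: abs_le_iff not_less[symmetric])
  then have "bounded {x. g x \<noteq> 0}" using bounded_subset bounded_closed_interval by blast
  then show ?thesis using g(1) by (simp add: test_funs_iff eq(1))
qed

lemma is_weak_dx_diff:
  assumes "u \<in> L2 strip_M" "v \<in> L2 strip_M" "is_weak_dx u w" "is_weak_dx v z"
  shows "is_weak_dx (\<lambda>p. u p - v p) (\<lambda>p. w p - z p)"
  unfolding is_weak_dx_def
proof (intro conjI ballI)
  have L2: "w \<in> L2 strip_M" "z \<in> L2 strip_M" using assms by (auto simp: is_weak_dx_def)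
  then show "(\<lambda>p. w p - z p) \<in> L2 strip_M" by (rule L2_diff)
  fix \<phi> assume \<phi>: "\<phi> \<in> test_funs"
  have "AE y in unit_M. (LINT x|lborel. vector_derivative \<phi> (at x) * u (x, y)) = - (LINT x|lborel. \<phi> x * w (x, y))"
    "AE y in unit_M. (LINT x|lborel. vector_derivative \<phi> (at x) * v (x, y)) = - (LINT x|lborel. \<phi> x * z (x, y))"
    using assms \<phi> by (auto simp: is_weak_dx_def)
  then show "AE y in unit_M. (LINT x|lborel. vector_derivative \<phi> (at x) * (u (x, y) - v (x, y))) =
      - (LINT x|lborel. \<phi> x * (w (x, y) - z (x, y)))"
    using AE_L2_slice[OF assms(1)] AE_L2_slice[OF assms(2)] AE_L2_slice[OF L2(1)] AE_L2_slice[OF L2(2)]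
  proof eventually_elim
    case (elim y)
    show ?case
      using elim(1,2) integrable_L2_mult[OF test_funs_L2[OF test_funs_deriv_L2[OF \<phi>]] elim(3)]
        integrable_L2_mult[OF test_funs_L2[OF test_funs_deriv_L2[OF \<phi>]] elim(4)]
        integrable_L2_mult[OF test_funs_L2[OF \<phi>] elim(5)] integrable_L2_mult[OF test_funs_L2[OF \<phi>] elim(6)]
      by (simp add: right_diff_distrib)
  qed
qed

text \<open>Both candidates subtract to a weak derivative of zero. Consequently the choice made by
  \<open>SOME\<close> in \<open>weak_dx\<close> affects nothing beyond a null set.\<close>

lemma is_weak_dx_unique:
  assumes "u \<in> L2 strip_M" "is_weak_dx u w" "is_weak_dx u w'"
  shows "AE p in strip_M. w p = w' p"
proof -
  have d: "is_weak_dx (\<lambda>p. u p - u p) (\<lambda>p. w p - w' p)"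
    by (rule is_weak_dx_diff[OF assms(1,1,2,3)])
  have "AE p in strip_M. w p - w' p = 0"
  proof (rule weak_dx_zero)
    show "(\<lambda>p. w p - w' p) \<in> L2 strip_M" using d by (simp add: is_weak_dx_def)
    show "AE y in unit_M. (LINT x|lborel. \<phi> x * (w (x, y) - w' (x, y))) = 0" if "\<phi> \<in> test_funs" for \<phi>
      using d that unfolding is_weak_dx_def by force
  qed
  then show ?thesis by eventually_elim simp
qed

lemma ft1_deriv:
  assumes d: "\<And>x. (\<phi> has_vector_derivative \<phi>' x) (at x)" and cont: "continuous_on UNIV \<phi>'"
    and supp: "\<And>x. \<bar>x\<bar> > R \<Longrightarrow> \<phi> x = 0" "\<And>x. \<bar>x\<bar> > R \<Longrightarrow> \<phi>' x = 0"
  shows "ft1 \<phi>' \<xi> = \<i> * \<xi> * ft1 \<phi> \<xi>"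
proof -
  \<comment> \<open>The endpoints lie strictly outside the support, so the boundary terms of the
    integration by parts vanish.\<close>
  define r where "r = \<bar>R\<bar> + 1"
  have r: "r > 0" "R < r" by (auto simp: r_def)
  have contp: "continuous_on UNIV \<phi>" by (rule continuous_on_vector_derivative) (use d in auto)
  let ?I = "\<lambda>x. indicator {-r..r} x :: real"
  have i: "integrable lborel (\<lambda>x. ?I x *\<^sub>R (f x * cis (- (x * \<xi>))))" if "continuous_on UNIV f" for f
    by (intro borel_integrable_atLeastAtMost'[unfolded set_integrable_def] continuous_intros
        continuous_on_subset[OF that subset_UNIV])
  have cut: "f x * cis (- (x * \<xi>)) = ?I x *\<^sub>R (f x * cis (- (x * \<xi>)))" if "\<And>x. \<bar>x\<bar> > R \<Longrightarrow> f x = 0" for f x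
    using that[of x] r by (cases "x \<in> {-r..r}") (auto simp: indicator_def abs_if split: if_splits)
  have "(LINT x|lborel. ?I x *\<^sub>R (\<phi>' x * cis (- (x * \<xi>)) + \<phi> x * (- \<i> * \<xi> * cis (- (x * \<xi>))))) =
      \<phi> r * cis (- (r * \<xi>)) - \<phi> (- r) * cis (- (- r * \<xi>))"
  proof (rule integral_FTC_Icc)
    fix x :: real
    have "((\<lambda>z. exp (- \<i> * \<xi> * z)) has_field_derivative (- \<i> * \<xi> * exp (- \<i> * \<xi> * of_real x))) (at (of_real x))"
      by (auto intro!: derivative_eq_intros)
    from has_vector_derivative_real_field[OF this]
    have e: "((\<lambda>x. cis (- (x * \<xi>))) has_vector_derivative (- \<i> * \<xi> * cis (- (x * \<xi>)))) (at x)"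
      by (simp add: cis_conv_exp mult_ac)
    show "((\<lambda>x. \<phi> x * cis (- (x * \<xi>))) has_vector_derivative \<phi>' x * cis (- (x * \<xi>)) + \<phi> x * (- \<i> * \<xi> * cis (- (x * \<xi>)))) (at x within {-r..r})"
      by (subst add.commute) (rule has_vector_derivative_at_within[OF has_vector_derivative_mult[OF d e]])
    show "continuous_on {-r..r} (\<lambda>x. \<phi>' x * cis (- (x * \<xi>)) + \<phi> x * (- \<i> * \<xi> * cis (- (x * \<xi>))))"
      by (intro continuous_intros continuous_on_subset[OF cont subset_UNIV] continuous_on_subset[OF contp subset_UNIV])
  qed (use r in auto)
  also have "\<dots> = 0" using supp(1)[of r] supp(1)[of "- r"] r by simp
  also have "(LINT x|lborel. ?I x *\<^sub>R (\<phi>' x * cis (- (x * \<xi>)) + \<phi> x * (- \<i> * \<xi> * cis (- (x * \<xi>))))) =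
      (LINT x|lborel. ?I x *\<^sub>R (\<phi>' x * cis (- (x * \<xi>))) + (- \<i> * \<xi>) * (?I x *\<^sub>R (\<phi> x * cis (- (x * \<xi>)))))"
    by (rule Bochner_Integration.integral_cong) (simp_all add: scaleR_conv_of_real algebra_simps)
  finally have 0: "(LINT x|lborel. ?I x *\<^sub>R (\<phi>' x * cis (- (x * \<xi>))) + (- \<i> * \<xi>) * (?I x *\<^sub>R (\<phi> x * cis (- (x * \<xi>))))) = 0" .
  have "(LINT x|lborel. ?I x *\<^sub>R (\<phi>' x * cis (- (x * \<xi>)))) + (LINT x|lborel. (- \<i> * \<xi>) * (?I x *\<^sub>R (\<phi> x * cis (- (x * \<xi>))))) = 0"
    unfolding 0[symmetric] by (rule Bochner_Integration.integral_add[symmetric, OF i[OF cont] integrable_mult_right[OF i[OF contp]]])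
  moreover have "(LINT x|lborel. f x * cis (- (x * \<xi>))) = (LINT x|lborel. ?I x *\<^sub>R (f x * cis (- (x * \<xi>))))"
    if "\<And>x. \<bar>x\<bar> > R \<Longrightarrow> f x = 0" for f
    by (rule Bochner_Integration.integral_cong[OF refl]) (rule cut[OF that])
  ultimately have "(LINT x|lborel. \<phi>' x * cis (- (x * \<xi>))) = \<i> * \<xi> * (LINT x|lborel. \<phi> x * cis (- (x * \<xi>)))"
    using supp unfolding integral_mult_right_zero by (simp add: add_eq_0_iff2)
  then show ?thesis by (simp add: ft1_def mult_ac)
qed

lemma ft1_multiplication_cnj:
  assumes "integrable lborel u" "integrable lborel k"
  shows "(LINT x|lborel. u x * cnj (ft1 (\<lambda>\<xi>. cnj (k \<xi>)) x)) = (LINT \<xi>|lborel. cnj (ft1 (\<lambda>x. cnj (u x)) \<xi>) * k \<xi>)"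
proof -
  have "(LINT \<xi>|lborel. ft1 (\<lambda>x. cnj (u x)) \<xi> * cnj (k \<xi>)) = (LINT x|lborel. cnj (u x) * ft1 (\<lambda>\<xi>. cnj (k \<xi>)) x)"
    using assms by (intro ft1_multiplication) auto
  from arg_cong[OF this, of cnj] show ?thesis
    by (simp flip: Bochner_Integration.integral_cnj)
qed

lemma L2_freq_mult:
  assumes k: "k \<in> L2 strip_M" "\<And>\<xi> y. \<bar>\<xi>\<bar> > R \<Longrightarrow> k (\<xi>, y) = 0"
  shows "(\<lambda>p. \<i> * fst p * k p) \<in> L2 strip_M"
proof (rule L2_bound[OF _ k(1)])
  have "(\<lambda>p. complex_of_real (fst p)) \<in> borel_measurable strip_M"
    by (rule measurable_compose[OF measurable_fst]) simp
  then show "(\<lambda>p. \<i> * fst p * k p) \<in> borel_measurable strip_M"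
    using L2_measurable[OF k(1)] by (intro borel_measurable_times borel_measurable_const)
  show "AE p in strip_M. cmod (\<i> * fst p * k p) \<le> \<bar>R\<bar> * cmod (k p)"
  proof (rule AE_I2)
    fix p :: "real \<times> real"
    show "cmod (\<i> * fst p * k p) \<le> \<bar>R\<bar> * cmod (k p)"
    proof (cases "\<bar>fst p\<bar> > R")
      case True
      then show ?thesis using k(2)[of "fst p" "snd p"] by simp
    next
      case False
      then show ?thesis by (auto simp: norm_mult intro!: mult_right_mono)
    qed
  qed
qed

text \<open>The multiplication formula moves \<open>ift\<close> onto the test function, where
  differentiation is multiplication by i \<open>\<xi>\<close> after an honest integration by parts.
  Conjugating that factor produces the minus sign of the weak derivative.\<close>

theorem is_weak_dx_ift:
  assumes k: "k \<in> L2 strip_M" "\<And>\<xi> y. \<bar>\<xi>\<bar> > R \<Longrightarrow> k (\<xi>, y) = 0"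
  shows "is_weak_dx (ift k) (ift (\<lambda>p. \<i> * fst p * k p))"
  unfolding is_weak_dx_def
proof (intro conjI ballI)
  let ?k = "\<lambda>p. \<i> * complex_of_real (fst p) * k p"
  have k': "?k \<in> L2 strip_M" by (rule L2_freq_mult[OF k])
  have i: "integrable strip_M k" "integrable strip_M ?k"
    using integrable_bounded_support[OF k(1)] integrable_bounded_support[OF k', of R] k(2) by auto
  show "ift ?k \<in> L2 strip_M" by (rule ift_L2(1)[OF i(2) k'])
  fix \<phi> assume \<phi>: "\<phi> \<in> test_funs"
  obtain R' \<phi>' where \<phi>': "R' > 0" "\<And>x. \<bar>x\<bar> > R' \<Longrightarrow> \<phi> x = 0" "\<And>x. (\<phi> has_vector_derivative \<phi>' x) (at x)"
    "continuous_on UNIV \<phi>" "continuous_on UNIV \<phi>'" "\<And>x. \<bar>x\<bar> > R' \<Longrightarrow> \<phi>' x = 0"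
    by (rule test_funs_cases[OF \<phi>]) (rule that, assumption+)
  have vd: "vector_derivative \<phi> (at x) = \<phi>' x" for x using \<phi>'(3) by (rule vector_derivative_at)
  have int: "integrable lborel f" if "continuous_on UNIV f" "\<And>x. \<bar>x\<bar> > R' \<Longrightarrow> f x = 0" for f :: "real \<Rightarrow> complex"
  proof -
    have "integrable lborel (\<lambda>x. indicator {-R'..R'} x *\<^sub>R f x)"
      by (rule borel_integrable_atLeastAtMost'[unfolded set_integrable_def])
         (rule continuous_on_subset[OF that(1) subset_UNIV])
    moreover have "indicator {-R'..R'} x *\<^sub>R f x = f x" for x
      using that(2)[of x] by (cases "x \<in> {-R'..R'}") (auto simp: abs_if split: if_splits)
    ultimately show ?thesis by simp
  qed
  have ft': "ft1 (\<lambda>x. cnj (\<phi>' x)) \<xi> = \<i> * \<xi> * ft1 (\<lambda>x. cnj (\<phi> x)) \<xi>" for \<xi>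
  proof (rule ft1_deriv[where R = R'])
    show "((\<lambda>x. cnj (\<phi> x)) has_vector_derivative cnj (\<phi>' x)) (at x)" for x
      using bounded_linear.has_vector_derivative[OF bounded_linear_cnj \<phi>'(3)] .
    show "continuous_on UNIV (\<lambda>x. cnj (\<phi>' x))" by (intro continuous_intros \<phi>')
  qed (use \<phi>' in auto)
  show "AE y in unit_M. (LINT x|lborel. vector_derivative \<phi> (at x) * ift k (x, y)) = - (LINT x|lborel. \<phi> x * ift ?k (x, y))"
    using AE_integrable_slice[OF i(1)] AE_integrable_slice[OF i(2)]
  proof eventually_elim
    case (elim y)
    have "(LINT x|lborel. vector_derivative \<phi> (at x) * ift k (x, y)) = (LINT \<xi>|lborel. cnj (ft1 (\<lambda>x. cnj (\<phi>' x)) \<xi>) * k (\<xi>, y))"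
      using ft1_multiplication_cnj[OF int[OF \<phi>'(5,6)] elim(1)] by (simp add: vd ift_def ft_def)
    also have "\<dots> = (LINT \<xi>|lborel. - (cnj (ft1 (\<lambda>x. cnj (\<phi> x)) \<xi>) * ?k (\<xi>, y)))"
      unfolding ft' by (intro Bochner_Integration.integral_cong) (auto simp: mult_ac)
    also have "\<dots> = - (LINT \<xi>|lborel. cnj (ft1 (\<lambda>x. cnj (\<phi> x)) \<xi>) * ?k (\<xi>, y))"
      by (rule Bochner_Integration.integral_minus)
    also have "(LINT \<xi>|lborel. cnj (ft1 (\<lambda>x. cnj (\<phi> x)) \<xi>) * ?k (\<xi>, y)) = (LINT x|lborel. \<phi> x * ift ?k (x, y))"
      using ft1_multiplication_cnj[OF int[OF \<phi>'(4,2)] elim(2)] by (simp add: ift_def ft_def)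
    finally show ?case .
  qed
qed

text \<open>
  Test functions in the weak derivative are scalar, so it cannot be tested against \<open>ift k\<close> directly.
  Testing against \<open>cis (- \<xi> x) \<eta>(x)\<close> with a cutoff \<open>\<eta>\<close>, for each \<open>\<xi>\<close>, determines the Fourier
  transform of \<open>\<eta> v'\<close> instead.
\<close>
theorem weak_dx_ift_adjoint:
  assumes v: "v \<in> L2 strip_M" "is_weak_dx v v'"
    and k: "k \<in> L2 strip_M" "\<And>\<xi> y. \<bar>\<xi>\<bar> > R \<Longrightarrow> k (\<xi>, y) = 0"
  shows "l2_inner strip_M (ift k) v' = - l2_inner strip_M (ift (\<lambda>p. \<i> * fst p * k p)) v"
proof -
  let ?k = "\<lambda>p. \<i> * complex_of_real (fst p) * k p"
  have k': "?k \<in> L2 strip_M" by (rule L2_freq_mult[OF k])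
  have i: "integrable strip_M k" "integrable strip_M ?k"
    using integrable_bounded_support[OF k(1)] integrable_bounded_support[OF k', of R] k(2) by auto
  have v': "v' \<in> L2 strip_M" using v(2) by (simp add: is_weak_dx_def)
  obtain \<eta> \<eta>' C where \<eta>: "\<And>n::nat. \<eta> n \<in> test_funs" "\<And>n x. (\<eta> n has_vector_derivative \<eta>' n x) (at x)"
    "\<And>n x. cmod (\<eta> n x) \<le> C" "\<And>n x. cmod (\<eta>' n x) \<le> C" "C \<ge> 0"
    "\<And>n. continuous_on UNIV (\<eta> n)" "\<And>n. continuous_on UNIV (\<eta>' n)"
    "\<And>x. (\<lambda>n. \<eta> n x) \<longlonglongrightarrow> 1" "\<And>x. (\<lambda>n. \<eta>' n x) \<longlonglongrightarrow> 0"
    "\<And>n. \<exists>R>0. \<forall>x. \<bar>x\<bar> > R \<longrightarrow> \<eta> n x = 0 \<and> \<eta>' n x = 0"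
    by (rule test_funs_cutoff) blast
  have cm: "(\<lambda>p. f (fst p)) \<in> borel_measurable strip_M" if "continuous_on UNIV f" for f :: "real \<Rightarrow> complex"
    by (rule measurable_compose[OF measurable_fst]) (use borel_measurable_continuous_onI[OF that] in simp)
  have cut_L2: "(\<lambda>p. \<eta> n (fst p) * f p) \<in> L2 strip_M" "(\<lambda>p. \<eta>' n (fst p) * f p) \<in> L2 strip_M" if "f \<in> L2 strip_M" for f n
    using \<eta>(3,4,6,7) by (auto intro!: L2_mult_bounded[OF that] cm)
  have cut_int: "integrable strip_M (\<lambda>p. \<eta> n (fst p) * f p)" "integrable strip_M (\<lambda>p. \<eta>' n (fst p) * f p)" if "f \<in> L2 strip_M" for f n
  proof -
    obtain R where "\<forall>x. \<bar>x\<bar> > R \<longrightarrow> \<eta> n x = 0 \<and> \<eta>' n x = 0" using \<eta>(10) by blast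
    then show "integrable strip_M (\<lambda>p. \<eta> n (fst p) * f p)" "integrable strip_M (\<lambda>p. \<eta>' n (fst p) * f p)"
      using integrable_bounded_support[OF cut_L2(1)[OF that, of n], of R] integrable_bounded_support[OF cut_L2(2)[OF that, of n], of R]
      by auto
  qed
  let ?a = "\<lambda>n. ft (\<lambda>p. \<eta> n (fst p) * v p)" and ?b = "\<lambda>n. ft (\<lambda>p. \<eta>' n (fst p) * v p)"
    and ?c = "\<lambda>n. ft (\<lambda>p. \<eta> n (fst p) * v' p)"
  have ft_eq: "AE p in strip_M. ?c n p = \<i> * fst p * ?a n p - ?b n p" for n
  proof (rule strip.AE_pair_measure)
    have fst: "(\<lambda>p. complex_of_real (fst p)) \<in> borel_measurable strip_M"
      by (rule cm) (intro continuous_intros)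
    have 1: "?c n \<in> borel_measurable strip_M"
      by (rule ft_measurable[OF L2_measurable[OF cut_L2(1)[OF v']]])
    have 2: "(\<lambda>p. \<i> * fst p * ?a n p - ?b n p) \<in> borel_measurable strip_M"
      using fst ft_measurable[OF L2_measurable[OF cut_L2(1)[OF v(1), of n]]] ft_measurable[OF L2_measurable[OF cut_L2(2)[OF v(1), of n]]]
      by (intro borel_measurable_diff borel_measurable_times borel_measurable_const)
    have "{p \<in> space strip_M. ?c n p - (\<i> * fst p * ?a n p - ?b n p) \<in> {0}} \<in> sets strip_M"
      by (rule measurable_sets_Collect[OF borel_measurable_diff[OF 1 2]]) simp
    then show "{p \<in> space strip_M. ?c n p = \<i> * fst p * ?a n p - ?b n p} \<in> sets strip_M" by simp
    \<comment> \<open>The test function contains the frequency, so the exceptional set of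
      \<open>y\<close> varies with \<open>\<xi>\<close>. As the equality set is measurable, this
      order of quantifiers suffices for the statement on the strip.\<close>
    show "AE \<xi> in lborel. AE y in unit_M. ?c n (\<xi>, y) = \<i> * fst (\<xi>, y) * ?a n (\<xi>, y) - ?b n (\<xi>, y)"
    proof (rule AE_I2)
      fix \<xi> :: real
      let ?e = "\<lambda>x. cis (- \<xi> * x)"
      let ?\<phi> = "\<lambda>x. ?e x * \<eta> n x"
      have t: "?\<phi> \<in> test_funs" by (rule test_funs_mult[OF \<eta>(1) smooth_cis])
      have d: "vector_derivative ?\<phi> (at x) = ?e x * \<eta>' n x - \<i> * \<xi> * (?e x * \<eta> n x)" for x
      proof -
        have "((\<lambda>z. exp (- \<i> * \<xi> * z)) has_field_derivative (- \<i> * \<xi> * exp (- \<i> * \<xi> * of_real x))) (at (of_real x))"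
          by (auto intro!: derivative_eq_intros)
        from has_vector_derivative_real_field[OF this]
        have "(?e has_vector_derivative (- \<i> * \<xi> * ?e x)) (at x)"
          by (simp add: cis_conv_exp mult_ac)
        from vector_derivative_at[OF has_vector_derivative_mult[OF this \<eta>(2)[of n x]]]
        have "vector_derivative ?\<phi> (at x) = ?e x * \<eta>' n x + (- \<i> * \<xi> * ?e x) * \<eta> n x" .
        also have "\<dots> = ?e x * \<eta>' n x - \<i> * \<xi> * (?e x * \<eta> n x)" by (simp only: mult_minus_left mult.assoc) simp
        finally show ?thesis .
      qed
      have "AE y in unit_M. (LINT x|lborel. vector_derivative ?\<phi> (at x) * v (x, y)) = - (LINT x|lborel. ?\<phi> x * v' (x, y))"
        using v(2) t by (simp add: is_weak_dx_def)
      then show "AE y in unit_M. ?c n (\<xi>, y) = \<i> * fst (\<xi>, y) * ?a n (\<xi>, y) - ?b n (\<xi>, y)"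
        using AE_integrable_slice[OF cut_int(1)[OF v(1), of n]] AE_integrable_slice[OF cut_int(2)[OF v(1), of n]]
      proof eventually_elim
        case (elim y)
        have "(LINT x|lborel. vector_derivative ?\<phi> (at x) * v (x, y)) =
            (LINT x|lborel. \<eta>' n x * v (x, y) * ?e x - (\<i> * \<xi>) * (\<eta> n x * v (x, y) * ?e x))"
          unfolding d by (intro Bochner_Integration.integral_cong) (auto simp: algebra_simps)
        also have "\<dots> = (LINT x|lborel. \<eta>' n x * v (x, y) * ?e x) - (LINT x|lborel. (\<i> * \<xi>) * (\<eta> n x * v (x, y) * ?e x))"
          using integrable_mult_cis[OF elim(2), of "- \<xi>"] integrable_mult_cis[OF elim(3), of "- \<xi>"]
          by (intro Bochner_Integration.integral_diff integrable_mult_right) simp_all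
        also have "\<dots> = (LINT x|lborel. \<eta>' n x * v (x, y) * ?e x) - (\<i> * \<xi>) * (LINT x|lborel. \<eta> n x * v (x, y) * ?e x)"
          by (simp only: integral_mult_right_zero)
        finally have A: "(LINT x|lborel. vector_derivative ?\<phi> (at x) * v (x, y)) =
            (LINT x|lborel. \<eta>' n x * v (x, y) * ?e x) - (\<i> * \<xi>) * (LINT x|lborel. \<eta> n x * v (x, y) * ?e x)" .
        have B: "(LINT x|lborel. ?\<phi> x * v' (x, y)) = (LINT x|lborel. \<eta> n x * v' (x, y) * ?e x)"
          by (intro Bochner_Integration.integral_cong) (auto simp: mult_ac)
        have "c = b - a" if "t = - c" "t = a - b" for a b c t :: complex
          using that by (metis minus_diff_eq minus_minus)
        from this[OF elim(1)[unfolded B] A]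
        have "(LINT x|lborel. \<eta> n x * v' (x, y) * ?e x) =
            (\<i> * \<xi>) * (LINT x|lborel. \<eta> n x * v (x, y) * ?e x) - (LINT x|lborel. \<eta>' n x * v (x, y) * ?e x)" .
        moreover have "?e x = cis (- (x * \<xi>))" for x by (simp add: mult.commute)
        ultimately have E: "(LINT x|lborel. \<eta> n x * v' (x, y) * cis (- (x * \<xi>))) =
            (\<i> * \<xi>) * (LINT x|lborel. \<eta> n x * v (x, y) * cis (- (x * \<xi>))) - (LINT x|lborel. \<eta>' n x * v (x, y) * cis (- (x * \<xi>)))"
          by (simp only:)
        have "z * (w * a - b) = w * (z * a) - z * b" for a b z w :: complex by (simp add: algebra_simps)
        then show ?case unfolding ft_def ft1_def fst_conv snd_conv E .
      qed
    qed
  qed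
  have adj: "l2_inner strip_M (\<lambda>p. \<eta> n (fst p) * v' p) (ift k) =
      - l2_inner strip_M (\<lambda>p. \<eta> n (fst p) * v p) (ift ?k) - l2_inner strip_M (\<lambda>p. \<eta>' n (fst p) * v p) (ift k)" for n
  proof -
    define a b c \<kappa> where "a = ?a n" and "b = ?b n" and "c = ?c n" and "\<kappa> = ?k"
    have L2: "a \<in> L2 strip_M" "b \<in> L2 strip_M" "c \<in> L2 strip_M" "\<kappa> \<in> L2 strip_M"
      unfolding a_def b_def c_def \<kappa>_def
      by (rule plancherel_strip(1)[OF cut_int(1)[OF v(1)] cut_L2(1)[OF v(1)]]
          plancherel_strip(1)[OF cut_int(2)[OF v(1)] cut_L2(2)[OF v(1)]]
          plancherel_strip(1)[OF cut_int(1)[OF v'] cut_L2(1)[OF v']] k')+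
    have iA: "integrable strip_M (\<lambda>p. a p * cnj (\<kappa> p))" by (rule integrable_L2_cnj[OF L2(1,4)])
    have iB: "integrable strip_M (\<lambda>p. b p * cnj (k p))" by (rule integrable_L2_cnj[OF L2(2) k(1)])
    have iC: "integrable strip_M (\<lambda>p. c p * cnj (k p))" by (rule integrable_L2_cnj[OF L2(3) k(1)])
    have iA': "integrable strip_M (\<lambda>p. - (a p * cnj (\<kappa> p)))" using iA by (rule integrable_minus)
    \<comment> \<open>Conjugation reverses the sign of i \<open>fst p\<close>, hence the minus sign
      in front of the pairing with \<open>\<kappa>\<close>.\<close>
    have alg: "c p * cnj (k p) = - (a p * cnj (\<kappa> p)) - b p * cnj (k p)"
      if "c p = \<i> * complex_of_real (fst p) * a p - b p" for p
      unfolding that \<kappa>_def by (simp add: algebra_simps)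
    have "l2_inner strip_M (\<lambda>p. \<eta> n (fst p) * v' p) (ift k) = l2_inner strip_M c k"
      unfolding c_def by (rule ft_ift_adjoint[symmetric, OF cut_int(1)[OF v'] cut_L2(1)[OF v'] i(1) k(1)])
    also have "\<dots> = (LINT p|strip_M. - (a p * cnj (\<kappa> p)) - b p * cnj (k p))"
      unfolding l2_inner_def
    proof (rule integral_cong_AE)
      show "(\<lambda>p. c p * cnj (k p)) \<in> borel_measurable strip_M"
        using iC by (rule borel_measurable_integrable)
      show "(\<lambda>p. - (a p * cnj (\<kappa> p)) - b p * cnj (k p)) \<in> borel_measurable strip_M"
        using Bochner_Integration.integrable_diff[OF iA' iB] by (rule borel_measurable_integrable)
      have "AE p in strip_M. c p = \<i> * complex_of_real (fst p) * a p - b p"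
        using ft_eq[of n] unfolding a_def b_def c_def .
      then show "AE p in strip_M. c p * cnj (k p) = - (a p * cnj (\<kappa> p)) - b p * cnj (k p)"
        by eventually_elim (rule alg)
    qed
    also have "\<dots> = (LINT p|strip_M. - (a p * cnj (\<kappa> p))) - (LINT p|strip_M. b p * cnj (k p))"
      using iA' iB by (rule Bochner_Integration.integral_diff)
    also have "\<dots> = - l2_inner strip_M a \<kappa> - l2_inner strip_M b k"
      by (simp only: l2_inner_def Bochner_Integration.integral_minus)
    also have "l2_inner strip_M a \<kappa> = l2_inner strip_M (\<lambda>p. \<eta> n (fst p) * v p) (ift ?k)"
      unfolding a_def \<kappa>_def by (rule ft_ift_adjoint[OF cut_int(1)[OF v(1)] cut_L2(1)[OF v(1)] i(2) k'])
    also have "l2_inner strip_M b k = l2_inner strip_M (\<lambda>p. \<eta>' n (fst p) * v p) (ift k)"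
      unfolding b_def by (rule ft_ift_adjoint[OF cut_int(2)[OF v(1)] cut_L2(2)[OF v(1)] i(1) k(1)])
    finally show ?thesis .
  qed
  have lim1: "(\<lambda>n. l2_norm strip_M (\<lambda>p. \<eta> n (fst p) * f p - f p)) \<longlonglongrightarrow> 0" if f: "f \<in> L2 strip_M" for f
  proof (rule l2_norm_dominated_convergence[OF L2_measurable[OF cut_L2(1)[OF f]] L2_measurable[OF f] f])
    show "AE p in strip_M. (\<lambda>n. \<eta> n (fst p) * f p) \<longlonglongrightarrow> f p"
      using tendsto_mult[OF \<eta>(8) tendsto_const] by (intro AE_I2) simp
    have "cmod (\<eta> n x * z - z) \<le> (C + 1) * cmod z" for n x z
    proof -
      have "cmod (\<eta> n x * z - z) = cmod (\<eta> n x - 1) * cmod z" by (simp add: left_diff_distrib flip: norm_mult)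
      also have "\<dots> \<le> (C + 1) * cmod z"
        using \<eta>(3)[of n x] norm_triangle_ineq4[of "\<eta> n x" 1] by (intro mult_right_mono) auto
      finally show ?thesis .
    qed
    then show "AE p in strip_M. cmod (\<eta> n (fst p) * f p - f p) \<le> (C + 1) * cmod (f p)" for n by simp
  qed
  have lim0: "(\<lambda>n. l2_norm strip_M (\<lambda>p. \<eta>' n (fst p) * f p - 0)) \<longlonglongrightarrow> 0" if f: "f \<in> L2 strip_M" for f
  proof (rule l2_norm_dominated_convergence[OF L2_measurable[OF cut_L2(2)[OF f]] L2_measurable[OF L2_zero] f])
    show "AE p in strip_M. (\<lambda>n. \<eta>' n (fst p) * f p) \<longlonglongrightarrow> 0"
      using tendsto_mult[OF \<eta>(9) tendsto_const] by (intro AE_I2) simp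
    show "AE p in strip_M. cmod (\<eta>' n (fst p) * f p - 0) \<le> C * cmod (f p)" for n
      using \<eta>(4) by (intro AE_I2) (auto simp: norm_mult intro: mult_right_mono)
  qed
  have K: "ift k \<in> L2 strip_M" "ift ?k \<in> L2 strip_M" using ift_L2(1) i k(1) k' by blast+
  define A B where "A n = l2_inner strip_M (\<lambda>p. \<eta> n (fst p) * v' p) (ift k)"
    and "B n = - l2_inner strip_M (\<lambda>p. \<eta> n (fst p) * v p) (ift ?k) - l2_inner strip_M (\<lambda>p. \<eta>' n (fst p) * v p) (ift k)" for n
  have AB: "A = B" unfolding A_def[abs_def] B_def[abs_def] by (rule ext) (rule adj)
  have LA: "A \<longlonglongrightarrow> l2_inner strip_M v' (ift k)"
    unfolding A_def[abs_def] by (rule l2_inner_tendsto[OF cut_L2(1)[OF v'] v' lim1[OF v'] K(1)])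
  \<comment> \<open>The cutoffs tend to 1 while their derivatives tend to 0, so the commutator term
    with \<open>\<eta>'\<close> disappears in the limit.\<close>
  have LB: "B \<longlonglongrightarrow> - l2_inner strip_M v (ift ?k) - l2_inner strip_M (\<lambda>p. 0) (ift k)"
    unfolding B_def[abs_def]
    by (intro tendsto_diff tendsto_minus
        l2_inner_tendsto[OF cut_L2(1)[OF v(1)] v(1) lim1[OF v(1)] K(2)]
        l2_inner_tendsto[OF cut_L2(2)[OF v(1)] L2_zero lim0[OF v(1)] K(1)])
  have "l2_inner strip_M v' (ift k) = - l2_inner strip_M v (ift ?k) - l2_inner strip_M (\<lambda>p. 0) (ift k)"
    using LA LB unfolding AB by (rule LIMSEQ_unique)
  then have "l2_inner strip_M v' (ift k) = - l2_inner strip_M v (ift ?k)" by (simp add: l2_inner_def)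
  then have "cnj (l2_inner strip_M v' (ift k)) = - cnj (l2_inner strip_M v (ift ?k))" by simp
  then show ?thesis unfolding l2_inner_commute[symmetric] .
qed

section \<open>Lebesgue measurable coefficients\<close>

lemma completion_measurable_AE:
  fixes f g :: "'a \<Rightarrow> 'b :: topological_space"
  assumes g: "g \<in> borel_measurable M" and eq: "AE x in M. f x = g x"
  shows "f \<in> borel_measurable (completion M)"
proof (rule measurableI)
  fix A :: "'b set" assume A: "A \<in> sets borel"
  show "f -` A \<inter> space (completion M) \<in> sets (completion M)"
  proof (rule completion.in_sets_AE)
    show "g -` A \<inter> space M \<in> sets (completion M)"
      using measurable_sets[OF g A] by (rule sets_completionI_sets)
    have "AE x in completion M. f x = g x" using eq by (rule AE_completion)
    then show "AE x in completion M. (x \<in> g -` A \<inter> space M) = (x \<in> f -` A \<inter> space (completion M))"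
      by eventually_elim simp
  qed simp
qed simp

lemma integral_completion_AE:
  fixes f g :: "'a \<Rightarrow> complex"
  assumes g: "g \<in> borel_measurable M" and eq: "AE x in M. f x = g x"
  shows "(LINT x|completion M. f x) = (LINT x|M. g x)"
proof -
  have "(LINT x|completion M. f x) = (LINT x|completion M. g x)"
    using completion_measurable_AE[OF g eq] AE_completion[OF eq] measurable_completion[OF g]
    by (intro integral_cong_AE) auto
  also have "\<dots> = (LINT x|M. g x)" by (rule integral_completion[OF g])
  finally show ?thesis .
qed

lemma AE_lborel_scale:
  assumes "AE x in lborel. P (x::real)" "c \<noteq> 0"
  shows "AE x in lborel. P (c * x)"
proof -
  obtain N where N: "N \<in> null_sets lborel" "{x \<in> space lborel. \<not> P x} \<subseteq> N"
    using assms(1) unfolding eventually_ae_filter by blast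
  have "AE x in lborel. x \<notin> N" by (rule AE_not_in[OF N(1)])
  then have "AE x in lborel. 0 + c * x \<notin> N"
    using N(1) by (intro AE_borel_affine assms(2)) (auto simp: pred_def null_sets_def intro: sets.Diff)
  then show ?thesis by eventually_elim (use N(2) in auto)
qed

text \<open>Slice by slice the dilation multiplies the measure of the exceptional set by 1 / |c|, so
  its preimage is again null. It is needed because the rescaling in \<open>interp\<close> acts on a
  function known only almost everywhere.\<close>

lemma AE_strip_scale:
  assumes P: "AE p in strip_M. P p" and c: "c \<noteq> 0"
  shows "AE p in strip_M. P (c * fst p, snd p)"
proof -
  obtain N where N: "N \<in> null_sets strip_M" "{p \<in> space strip_M. \<not> P p} \<subseteq> N"
    using P unfolding eventually_ae_filter by blast
  have Nm: "N \<in> sets strip_M" "emeasure strip_M N = 0" using N(1) by auto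
  let ?f = "\<lambda>p. (c * fst p, snd p)"
  have fst: "(\<lambda>p. c * fst p) \<in> measurable strip_M lborel"
    using measurable_compose[OF measurable_fst, of "\<lambda>x. c * x" lborel lborel unit_M] by simp
  have f: "?f \<in> measurable strip_M strip_M" using fst measurable_snd by (rule measurable_Pair)
  let ?N = "?f -` N \<inter> space strip_M"
  have N': "?N \<in> sets strip_M" using f Nm(1) by (rule measurable_sets)
  have ind: "(indicator N :: _ \<Rightarrow> ennreal) \<in> borel_measurable strip_M" using Nm(1) by simp
  have i: "indicator N (x, y) \<le> (indicator N (x, y) :: ennreal)" for x y by simp
  have "emeasure strip_M ?N = (\<integral>\<^sup>+p. indicator ?N p \<partial>strip_M)" using N' by simp
  also have "\<dots> = (\<integral>\<^sup>+p. indicator N (?f p) \<partial>strip_M)" by (intro nn_integral_cong) (auto simp: indicator_def)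
  also have "\<dots> = (\<integral>\<^sup>+y. (\<integral>\<^sup>+x. indicator N (c * x, y) \<partial>lborel) \<partial>unit_M)"
    using nn_integral_strip[OF measurable_compose[OF f ind]] by simp
  also have "\<dots> = (\<integral>\<^sup>+y. ennreal (1 / \<bar>c\<bar>) * (\<integral>\<^sup>+x. indicator N (x, y) \<partial>lborel) \<partial>unit_M)"
  proof (rule nn_integral_cong)
    fix y assume "y \<in> space unit_M"
    then have m: "(\<lambda>x. indicator N (x, y) :: ennreal) \<in> borel_measurable borel"
      using slice_measurable[OF ind] by simp
    have "ennreal (1 / \<bar>c\<bar>) * (\<integral>\<^sup>+x. indicator N (x, y) \<partial>lborel) =
        ennreal (1 / \<bar>c\<bar>) * (ennreal \<bar>c\<bar> * (\<integral>\<^sup>+x. indicator N (c * x, y) \<partial>lborel))"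
      by (subst nn_integral_real_affine[OF m c, of 0]) simp
    also have "\<dots> = ennreal (1 / \<bar>c\<bar> * \<bar>c\<bar>) * (\<integral>\<^sup>+x. indicator N (c * x, y) \<partial>lborel)"
      by (simp only: mult.assoc[symmetric] ennreal_mult[symmetric] abs_ge_zero zero_le_divide_1_iff)
    finally show "(\<integral>\<^sup>+x. indicator N (c * x, y) \<partial>lborel) = ennreal (1 / \<bar>c\<bar>) * (\<integral>\<^sup>+x. indicator N (x, y) \<partial>lborel)"
      using c by simp
  qed
  also have "\<dots> = ennreal (1 / \<bar>c\<bar>) * (\<integral>\<^sup>+y. (\<integral>\<^sup>+x. indicator N (x, y) \<partial>lborel) \<partial>unit_M)"
  proof (rule nn_integral_cmult)
    have "(\<lambda>(y, x). indicator N (x, y) :: ennreal) \<in> borel_measurable (unit_M \<Otimes>\<^sub>M lborel)"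
      using measurable_pair_swap[OF ind] .
    then show "(\<lambda>y. \<integral>\<^sup>+x. indicator N (x, y) \<partial>lborel) \<in> borel_measurable unit_M"
      by (rule lborel.borel_measurable_nn_integral)
  qed
  also have "(\<integral>\<^sup>+y. (\<integral>\<^sup>+x. indicator N (x, y) \<partial>lborel) \<partial>unit_M) = emeasure strip_M N"
    using nn_integral_strip[OF ind] Nm by simp
  finally have "?N \<in> null_sets strip_M" using N' Nm(2) by (intro null_setsI) simp_all
  then show ?thesis
  proof (rule AE_I')
    show "{p \<in> space strip_M. \<not> P (c * fst p, snd p)} \<subseteq> ?N"
    proof
      fix p assume p: "p \<in> {p \<in> space strip_M. \<not> P (c * fst p, snd p)}"
      then have "?f p \<in> {p \<in> space strip_M. \<not> P p}" by auto
      then have "?f p \<in> N" using N(2) by blast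
      then show "p \<in> ?N" using p by simp
    qed
  qed
qed

lemma periodic_int:
  assumes "\<And>y. D (y + 1) = D (y :: real)"
  shows "D (y + of_int n) = D y"
proof -
  have nat: "D (z + real k) = D z" for z k
  proof (induction k)
    case (Suc k)
    then show ?case using assms[of "z + real k"] by (simp add: add_ac)
  qed simp
  show ?thesis
  proof (cases n)
    case (nonneg k)
    then show ?thesis using nat by simp
  next
    case (neg k)
    then show ?thesis using nat[of "y + of_int n" "Suc k"] by simp
  qed
qed

text \<open>A Borel representative from the completion is read only on the unit cell and repeated
  through \<open>frac\<close>, then clamped between the bounds. Period and bounds thus hold at every
  point, and only the agreement with \<open>D\<close> is almost everywhere. The upper level
  \<open>max K m\<close> keeps the clamp consistent with the lower one.\<close>

lemma periodic_borel_representative: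
  fixes D :: "real \<Rightarrow> real"
  assumes D: "D \<in> borel_measurable lebesgue" "\<exists>K. AE y in lebesgue. \<bar>D y\<bar> \<le> K" "\<And>y. D (y + 1) = D y"
    and m: "\<And>y. D y \<ge> m"
  obtains d K where "d \<in> borel_measurable borel" "\<And>y. m \<le> d y" "\<And>y. d y \<le> K" "\<And>y. d (frac y) = d y"
    "AE y in lborel. D y = d y"
proof -
  obtain B where B: "B \<in> borel_measurable lborel" "AE y in lborel. D y = B y"
    using completion_ex_borel_measurable_real[OF D(1)] by blast
  obtain K where "AE y in lebesgue. \<bar>D y\<bar> \<le> K" using D(2) by blast
  then have K: "AE y in lborel. \<bar>D y\<bar> \<le> K" unfolding AE_completion_iff .
  define d where "d y = max m (min (max K m) (B (frac y)))" for y
  have "AE y in unit_M. D y = B y \<and> \<bar>D y\<bar> \<le> K"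
    using B(2) K by (subst AE_restrict_space_iff) auto
  from AE_real_of_unit[OF this] have "AE y in lborel. D y = d y"
  proof eventually_elim
    case (elim y)
    have "D (frac y) = D y" using periodic_int[of D "frac y" "\<lfloor>y\<rfloor>"] D(3) by (simp add: frac_def)
    then show ?case using elim m[of y] by (auto simp: d_def)
  qed
  moreover have "d \<in> borel_measurable borel"
  proof -
    have "frac \<in> borel_measurable (borel :: real measure)"
      unfolding frac_def[abs_def] by (intro borel_measurable_diff borel_measurable_real_floor) simp_all
    from measurable_compose[OF this, of B borel] B(1) have "(\<lambda>y. B (frac y)) \<in> borel_measurable borel" by simp
    then show ?thesis unfolding d_def[abs_def] by (intro borel_measurable_max borel_measurable_min borel_measurable_const)
  qed
  ultimately show ?thesis
    by (intro that[of d "max K m"]) (auto simp: d_def)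
qed

section \<open>Rescaling\<close>

text \<open>The unitary dilation on the frequency side. \<open>ift\<close> intertwines it with
  \<open>unscaling \<epsilon>\<close>, so the rescaled frequency is the quasimomentum divided by
  \<open>\<epsilon>\<close>.\<close>

definition dil :: "real \<Rightarrow> (real \<times> real \<Rightarrow> complex) \<Rightarrow> real \<times> real \<Rightarrow> complex" where
  "dil \<epsilon> k p = of_real (sqrt \<epsilon>) * k (\<epsilon> * fst p, snd p)"

lemma dil_measurable:
  assumes "k \<in> borel_measurable strip_M" shows "dil \<epsilon> k \<in> borel_measurable strip_M"
proof -
  have "(\<lambda>p. \<epsilon> * fst p) \<in> measurable strip_M lborel"
    using measurable_compose[OF measurable_fst, of "\<lambda>x. \<epsilon> * x" lborel lborel unit_M] by simp
  then have "(\<lambda>p. (\<epsilon> * fst p, snd p)) \<in> measurable strip_M strip_M" using measurable_snd by (rule measurable_Pair)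
  from measurable_compose[OF this assms] show ?thesis
    unfolding dil_def[abs_def] by (intro borel_measurable_times borel_measurable_const)
qed

lemma dil_slice_integral:
  fixes f :: "real \<Rightarrow> complex"
  assumes "\<epsilon> > 0"
  shows "(LINT x|lborel. of_real \<epsilon> * f (\<epsilon> * x)) = (LINT x|lborel. f x)"
  using assms by (subst lborel_integral_real_affine[of \<epsilon> f 0]) (simp_all add: scaleR_conv_of_real)

lemma dil_L2:
  assumes k: "k \<in> L2 strip_M" and \<epsilon>: "\<epsilon> > 0"
  shows "dil \<epsilon> k \<in> L2 strip_M"
proof -
  have km: "k \<in> borel_measurable strip_M" by (rule L2_measurable[OF k])
  have sq: "(\<lambda>p. ennreal ((cmod (f p))\<^sup>2)) \<in> borel_measurable strip_M" if "f \<in> borel_measurable strip_M" for f :: "_ \<Rightarrow> complex"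
    using that by simp
  have "(\<integral>\<^sup>+p. ennreal ((cmod (dil \<epsilon> k p))\<^sup>2) \<partial>strip_M) =
      (\<integral>\<^sup>+y. (\<integral>\<^sup>+x. ennreal ((cmod (dil \<epsilon> k (x, y)))\<^sup>2) \<partial>lborel) \<partial>unit_M)"
    by (rule nn_integral_strip[OF sq[OF dil_measurable[OF km]]])
  also have "\<dots> = (\<integral>\<^sup>+y. (\<integral>\<^sup>+x. ennreal ((cmod (k (x, y)))\<^sup>2) \<partial>lborel) \<partial>unit_M)"
  proof (rule nn_integral_cong)
    fix y assume "y \<in> space unit_M"
    then have m: "(\<lambda>x. ennreal ((cmod (k (x, y)))\<^sup>2)) \<in> borel_measurable borel"
      using slice_measurable[OF sq[OF km]] by simp
    have m': "(\<lambda>x. ennreal ((cmod (k (\<epsilon> * x, y)))\<^sup>2)) \<in> borel_measurable lborel"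
      using measurable_compose[of "\<lambda>x. \<epsilon> * x" lborel borel, OF _ m] by simp
    have "(\<integral>\<^sup>+x. ennreal ((cmod (k (x, y)))\<^sup>2) \<partial>lborel) = ennreal \<epsilon> * (\<integral>\<^sup>+x. ennreal ((cmod (k (\<epsilon> * x, y)))\<^sup>2) \<partial>lborel)"
      using \<epsilon> by (subst nn_integral_real_affine[OF m, of \<epsilon> 0]) simp_all
    also have "\<dots> = (\<integral>\<^sup>+x. ennreal \<epsilon> * ennreal ((cmod (k (\<epsilon> * x, y)))\<^sup>2) \<partial>lborel)"
      by (rule nn_integral_cmult[OF m', symmetric])
    also have "\<dots> = (\<integral>\<^sup>+x. ennreal ((cmod (dil \<epsilon> k (x, y)))\<^sup>2) \<partial>lborel)"
      using \<epsilon> by (simp add: dil_def norm_mult power_mult_distrib ennreal_mult)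
    finally show "(\<integral>\<^sup>+x. ennreal ((cmod (dil \<epsilon> k (x, y)))\<^sup>2) \<partial>lborel) = (\<integral>\<^sup>+x. ennreal ((cmod (k (x, y)))\<^sup>2) \<partial>lborel)" ..
  qed
  also have "\<dots> = (\<integral>\<^sup>+p. ennreal ((cmod (k p))\<^sup>2) \<partial>strip_M)"
    by (rule nn_integral_strip[OF sq[OF km], symmetric])
  finally show ?thesis using k dil_measurable[OF km] by (simp add: L2_iff_nn_integral)
qed

lemma dil_inner:
  assumes "k \<in> L2 strip_M" "k' \<in> L2 strip_M" "\<epsilon> > 0"
  shows "l2_inner strip_M (dil \<epsilon> k) (dil \<epsilon> k') = l2_inner strip_M k k'"
proof -
  have "of_real (sqrt \<epsilon>) * of_real (sqrt \<epsilon>) = (of_real \<epsilon> :: complex)"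
    using assms(3) by (simp flip: of_real_mult)
  then have "dil \<epsilon> k (x, y) * cnj (dil \<epsilon> k' (x, y)) = of_real \<epsilon> * (k (\<epsilon> * x, y) * cnj (k' (\<epsilon> * x, y)))" for x y
    by (simp add: dil_def mult.assoc[symmetric])
  then have "l2_inner lborel (\<lambda>x. dil \<epsilon> k (x, y)) (\<lambda>x. dil \<epsilon> k' (x, y)) = l2_inner lborel (\<lambda>x. k (x, y)) (\<lambda>x. k' (x, y))" for y
    unfolding l2_inner_def using dil_slice_integral[OF assms(3), of "\<lambda>x. k (x, y) * cnj (k' (x, y))"] by simp
  then show ?thesis
    unfolding l2_inner_strip[OF dil_L2[OF assms(1,3)] dil_L2[OF assms(2,3)]] l2_inner_strip[OF assms(1,2)] by simp
qed

lemma unscaling_ift: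
  assumes \<epsilon>: "\<epsilon> > 0"
  shows "unscaling \<epsilon> (ift k) = ift (dil \<epsilon> k)"
proof
  fix p :: "real \<times> real"
  obtain x y where p: "p = (x, y)" by (cases p)
  have s: "sqrt \<epsilon> = 1 / sqrt \<epsilon> * \<epsilon>" using \<epsilon> by (simp add: real_div_sqrt)
  have "(LINT \<xi>|lborel. dil \<epsilon> k (\<xi>, y) * cis (x * \<xi>)) =
      (LINT \<xi>|lborel. of_real (1 / sqrt \<epsilon>) * (of_real \<epsilon> * (k (\<epsilon> * \<xi>, y) * cis (x / \<epsilon> * (\<epsilon> * \<xi>)))))"
  proof (rule Bochner_Integration.integral_cong[OF refl])
    fix \<xi>
    have "x * \<xi> = x / \<epsilon> * (\<epsilon> * \<xi>)" using \<epsilon> by simp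
    moreover have "of_real (sqrt \<epsilon>) = of_real (1 / sqrt \<epsilon>) * (of_real \<epsilon> :: complex)"
      unfolding of_real_mult[symmetric] using s by simp
    ultimately show "dil \<epsilon> k (\<xi>, y) * cis (x * \<xi>) =
        of_real (1 / sqrt \<epsilon>) * (of_real \<epsilon> * (k (\<epsilon> * \<xi>, y) * cis (x / \<epsilon> * (\<epsilon> * \<xi>))))"
      unfolding dil_def by (simp only: fst_conv snd_conv mult.assoc)
  qed
  also have "\<dots> = of_real (1 / sqrt \<epsilon>) * (LINT \<xi>|lborel. of_real \<epsilon> * (k (\<epsilon> * \<xi>, y) * cis (x / \<epsilon> * (\<epsilon> * \<xi>))))"
    by (rule integral_mult_right_zero)
  also have "(LINT \<xi>|lborel. of_real \<epsilon> * (k (\<epsilon> * \<xi>, y) * cis (x / \<epsilon> * (\<epsilon> * \<xi>)))) = (LINT \<theta>|lborel. k (\<theta>, y) * cis (x / \<epsilon> * \<theta>))"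
    by (rule dil_slice_integral[OF \<epsilon>])
  finally show "unscaling \<epsilon> (ift k) p = ift (dil \<epsilon> k) p"
    unfolding p unscaling_def prod.case ift_eq by (simp only: mult_ac)
qed

text \<open>The adjoint Gelfand transform followed by the inverse of
  \<open>scaling \<epsilon>\<close>. Every solution of the difference problem is represented in this
  form.\<close>

definition scaled_adj :: "real \<Rightarrow> (real \<times> real \<Rightarrow> complex) \<Rightarrow> real \<Rightarrow> complex" where
  "scaled_adj \<epsilon> k x = of_real (1 / sqrt \<epsilon>) * gelfand_adj k (x / \<epsilon>)"

lemma scaled_adj_L2:
  assumes k: "k \<in> band" and \<epsilon>: "\<epsilon> > 0"
  shows "scaled_adj \<epsilon> k \<in> L2 lborel" "l2_norm lborel (scaled_adj \<epsilon> k) \<le> l2_norm strip_M k"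
proof -
  note g = lborel_real_affine_L2[OF gelfand_adj_bounded(1)[OF k], of "1 / \<epsilon>" 0]
  have eq: "scaled_adj \<epsilon> k = (\<lambda>x. of_real (1 / sqrt \<epsilon>) * gelfand_adj k (0 + 1 / \<epsilon> * x))" by (simp add: scaled_adj_def fun_eq_iff)
  show "scaled_adj \<epsilon> k \<in> L2 lborel" unfolding eq using g(1) \<epsilon> by (intro L2_cmult) simp
  have "l2_norm lborel (scaled_adj \<epsilon> k) = l2_norm lborel (gelfand_adj k)"
    unfolding eq l2_norm_cmult using g(2) \<epsilon> by (simp add: norm_divide real_sqrt_divide)
  then show "l2_norm lborel (scaled_adj \<epsilon> k) \<le> l2_norm strip_M k" using gelfand_adj_bounded(2)[OF k] by simp
qed

lemma scaled_adj_add: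
  assumes "k \<in> band" "k' \<in> band" "\<epsilon> > 0"
  shows "AE x in lborel. scaled_adj \<epsilon> (\<lambda>p. k p + c * k' p) x = scaled_adj \<epsilon> k x + c * scaled_adj \<epsilon> k' x"
proof -
  have "AE x in lborel. gelfand_adj (\<lambda>p. k p + c * k' p) (1 / \<epsilon> * x) = gelfand_adj k (1 / \<epsilon> * x) + c * gelfand_adj k' (1 / \<epsilon> * x)"
    using assms(3) by (intro AE_lborel_scale[OF gelfand_adj_add[OF assms(1,2)]]) simp
  then show ?thesis by eventually_elim (simp add: scaled_adj_def algebra_simps add_divide_distrib)
qed

lemma scaled_adj_inner_add:
  assumes "k \<in> band" "k' \<in> band" "\<epsilon> > 0" "v \<in> L2 lborel"
  shows "l2_inner lborel (scaled_adj \<epsilon> (\<lambda>p. k p + c * k' p)) v = l2_inner lborel (scaled_adj \<epsilon> k) v + c * l2_inner lborel (scaled_adj \<epsilon> k') v"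
proof -
  note L = scaled_adj_L2(1)[OF assms(1,3)] scaled_adj_L2(1)[OF assms(2,3)] scaled_adj_L2(1)[OF band_add[OF assms(1,2)] assms(3), of c]
  have "l2_inner lborel (scaled_adj \<epsilon> (\<lambda>p. k p + c * k' p)) v = l2_inner lborel (\<lambda>x. scaled_adj \<epsilon> k x + c * scaled_adj \<epsilon> k' x) v"
    by (rule l2_inner_AE_cong[OF L2_measurable[OF L(3)] L2_measurable[OF L2_add[OF L(1) L2_cmult[OF L(2)]]]
          L2_measurable[OF assms(4)] L2_measurable[OF assms(4)] scaled_adj_add[OF assms(1-3)]]) simp
  also have "\<dots> = l2_inner lborel (scaled_adj \<epsilon> k) v + c * l2_inner lborel (scaled_adj \<epsilon> k') v"
    by (simp add: l2_inner_add_left[OF L(1) L2_cmult[OF L(2)] assms(4)] l2_inner_cmult_left)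
  finally show ?thesis .
qed

text \<open>An integer shift leaves the fractional part alone and changes only the exponential.
  Translations by multiples of the period thus become multiplication by characters.\<close>

lemma gelfand_adj_shift: "gelfand_adj k (x + of_int n) = gelfand_adj (\<lambda>p. cis (of_int n * fst p) * k p) x"
proof -
  have "cis ((x + of_int n) * \<theta>) = cis (of_int n * \<theta>) * cis (x * \<theta>)" for \<theta>
    by (simp add: cis_mult distrib_right add.commute)
  then have "k (\<theta>, frac x) * cis ((x + of_int n) * \<theta>) = cis (of_int n * \<theta>) * k (\<theta>, frac x) * cis (x * \<theta>)" for \<theta>
    by simp
  moreover have "frac (x + of_int n) = frac x" by simp
  ultimately show ?thesis by (simp only: gelfand_adj_def ift_eq fst_conv)
qed

lemma scaled_adj_shift: "\<epsilon> > 0 \<Longrightarrow> scaled_adj \<epsilon> k (x + of_int n * \<epsilon>) = scaled_adj \<epsilon> (\<lambda>p. cis (of_int n * fst p) * k p) x"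
  using gelfand_adj_shift[of k "x / \<epsilon>" n] by (simp add: scaled_adj_def add_divide_distrib)

lemma ift_cmult: "ift (\<lambda>p. c (snd p) * k p) (x, y) = c y * ift k (x, y)"
  by (simp add: ift_eq mult.assoc mult.left_commute)

text \<open>The transform is evaluated at y = \<open>frac (x / \<epsilon>)\<close>, so a periodic
  coefficient in \<open>x / \<epsilon>\<close> is a factor depending on \<open>y\<close> alone and
  comes out of the frequency integral. Together with the shift rule this diagonalises the difference
  operator.\<close>

lemma scaled_adj_cmult:
  assumes "\<And>y. d (frac y) = d y"
  shows "scaled_adj \<epsilon> (\<lambda>p. d (snd p) * k p) x = d (x / \<epsilon>) * scaled_adj \<epsilon> k x"
  by (simp add: scaled_adj_def gelfand_adj_def ift_cmult assms)

lemma band_mult: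
  assumes "k \<in> band" "a \<in> borel_measurable strip_M" "\<And>p. p \<in> space strip_M \<Longrightarrow> k p \<noteq> 0 \<Longrightarrow> cmod (a p) \<le> C"
  shows "(\<lambda>p. a p * k p) \<in> band"
proof -
  have "(\<lambda>p. a p * k p) \<in> L2 strip_M"
  proof (rule L2_bound[OF _ band_L2[OF assms(1)]])
    show "(\<lambda>p. a p * k p) \<in> borel_measurable strip_M"
      using assms(2) L2_measurable[OF band_L2[OF assms(1)]] by (rule borel_measurable_times)
    show "AE p in strip_M. cmod (a p * k p) \<le> C * cmod (k p)"
    proof (rule AE_I2)
      fix p assume p: "p \<in> space strip_M"
      show "cmod (a p * k p) \<le> C * cmod (k p)"
      proof (cases "k p = 0")
        case False
        then show ?thesis unfolding norm_mult using assms(3)[OF p] by (intro mult_right_mono) auto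
      qed simp
    qed
  qed
  then show ?thesis using assms(1) by (auto simp: band_def)
qed

lemma ift_inner_add:
  assumes "integrable strip_M k" "k \<in> L2 strip_M" "integrable strip_M k'" "k' \<in> L2 strip_M" "v \<in> L2 strip_M"
  shows "l2_inner strip_M (ift (\<lambda>p. k p + c * k' p)) v = l2_inner strip_M (ift k) v + c * l2_inner strip_M (ift k') v"
proof -
  have i: "integrable strip_M (\<lambda>p. k p + c * k' p)" "(\<lambda>p. k p + c * k' p) \<in> L2 strip_M"
    using assms by (auto intro: L2_add L2_cmult)
  note L = ift_L2(1)[OF assms(1,2)] ift_L2(1)[OF assms(3,4)] ift_L2(1)[OF i]
  have "l2_inner strip_M (ift (\<lambda>p. k p + c * k' p)) v = l2_inner strip_M (\<lambda>x. ift k x + c * ift k' x) v"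
    by (rule l2_inner_AE_cong[OF L2_measurable[OF L(3)] L2_measurable[OF L2_add[OF L(1) L2_cmult[OF L(2)]]]
          L2_measurable[OF assms(5)] L2_measurable[OF assms(5)] ift_add[OF assms(1,3)]]) simp
  also have "\<dots> = l2_inner strip_M (ift k) v + c * l2_inner strip_M (ift k') v"
    by (simp add: l2_inner_add_left[OF L(1) L2_cmult[OF L(2)] assms(5)] l2_inner_cmult_left)
  finally show ?thesis .
qed

text \<open>The function \<open>h\<close> in the definition of \<open>interp\<close> is any Fourier
  preimage of \<open>ext_zero g\<close>. Uniqueness forces it to be \<open>ift (ext_zero g)\<close>
  almost everywhere, and the dilation carries this through the unscaling.\<close>

lemma interp_facts:
  assumes "(F, w) \<in> interp \<epsilon>" "\<epsilon> > 0"
  obtains g where "F \<in> L2 lborel" "(scaling \<epsilon> F, g) \<in> gelfand" "w \<in> L2 strip_M"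
    "AE p in strip_M. w p = ift (dil \<epsilon> (ext_zero g)) p"
proof -
  obtain g h where F: "F \<in> L2 lborel" and g: "(scaling \<epsilon> F, g) \<in> gelfand" and h: "(h, ext_zero g) \<in> fourier"
    and w: "w = unscaling \<epsilon> h"
    using assms(1) unfolding interp_def by auto
  have b: "ext_zero g \<in> band" by (rule gelfand_facts[OF g])
  have hL2: "h \<in> L2 strip_M" using h unfolding fourier_eq by (rule l2_closureE) blast
  have AE: "AE p in strip_M. h p = ift (ext_zero g) p"
    by (rule fourier_unique[OF h fourier_ift[OF band_integrable[OF b] band_L2[OF b]]])
  have us: "unscaling \<epsilon> f p = of_real (1 / sqrt \<epsilon>) * f (1 / \<epsilon> * fst p, snd p)" for f p
    by (cases p) (simp add: unscaling_def)
  have "w = dil (1 / \<epsilon>) h"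
    unfolding w by (rule ext) (simp add: us dil_def real_sqrt_divide)
  then have "w \<in> L2 strip_M" using dil_L2[OF hL2, of "1 / \<epsilon>"] assms(2) by simp
  moreover have "AE p in strip_M. h (1 / \<epsilon> * fst p, snd p) = ift (ext_zero g) (1 / \<epsilon> * fst p, snd p)"
    using AE assms(2) by (intro AE_strip_scale) auto
  then have "AE p in strip_M. w p = ift (dil \<epsilon> (ext_zero g)) p"
    unfolding w unscaling_ift[OF assms(2), symmetric] by eventually_elim (simp only: us)
  ultimately show ?thesis using that F g by blast
qed

lemma scaling_L2:
  assumes "F \<in> L2 lborel" "\<epsilon> > 0"
  shows "scaling \<epsilon> F \<in> L2 lborel" "l2_norm lborel (scaling \<epsilon> F) = l2_norm lborel F"
proof -
  note r = lborel_real_affine_L2[OF assms(1), of \<epsilon> 0]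
  show "scaling \<epsilon> F \<in> L2 lborel"
    unfolding scaling_def using r(1) assms(2) by (intro L2_cmult) simp
  show "l2_norm lborel (scaling \<epsilon> F) = l2_norm lborel F"
    unfolding scaling_def l2_norm_cmult using r(2) assms(2) by simp
qed

lemma interp_exists:
  assumes "F \<in> L2 lborel" "\<epsilon> > 0"
  obtains w where "(F, w) \<in> interp \<epsilon>"
proof -
  obtain g where g: "(scaling \<epsilon> F, g) \<in> gelfand" by (rule gelfand_exists[OF scaling_L2(1)[OF assms]])
  have b: "ext_zero g \<in> band" by (rule gelfand_facts[OF g])
  have "(ext_zero g, ift (ext_zero g)) \<in> fourier\<inverse>"
    using fourier_ift[OF band_integrable[OF b] band_L2[OF b]] by simp
  then have "(F, unscaling \<epsilon> (ift (ext_zero g))) \<in> interp \<epsilon>"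
    using assms(1) g unfolding interp_def by blast
  then show ?thesis by (rule that)
qed

lemma scaled_adj_gelfand:
  assumes "(scaling \<epsilon> F, g) \<in> gelfand" "\<epsilon> > 0"
  shows "AE x in lborel. scaled_adj \<epsilon> (ext_zero g) x = F x"
proof -
  have "AE x in lborel. gelfand_adj (ext_zero g) (1 / \<epsilon> * x) = scaling \<epsilon> F (1 / \<epsilon> * x)"
    using gelfand_facts(5)[OF assms(1)] assms(2) by (intro AE_lborel_scale) auto
  moreover have "of_real (1 / sqrt \<epsilon>) * of_real (sqrt \<epsilon>) = (1 :: complex)"
    using assms(2) unfolding of_real_mult[symmetric] by simp
  ultimately show ?thesis
    using assms(2) by (auto simp: scaled_adj_def scaling_def mult.assoc[symmetric])
qed

lemma dil_support:
  assumes "k \<in> band" "\<epsilon> > 0" "\<bar>\<xi>\<bar> > pi / \<epsilon>"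
  shows "dil \<epsilon> k (\<xi>, y) = 0"
proof -
  have "\<bar>\<epsilon> * \<xi>\<bar> > pi" using assms(2,3) by (simp add: abs_mult field_simps)
  then show ?thesis using band_zero[OF assms(1)] by (simp add: dil_def)
qed

lemma dil_band:
  assumes "k \<in> band" "\<epsilon> > 0"
  shows "dil \<epsilon> k \<in> L2 strip_M" "integrable strip_M (dil \<epsilon> k)"
proof -
  show "dil \<epsilon> k \<in> L2 strip_M" by (rule dil_L2[OF band_L2[OF assms(1)] assms(2)])
  then show "integrable strip_M (dil \<epsilon> k)"
    using dil_support[OF assms] by (rule integrable_bounded_support)
qed

text \<open>Any value of \<open>interp\<close> is itself of the form
  \<open>ift (dil \<epsilon> (ext_zero g))\<close>. Pairing two such functions removes
  \<open>ift\<close> and \<open>dil\<close> by isometry, and the duality of \<open>gelfand\<close>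
  with \<open>gelfand_adj\<close> and a change of variables finish the pairing on the line.\<close>

lemma interp_adj_ift:
  assumes k: "k \<in> band" and \<epsilon>: "\<epsilon> > 0"
  shows "(ift (dil \<epsilon> k), scaled_adj \<epsilon> k) \<in> interp_adj \<epsilon>"
proof -
  have z: "ift (dil \<epsilon> k) \<in> L2 strip_M" by (rule ift_L2(1)[OF dil_band(2,1)[OF k \<epsilon>]])
  have h: "scaled_adj \<epsilon> k \<in> L2 lborel" by (rule scaled_adj_L2[OF k \<epsilon>])
  have "l2_inner strip_M V (ift (dil \<epsilon> k)) = l2_inner lborel G (scaled_adj \<epsilon> k)" if GV: "(G, V) \<in> interp \<epsilon>" for G V
  proof -
    obtain g where g: "G \<in> L2 lborel" "(scaling \<epsilon> G, g) \<in> gelfand" "V \<in> L2 strip_M"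
      "AE p in strip_M. V p = ift (dil \<epsilon> (ext_zero g)) p"
      by (rule interp_facts[OF GV \<epsilon>])
    have b: "ext_zero g \<in> band" by (rule gelfand_facts[OF g(2)])
    have I: "ift (dil \<epsilon> (ext_zero g)) \<in> L2 strip_M" by (rule ift_L2(1)[OF dil_band(2,1)[OF b \<epsilon>]])
    have "l2_inner strip_M V (ift (dil \<epsilon> k)) = l2_inner strip_M (ift (dil \<epsilon> (ext_zero g))) (ift (dil \<epsilon> k))"
      by (rule l2_inner_AE_cong[OF g(3)[THEN L2_measurable] I[THEN L2_measurable] z[THEN L2_measurable] z[THEN L2_measurable] g(4)]) simp
    also have "\<dots> = l2_inner strip_M (dil \<epsilon> (ext_zero g)) (dil \<epsilon> k)"
      by (rule ift_inner[OF dil_band(2,1)[OF b \<epsilon>] dil_band(2,1)[OF k \<epsilon>]])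
    also have "\<dots> = l2_inner strip_M (ext_zero g) k" by (rule dil_inner[OF band_L2[OF b] band_L2[OF k] \<epsilon>])
    also have "\<dots> = l2_inner lborel (scaling \<epsilon> G) (gelfand_adj k)" by (rule gelfand_facts(4)[OF g(2) k])
    also have "\<dots> = (LINT x|lborel. of_real \<epsilon> * (\<lambda>t. G t * cnj (scaled_adj \<epsilon> k t)) (\<epsilon> * x))"
      unfolding l2_inner_def
    proof (rule Bochner_Integration.integral_cong[OF refl])
      fix x
      have "\<epsilon> * (1 / sqrt \<epsilon>) = sqrt \<epsilon>" using \<epsilon> by (simp add: real_div_sqrt)
      then have s: "of_real \<epsilon> * of_real (1 / sqrt \<epsilon>) = (of_real (sqrt \<epsilon>) :: complex)" unfolding of_real_mult[symmetric] by simp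
      have "of_real \<epsilon> * (G (\<epsilon> * x) * cnj (scaled_adj \<epsilon> k (\<epsilon> * x))) = (of_real \<epsilon> * of_real (1 / sqrt \<epsilon>)) * (G (\<epsilon> * x) * cnj (gelfand_adj k x))"
        using \<epsilon> by (simp add: scaled_adj_def)
      then show "scaling \<epsilon> G x * cnj (gelfand_adj k x) = of_real \<epsilon> * (\<lambda>t. G t * cnj (scaled_adj \<epsilon> k t)) (\<epsilon> * x)"
        by (simp only: s scaling_def mult.assoc)
    qed
    also have "\<dots> = l2_inner lborel G (scaled_adj \<epsilon> k)"
      unfolding l2_inner_def by (rule dil_slice_integral[OF \<epsilon>])
    finally show ?thesis .
  qed
  then show ?thesis using z h unfolding interp_adj_def l2_adjoint_def by auto
qed

text \<open>Since \<open>interp\<close> is defined on all of L2, the adjoint relation may be tested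
  with the difference of the two candidates, which is then orthogonal to itself.\<close>

lemma interp_adj_unique:
  assumes "(z, h) \<in> interp_adj \<epsilon>" "(z', h') \<in> interp_adj \<epsilon>" "AE p in strip_M. z p = z' p" "\<epsilon> > 0"
  shows "AE x in lborel. h x = h' x"
proof -
  have L2: "z \<in> L2 strip_M" "z' \<in> L2 strip_M" "h \<in> L2 lborel" "h' \<in> L2 lborel"
    using assms(1,2) by (auto simp: interp_adj_def l2_adjoint_def)
  have adj: "\<And>G V. (G, V) \<in> interp \<epsilon> \<Longrightarrow> l2_inner strip_M V z = l2_inner lborel G h"
    "\<And>G V. (G, V) \<in> interp \<epsilon> \<Longrightarrow> l2_inner strip_M V z' = l2_inner lborel G h'"
    using assms(1,2) by (auto simp: interp_adj_def l2_adjoint_def)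
  let ?d = "\<lambda>x. h x - h' x"
  have d: "?d \<in> L2 lborel" by (rule L2_diff[OF L2(3,4)])
  obtain V where V: "(?d, V) \<in> interp \<epsilon>" by (rule interp_exists[OF d assms(4)])
  have VL2: "V \<in> L2 strip_M" by (rule interp_facts[OF V assms(4)])
  have "l2_inner lborel ?d ?d = l2_inner lborel ?d h - l2_inner lborel ?d h'"
    by (rule l2_inner_diff_right[OF L2(3,4) d])
  also have "\<dots> = l2_inner strip_M V z - l2_inner strip_M V z'" using adj[OF V] by simp
  also have "\<dots> = 0" using l2_inner_cong_right[OF VL2 L2(1,2) assms(3)] by simp
  finally have "l2_norm lborel ?d = 0" by (simp add: l2_inner_self)
  then show ?thesis using l2_norm_zero_iff[OF d] by simp
qed

section \<open>Comparison of 2 - 2 cos t with t^2\<close>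

lemma sin_cubic_bound: "\<bar>sin x - x\<bar> \<le> \<bar>x\<bar> ^ 3 / 6" for x :: real
  using Maclaurin_sin_bound[of x 3] by (simp add: sin_coeff_def eval_nat_numeral lessThan_Suc)

lemma cos_half: "2 - 2 * cos t = 4 * (sin (t / 2))\<^sup>2" for t :: real
  using cos_double_sin[of "t / 2"] by simp

text \<open>By the half-angle formula the gap is 4 (x^2 - sin^2 x) with x = |t| / 2. The factor x -
  sin x is at most x^3 / 6 and the factor x + sin x at most 2 x, which gives t^4 / 12.\<close>

lemma cos_quartic_bound: "2 - 2 * cos t \<le> t\<^sup>2" "t\<^sup>2 - (2 - 2 * cos t) \<le> t ^ 4 / 12" for t :: real
proof -
  define x where "x = \<bar>t / 2\<bar>"
  have x: "x \<ge> 0" and t2: "t\<^sup>2 = 4 * x\<^sup>2" and t4: "t ^ 4 = 16 * x ^ 4"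
    by (simp_all add: x_def power_divide)
  have s: "(sin (t / 2))\<^sup>2 = (sin x)\<^sup>2" by (simp add: x_def abs_if)
  have abs: "\<bar>sin x\<bar> \<le> x" using abs_sin_x_le_abs_x[of x] x by simp
  then have sq: "(sin x)\<^sup>2 \<le> x\<^sup>2" by (metis abs_ge_zero power2_abs power_mono)
  then show "2 - 2 * cos t \<le> t\<^sup>2" unfolding cos_half s t2 by simp
  have "x - sin x \<le> x ^ 3 / 6" using sin_cubic_bound[of x] unfolding abs_of_nonneg[OF x] by linarith
  moreover have "0 \<le> x - sin x" "0 \<le> x + sin x" "x + sin x \<le> 2 * x" using abs by auto
  ultimately have "(x - sin x) * (x + sin x) \<le> x ^ 3 / 6 * (2 * x)"
    by (intro mult_mono) (use x in auto)
  moreover have "(x - sin x) * (x + sin x) = x\<^sup>2 - (sin x)\<^sup>2" by (simp add: power2_eq_square algebra_simps)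
  moreover have "x ^ 3 / 6 * (2 * x) = x ^ 4 / 3" by (simp add: eval_nat_numeral)
  ultimately have "x\<^sup>2 - (sin x)\<^sup>2 \<le> x ^ 4 / 3" by linarith
  then show "t\<^sup>2 - (2 - 2 * cos t) \<le> t ^ 4 / 12" unfolding cos_half s t2 t4 by simp
qed

text \<open>For 0 \<le> x \<le> 2 the cubic bound gives sin x \<ge> x - x^3 / 6 \<ge> x / 3, and
  squaring yields 1/9. The range covers x = |t| / 2 since pi < 4.\<close>

lemma cos_lower_bound:
  assumes "\<bar>t\<bar> \<le> pi"
  shows "t\<^sup>2 / 9 \<le> 2 - 2 * cos t"
proof -
  define x where "x = \<bar>t / 2\<bar>"
  have x: "x \<ge> 0" and t2: "t\<^sup>2 = 4 * x\<^sup>2" by (simp_all add: x_def power_divide)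
  have "x \<le> 2" using assms pi_less_4 by (simp add: x_def)
  then have "x * x \<le> 2 * 2" using x by (intro mult_mono) auto
  then have "x * (x * x) \<le> x * 4" using x by (intro mult_left_mono) auto
  then have "x ^ 3 / 6 \<le> 2 / 3 * x" by (simp add: eval_nat_numeral)
  then have "x / 3 \<le> sin x" using sin_cubic_bound[of x] unfolding abs_of_nonneg[OF x] by linarith
  then have "(x / 3)\<^sup>2 \<le> (sin x)\<^sup>2" using x by (intro power_mono) auto
  moreover have "(sin (t / 2))\<^sup>2 = (sin x)\<^sup>2" by (simp add: x_def abs_if)
  ultimately show ?thesis unfolding cos_half t2 by (simp add: power_divide)
qed

text \<open>Here \<open>a\<close> stands for 2 - 2 cos t and \<open>b\<close> for t^2. The
  hypotheses give b - a \<le> b^2 / 12 \<le> (9/12) a b. The product of the denominators is at least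
  d^2 a b / e^4, so a b cancels and 3 e^2 / (4 d) remains, uniformly in the frequency.\<close>

lemma resolvent_symbol_bound:
  fixes a b d e :: real
  assumes "a \<le> b" "b - a \<le> b\<^sup>2 / 12" "b / 9 \<le> a" "0 \<le> b" "d > 0" "e > 0"
  shows "\<bar>1 / (1 + d * a / e\<^sup>2) - 1 / (1 + d * b / e\<^sup>2)\<bar> \<le> 3 / (4 * d) * e\<^sup>2"
proof -
  have a: "0 \<le> a" using assms by linarith
  have pos: "0 < 1 + d * a / e\<^sup>2" "0 < 1 + d * b / e\<^sup>2"
    using a assms by (auto intro!: add_pos_nonneg)
  have "1 / u - 1 / v = (v - u) / (u * v)" if "0 < u" "0 < v" for u v :: real
    using that by (simp add: field_simps)
  from this[OF pos]
  have "1 / (1 + d * a / e\<^sup>2) - 1 / (1 + d * b / e\<^sup>2) = (d * (b - a) / e\<^sup>2) / ((1 + d * a / e\<^sup>2) * (1 + d * b / e\<^sup>2))"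
    by (simp add: right_diff_distrib diff_divide_distrib)
  moreover have "0 \<le> (d * (b - a) / e\<^sup>2) / ((1 + d * a / e\<^sup>2) * (1 + d * b / e\<^sup>2))"
    using assms pos by simp
  moreover have "(d * (b - a) / e\<^sup>2) / ((1 + d * a / e\<^sup>2) * (1 + d * b / e\<^sup>2)) \<le> 3 / (4 * d) * e\<^sup>2"
  proof -
    have "b - a \<le> b * b / 12" using assms(2) by (simp add: power2_eq_square)
    also have "\<dots> \<le> b * (9 * a) / 12" using assms(3,4) by (intro divide_right_mono mult_left_mono) auto
    finally have ba: "b - a \<le> 3 / 4 * (a * b)" by simp
    have "d * (b - a) / e\<^sup>2 \<le> d * (3 / 4 * (a * b)) / e\<^sup>2"
      using ba assms(5,6) by (intro divide_right_mono mult_left_mono) auto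
    also have "\<dots> = 3 / (4 * d) * e\<^sup>2 * ((d * a / e\<^sup>2) * (d * b / e\<^sup>2))"
      using assms(5,6) by (simp add: field_simps power2_eq_square)
    also have "\<dots> \<le> 3 / (4 * d) * e\<^sup>2 * ((1 + d * a / e\<^sup>2) * (1 + d * b / e\<^sup>2))"
      using a assms by (intro mult_left_mono mult_mono) auto
    finally have "d * (b - a) / e\<^sup>2 \<le> 3 / (4 * d) * e\<^sup>2 * ((1 + d * a / e\<^sup>2) * (1 + d * b / e\<^sup>2))" .
    then show ?thesis by (subst pos_divide_le_eq[OF mult_pos_pos[OF pos]])
  qed
  ultimately show ?thesis by (simp only: abs_of_nonneg)
qed

section \<open>The two resolvents\<close>

text \<open>The original coefficient \<open>D\<close> enters only through the two forms, where it
  may be changed on a null set. Everything else is computed with the Borel representative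
  \<open>d\<close>.\<close>

locale fibre_problem =
  fixes D d :: "real \<Rightarrow> real" and m K \<epsilon> :: real
  assumes d_measurable: "d \<in> borel_measurable borel"
    and d_lower: "\<And>y. m \<le> d y" and d_upper: "\<And>y. d y \<le> K"
    and d_frac: "\<And>y. d (frac y) = d y"
    and D_eq: "AE y in lborel. D y = d y"
    and m_pos: "m > 0" and eps_pos: "\<epsilon> > 0"
begin

lemma d_pos: "d y > 0"
  using d_lower[of y] m_pos by linarith

lemma d_strip_measurable: "(\<lambda>p. d (snd p)) \<in> borel_measurable strip_M"
  by (rule measurable_compose[OF snd_strip_measurable d_measurable])

lemma cd_strip_measurable: "(\<lambda>p. complex_of_real (d (snd p))) \<in> borel_measurable strip_M"
  by (rule measurable_compose[OF d_strip_measurable]) simp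

lemma cd_bound: "cmod (complex_of_real (d y)) \<le> K"
  using d_pos[of y] d_upper[of y] by simp

lemma band_d: "k \<in> band \<Longrightarrow> (\<lambda>p. complex_of_real (d (snd p)) * k p) \<in> band"
  by (rule band_mult[OF _ cd_strip_measurable cd_bound])

lemma L2_d: "k \<in> L2 strip_M \<Longrightarrow> (\<lambda>p. complex_of_real (d (snd p)) * k p) \<in> L2 strip_M"
  by (rule L2_mult_bounded[OF _ cd_strip_measurable cd_bound])

lemma band_cis: "k \<in> band \<Longrightarrow> (\<lambda>p. cis (of_int n * fst p) * k p) \<in> band"
proof (rule band_mult[where C = 1])
  have "(\<lambda>p. of_int n * fst p) \<in> measurable strip_M borel"
    using measurable_compose[OF measurable_fst, of "\<lambda>x. of_int n * x" lborel borel unit_M] by simp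
  then show "(\<lambda>p. cis (of_int n * fst p)) \<in> borel_measurable strip_M" by (rule borel_measurable_cis)
qed simp_all

lemma AE_D_scale: "AE x in lborel. D (x / \<epsilon>) = d (x / \<epsilon>)"
  using AE_lborel_scale[OF D_eq, of "1 / \<epsilon>"] eps_pos by simp

lemma AE_D_strip: "AE p in strip_M. D (snd p) = d (snd p)"
proof (rule AE_strip_I)
  show "AE y in unit_M. D y = d y" using D_eq by (subst AE_restrict_space_iff) auto
qed

lemma form_eps_eq:
  assumes u: "u \<in> L2 lborel" and v: "v \<in> L2 lborel"
  shows "form_eps D \<epsilon> u v = of_real (1 / \<epsilon>\<^sup>2) *
      l2_inner lborel (\<lambda>x. complex_of_real (d (x / \<epsilon>)) * (u (x + \<epsilon>) - u x)) (\<lambda>x. v (x + \<epsilon>) - v x)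
    + l2_inner lborel u v"
    and "(\<lambda>x. complex_of_real (d (x / \<epsilon>)) * (u (x + \<epsilon>) - u x)) \<in> L2 lborel"
    and "(\<lambda>x. v (x + \<epsilon>) - v x) \<in> L2 lborel"
proof -
  show dv: "(\<lambda>x. v (x + \<epsilon>) - v x) \<in> L2 lborel" by (intro L2_diff translate_L2 v)
  have du: "(\<lambda>x. u (x + \<epsilon>) - u x) \<in> L2 lborel" by (intro L2_diff translate_L2 u)
  have "(\<lambda>x. d (x / \<epsilon>)) \<in> borel_measurable lborel"
    using measurable_compose[of "\<lambda>x. x / \<epsilon>" lborel borel, OF _ d_measurable] by simp
  then have "(\<lambda>x. complex_of_real (d (x / \<epsilon>))) \<in> borel_measurable lborel"
    by (rule measurable_compose) simp
  then show b: "(\<lambda>x. complex_of_real (d (x / \<epsilon>)) * (u (x + \<epsilon>) - u x)) \<in> L2 lborel"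
    by (rule L2_mult_bounded[OF du _ cd_bound])
  have "(LINT x|lebesgue. of_real (D (x / \<epsilon>)) * (u (x + \<epsilon>) - u x) * cnj (v (x + \<epsilon>) - v x)) =
      (LINT x|lborel. of_real (d (x / \<epsilon>)) * (u (x + \<epsilon>) - u x) * cnj (v (x + \<epsilon>) - v x))"
  proof (rule integral_completion_AE)
    show "(\<lambda>x. of_real (d (x / \<epsilon>)) * (u (x + \<epsilon>) - u x) * cnj (v (x + \<epsilon>) - v x)) \<in> borel_measurable lborel"
      using integrable_L2_cnj[OF b dv] by (rule borel_measurable_integrable)
    show "AE x in lborel. complex_of_real (D (x / \<epsilon>)) * (u (x + \<epsilon>) - u x) * cnj (v (x + \<epsilon>) - v x) =
        of_real (d (x / \<epsilon>)) * (u (x + \<epsilon>) - u x) * cnj (v (x + \<epsilon>) - v x)"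
      using AE_D_scale by eventually_elim simp
  qed
  then show "form_eps D \<epsilon> u v = of_real (1 / \<epsilon>\<^sup>2) *
      l2_inner lborel (\<lambda>x. complex_of_real (d (x / \<epsilon>)) * (u (x + \<epsilon>) - u x)) (\<lambda>x. v (x + \<epsilon>) - v x)
    + l2_inner lborel u v"
    unfolding form_eps_def l2_inner_def by simp
qed

section \<open>The symbols of the two resolvents and the solution of the difference problem\<close>

definition eps_symbol :: "real \<times> real \<Rightarrow> real" where
  "eps_symbol p = 1 / (1 + d (snd p) * (2 - 2 * cos (fst p)) / \<epsilon>\<^sup>2)"

text \<open>The factor 1 / (1 + d \<open>\<xi>\<close>^2) written in the quasimomentum,
  \<open>\<epsilon>\<close> times \<open>\<xi>\<close>, so that both symbols act on the same band
  and can be subtracted.\<close>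

definition hom_symbol :: "real \<times> real \<Rightarrow> real" where
  "hom_symbol p = 1 / (1 + d (snd p) * (fst p)\<^sup>2 / \<epsilon>\<^sup>2)"

lemma fst_strip_measurable: "fst \<in> borel_measurable strip_M"
  using measurable_fst[of lborel unit_M] by simp

lemma symbols_measurable: "eps_symbol \<in> borel_measurable strip_M" "hom_symbol \<in> borel_measurable strip_M"
proof -
  have c: "(\<lambda>p. cos (fst p)) \<in> borel_measurable strip_M"
    by (rule measurable_compose[OF fst_strip_measurable]) simp
  have "(\<lambda>p. 1 / (1 + d (snd p) * (2 - 2 * cos (fst p)) / \<epsilon>\<^sup>2)) \<in> borel_measurable strip_M"
    by (intro borel_measurable_divide borel_measurable_add borel_measurable_times borel_measurable_diff
        borel_measurable_const d_strip_measurable c)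
  then show "eps_symbol \<in> borel_measurable strip_M" unfolding eps_symbol_def[abs_def] .
  have "(\<lambda>p. 1 / (1 + d (snd p) * (fst p)\<^sup>2 / \<epsilon>\<^sup>2)) \<in> borel_measurable strip_M"
    by (intro borel_measurable_divide borel_measurable_add borel_measurable_times borel_measurable_power
        borel_measurable_const d_strip_measurable fst_strip_measurable)
  then show "hom_symbol \<in> borel_measurable strip_M" unfolding hom_symbol_def[abs_def] .
qed

lemma eps_symbol_denominator_pos: "0 < 1 + d (snd p) * (2 - 2 * cos (fst p)) / \<epsilon>\<^sup>2"
proof -
  have "0 \<le> 2 - 2 * cos (fst p)" using cos_le_one[of "fst p"] by linarith
  then have "0 \<le> d (snd p) * (2 - 2 * cos (fst p)) / \<epsilon>\<^sup>2"
    using d_pos[of "snd p"] by (intro divide_nonneg_nonneg mult_nonneg_nonneg) auto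
  then show ?thesis by linarith
qed

lemma hom_symbol_denominator_pos: "0 < 1 + d (snd p) * (fst p)\<^sup>2 / \<epsilon>\<^sup>2"
proof -
  have "0 \<le> d (snd p) * (fst p)\<^sup>2 / \<epsilon>\<^sup>2"
    using d_pos[of "snd p"] by (intro divide_nonneg_nonneg mult_nonneg_nonneg) auto
  then show ?thesis by linarith
qed

lemma symbols_bounds: "0 \<le> eps_symbol p" "eps_symbol p \<le> 1" "0 \<le> hom_symbol p" "hom_symbol p \<le> 1"
proof -
  have "0 \<le> 2 - 2 * cos (fst p)" using cos_le_one[of "fst p"] by linarith
  then have "0 \<le> d (snd p) * (2 - 2 * cos (fst p)) / \<epsilon>\<^sup>2" "0 \<le> d (snd p) * (fst p)\<^sup>2 / \<epsilon>\<^sup>2"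
    using d_pos[of "snd p"] by (auto intro!: divide_nonneg_nonneg mult_nonneg_nonneg)
  then show "0 \<le> eps_symbol p" "eps_symbol p \<le> 1" "0 \<le> hom_symbol p" "hom_symbol p \<le> 1"
    by (auto simp: eps_symbol_def hom_symbol_def divide_le_eq_1)
qed

lemma band_real_mult:
  assumes "k \<in> band" "a \<in> borel_measurable strip_M" "\<And>p. p \<in> space strip_M \<Longrightarrow> k p \<noteq> 0 \<Longrightarrow> \<bar>a p\<bar> \<le> C"
  shows "(\<lambda>p. complex_of_real (a p) * k p) \<in> band"
proof (rule band_mult[OF assms(1)])
  show "(\<lambda>p. complex_of_real (a p)) \<in> borel_measurable strip_M"
    by (rule measurable_compose[OF assms(2)]) simp
qed (use assms(3) in simp)

lemma band_eps_symbol: "k \<in> band \<Longrightarrow> (\<lambda>p. complex_of_real (eps_symbol p) * k p) \<in> band"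
  by (rule band_real_mult[OF _ symbols_measurable(1), of _ 1]) (use symbols_bounds in auto)

lemma band_hom_symbol: "k \<in> band \<Longrightarrow> (\<lambda>p. complex_of_real (hom_symbol p) * k p) \<in> band"
  by (rule band_real_mult[OF _ symbols_measurable(2), of _ 1]) (use symbols_bounds in auto)

text \<open>The factors belong to the backward and the forward difference. The first is the
  conjugate of the second, so the product is the squared modulus of
  \<open>cis t - 1\<close>.\<close>

lemma difference_quotient_symbol:
  "(cis (- t) - 1) * (cis t - 1) = of_real (2 - 2 * cos t)"
  by (simp add: complex_eq_iff algebra_simps sin_cos_squared_add3 power2_eq_square[symmetric])

text \<open>Every operation of the form is carried out under \<open>scaled_adj\<close>:
  \<open>e\<close> is the forward difference of \<open>k\<close>, \<open>b\<close> multiplies it by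
  the coefficient, and \<open>c\<close> is the backward difference of \<open>b\<close>. The form
  thus pairs \<open>v\<close> with the transform of k + c / \<open>\<epsilon>\<close>^2, which is
  \<open>k0\<close> by the choice of \<open>eps_symbol\<close>.\<close>

lemma form_eps_scaled_adj:
  assumes k0: "k0 \<in> band" and v: "v \<in> L2 lborel"
  shows "form_eps D \<epsilon> (scaled_adj \<epsilon> (\<lambda>p. complex_of_real (eps_symbol p) * k0 p)) v = l2_inner lborel (scaled_adj \<epsilon> k0) v"
proof -
  define k where "k p = complex_of_real (eps_symbol p) * k0 p" for p
  have k: "k \<in> band" unfolding k_def[abs_def] by (rule band_eps_symbol[OF k0])
  define e where "e p = cis (of_int 1 * fst p) * k p + (-1) * k p" for p
  have e: "e \<in> band" unfolding e_def[abs_def] by (rule band_add[OF band_cis[OF k] k])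
  define b where "b p = complex_of_real (d (snd p)) * e p" for p
  have b: "b \<in> band" unfolding b_def[abs_def] by (rule band_d[OF e])
  define b' where "b' p = cis (of_int (-1) * fst p) * b p" for p
  have b': "b' \<in> band" unfolding b'_def[abs_def] by (rule band_cis[OF b])
  define c where "c p = b' p + (-1) * b p" for p
  have c: "c \<in> band" unfolding c_def[abs_def] by (rule band_add[OF b' b])
  have uL2: "scaled_adj \<epsilon> k \<in> L2 lborel" and bL2: "scaled_adj \<epsilon> b \<in> L2 lborel"
    by (rule scaled_adj_L2(1)[OF k eps_pos], rule scaled_adj_L2(1)[OF b eps_pos])
  have tv: "(\<lambda>x. v (x + \<epsilon>)) \<in> L2 lborel" by (rule translate_L2(1)[OF v])
  have AE: "AE x in lborel. complex_of_real (d (x / \<epsilon>)) * (scaled_adj \<epsilon> k (x + \<epsilon>) - scaled_adj \<epsilon> k x) = scaled_adj \<epsilon> b x"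
    using scaled_adj_add[OF band_cis[OF k, of 1] k eps_pos, of "-1"]
  proof eventually_elim
    case (elim x)
    have "scaled_adj \<epsilon> b x = d (x / \<epsilon>) * scaled_adj \<epsilon> e x"
      unfolding b_def[abs_def] by (rule scaled_adj_cmult) (simp add: d_frac)
    also have "scaled_adj \<epsilon> e x = scaled_adj \<epsilon> k (x + \<epsilon>) - scaled_adj \<epsilon> k x"
      using elim scaled_adj_shift[OF eps_pos, of k x 1] unfolding e_def[abs_def] by simp
    finally show ?case by simp
  qed
  have "l2_inner lborel (\<lambda>x. complex_of_real (d (x / \<epsilon>)) * (scaled_adj \<epsilon> k (x + \<epsilon>) - scaled_adj \<epsilon> k x)) (\<lambda>x. v (x + \<epsilon>) - v x) =
      l2_inner lborel (scaled_adj \<epsilon> b) (\<lambda>x. v (x + \<epsilon>) - v x)"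
    by (rule l2_inner_AE_cong[OF L2_measurable[OF form_eps_eq(2)[OF uL2 v]] L2_measurable[OF bL2]
          L2_measurable[OF form_eps_eq(3)[OF uL2 v]] L2_measurable[OF form_eps_eq(3)[OF uL2 v]] AE]) simp
  also have "\<dots> = l2_inner lborel (scaled_adj \<epsilon> b) (\<lambda>x. v (x + \<epsilon>)) - l2_inner lborel (scaled_adj \<epsilon> b) v"
    by (rule l2_inner_diff_right[OF tv v bL2])
  \<comment> \<open>Discrete integration by parts: the substitution x - \<open>\<epsilon>\<close>
    moves the shift off \<open>v\<close>, where it acts on the symbol as \<open>cis\<close> of the
    negative quasimomentum.\<close>
  also have "l2_inner lborel (scaled_adj \<epsilon> b) (\<lambda>x. v (x + \<epsilon>)) = l2_inner lborel (scaled_adj \<epsilon> b') v"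
  proof -
    have "l2_inner lborel (scaled_adj \<epsilon> b) (\<lambda>x. v (x + \<epsilon>)) = (LINT x|lborel. scaled_adj \<epsilon> b (- \<epsilon> + 1 * x) * cnj (v (- \<epsilon> + 1 * x + \<epsilon>)))"
      unfolding l2_inner_def by (subst lborel_integral_real_affine[of 1 _ "- \<epsilon>"]) simp_all
    also have "\<dots> = l2_inner lborel (scaled_adj \<epsilon> b') v"
      unfolding l2_inner_def
    proof (rule Bochner_Integration.integral_cong[OF refl])
      fix x
      have "scaled_adj \<epsilon> b (- \<epsilon> + 1 * x) = scaled_adj \<epsilon> b' x"
        using scaled_adj_shift[OF eps_pos, of b x "-1"] by (simp add: b'_def[abs_def])
      then show "scaled_adj \<epsilon> b (- \<epsilon> + 1 * x) * cnj (v (- \<epsilon> + 1 * x + \<epsilon>)) = scaled_adj \<epsilon> b' x * cnj (v x)" by simp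
    qed
    finally show ?thesis .
  qed
  also have "l2_inner lborel (scaled_adj \<epsilon> b') v - l2_inner lborel (scaled_adj \<epsilon> b) v = l2_inner lborel (scaled_adj \<epsilon> c) v"
    unfolding c_def[abs_def] using scaled_adj_inner_add[OF b' b eps_pos v, of "-1"] by simp
  finally have main: "form_eps D \<epsilon> (scaled_adj \<epsilon> k) v = l2_inner lborel (scaled_adj \<epsilon> k) v + of_real (1 / \<epsilon>\<^sup>2) * l2_inner lborel (scaled_adj \<epsilon> c) v"
    unfolding form_eps_eq(1)[OF uL2 v] by (simp only: add.commute)
  have "k p + of_real (1 / \<epsilon>\<^sup>2) * c p = k0 p" for p
  proof -
    have "c p = complex_of_real (d (snd p)) * ((cis (- fst p) - 1) * (cis (fst p) - 1)) * k p"
      by (simp add: c_def b'_def b_def e_def algebra_simps)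
    then have "k p + of_real (1 / \<epsilon>\<^sup>2) * c p = (1 + of_real (1 / \<epsilon>\<^sup>2) * (of_real (d (snd p)) * of_real (2 - 2 * cos (fst p)))) * k p"
      unfolding difference_quotient_symbol by (simp only: distrib_right mult_1 mult.assoc)
    also have "(1 + of_real (1 / \<epsilon>\<^sup>2) * (of_real (d (snd p)) * of_real (2 - 2 * cos (fst p)))) =
        complex_of_real (1 + d (snd p) * (2 - 2 * cos (fst p)) / \<epsilon>\<^sup>2)"
      by simp
    also have "\<dots> * k p = complex_of_real ((1 + d (snd p) * (2 - 2 * cos (fst p)) / \<epsilon>\<^sup>2) * eps_symbol p) * k0 p"
      by (simp only: k_def of_real_mult mult.assoc)
    also have "(1 + d (snd p) * (2 - 2 * cos (fst p)) / \<epsilon>\<^sup>2) * eps_symbol p = 1"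
      using eps_symbol_denominator_pos[of p] unfolding eps_symbol_def by simp
    finally show ?thesis by simp
  qed
  then have "(\<lambda>p. k p + of_real (1 / \<epsilon>\<^sup>2) * c p) = k0" by (rule ext)
  then show ?thesis
    using main scaled_adj_inner_add[OF k c eps_pos v, of "of_real (1 / \<epsilon>\<^sup>2)"] unfolding k_def[abs_def] by simp
qed

text \<open>The difference of the solutions is itself an admissible test function. The coefficient
  is positive, so the form dominates the squared norm of the difference and forces it to
  vanish.\<close>

lemma op_eps_unique:
  assumes "(u, F) \<in> op_eps D \<epsilon>" "(u', F) \<in> op_eps D \<epsilon>"
  shows "AE x in lborel. u x = u' x"
proof -
  have u: "u \<in> L2 lborel" "u' \<in> L2 lborel"
    and eq: "\<And>v. v \<in> L2 lborel \<Longrightarrow> form_eps D \<epsilon> u v = form_eps D \<epsilon> u' v"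
    using assms by (auto simp: op_eps_def form_op_def)
  define w where "w x = u x - u' x" for x
  have w: "w \<in> L2 lborel" unfolding w_def[abs_def] by (rule L2_diff[OF u])
  let ?T = "\<lambda>u x. complex_of_real (d (x / \<epsilon>)) * (u (x + \<epsilon>) - u x)" and ?d = "\<lambda>x. w (x + \<epsilon>) - w x"
  have "l2_inner lborel (?T u) ?d - l2_inner lborel (?T u') ?d = l2_inner lborel (\<lambda>x. ?T u x - ?T u' x) ?d"
    by (rule l2_inner_diff_left[OF form_eps_eq(2)[OF u(1) w] form_eps_eq(2)[OF u(2) w] form_eps_eq(3)[OF w w], symmetric])
  also have "\<dots> = (LINT x|lborel. complex_of_real (d (x / \<epsilon>) * (cmod (?d x))\<^sup>2))"
    unfolding l2_inner_def
  proof (rule Bochner_Integration.integral_cong[OF refl])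
    fix x
    have "?T u x - ?T u' x = of_real (d (x / \<epsilon>)) * ?d x" by (simp add: w_def algebra_simps)
    then show "(?T u x - ?T u' x) * cnj (?d x) = complex_of_real (d (x / \<epsilon>) * (cmod (?d x))\<^sup>2)"
      by (simp only: of_real_mult complex_norm_square mult.assoc)
  qed
  finally have 1: "l2_inner lborel (?T u) ?d - l2_inner lborel (?T u') ?d = of_real (LINT x|lborel. d (x / \<epsilon>) * (cmod (?d x))\<^sup>2)"
    unfolding integral_complex_of_real .
  have 2: "l2_inner lborel u w - l2_inner lborel u' w = of_real ((l2_norm lborel w)\<^sup>2)"
    unfolding l2_inner_self[symmetric] l2_inner_diff_left[OF u w, symmetric] w_def[symmetric] ..
  have "0 = form_eps D \<epsilon> u w - form_eps D \<epsilon> u' w" using eq[OF w] by simp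
  also have "\<dots> = of_real (1 / \<epsilon>\<^sup>2) * (l2_inner lborel (?T u) ?d - l2_inner lborel (?T u') ?d) + (l2_inner lborel u w - l2_inner lborel u' w)"
    unfolding form_eps_eq(1)[OF u(1) w] form_eps_eq(1)[OF u(2) w] by (simp only: right_diff_distrib add_diff_add)
  also have "\<dots> = of_real (1 / \<epsilon>\<^sup>2 * (LINT x|lborel. d (x / \<epsilon>) * (cmod (?d x))\<^sup>2) + (l2_norm lborel w)\<^sup>2)"
    unfolding 1 2 by simp
  finally have "0 = complex_of_real (1 / \<epsilon>\<^sup>2 * (LINT x|lborel. d (x / \<epsilon>) * (cmod (?d x))\<^sup>2) + (l2_norm lborel w)\<^sup>2)" .
  from of_real_eq_0_iff[THEN iffD1, OF this[symmetric]]
  have 0: "1 / \<epsilon>\<^sup>2 * (LINT x|lborel. d (x / \<epsilon>) * (cmod (?d x))\<^sup>2) + (l2_norm lborel w)\<^sup>2 = 0" .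
  have "0 \<le> 1 / \<epsilon>\<^sup>2 * (LINT x|lborel. d (x / \<epsilon>) * (cmod (?d x))\<^sup>2)"
    using d_pos by (intro mult_nonneg_nonneg Bochner_Integration.integral_nonneg) (auto intro: less_imp_le)
  with 0 have "(l2_norm lborel w)\<^sup>2 = 0" using zero_le_power2[of "l2_norm lborel w"] by linarith
  then have "AE x in lborel. w x = 0" using l2_norm_zero_iff[OF w] by simp
  then show ?thesis by eventually_elim (simp add: w_def)
qed

end

context fibre_problem
begin

section \<open>The differential form on the strip and its solution\<close>

lemma weak_dx_is_weak: "u \<in> H1 \<Longrightarrow> is_weak_dx u (weak_dx u)"
  unfolding H1_def weak_dx_def using someI_ex[of "is_weak_dx u"] by blast

lemma H1_L2: "u \<in> H1 \<Longrightarrow> u \<in> L2 strip_M"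
  by (simp add: H1_def)

lemma weak_L2: "is_weak_dx u w \<Longrightarrow> w \<in> L2 strip_M"
  by (simp add: is_weak_dx_def)

text \<open>Uniqueness of weak derivatives allows any of them in place of the chosen
  \<open>weak_dx\<close>, and the coefficient becomes its Borel representative. The integral then
  lives on the uncompleted measure.\<close>

lemma form_hom_eq:
  assumes u: "u \<in> H1" "is_weak_dx u u'" and v: "v \<in> H1" "is_weak_dx v v'"
  shows "form_hom D u v = l2_inner strip_M (\<lambda>p. complex_of_real (d (snd p)) * u' p) v' + l2_inner strip_M u v"
proof -
  have "(LINT z|completion strip_M. of_real (D (snd z)) * weak_dx u z * cnj (weak_dx v z)) =
      (LINT z|strip_M. of_real (d (snd z)) * u' z * cnj (v' z))"
  proof (rule integral_completion_AE)
    show "(\<lambda>z. complex_of_real (d (snd z)) * u' z * cnj (v' z)) \<in> borel_measurable strip_M"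
      using integrable_L2_cnj[OF L2_d[OF weak_L2[OF u(2)]] weak_L2[OF v(2)]] by (rule borel_measurable_integrable)
    show "AE z in strip_M. complex_of_real (D (snd z)) * weak_dx u z * cnj (weak_dx v z) = of_real (d (snd z)) * u' z * cnj (v' z)"
      using AE_D_strip is_weak_dx_unique[OF H1_L2[OF u(1)] weak_dx_is_weak[OF u(1)] u(2)]
        is_weak_dx_unique[OF H1_L2[OF v(1)] weak_dx_is_weak[OF v(1)] v(2)]
      by eventually_elim simp
  qed
  then show ?thesis unfolding form_hom_def l2_inner_def by simp
qed

lemma ift_dil_H1:
  assumes "k \<in> band"
  shows "is_weak_dx (ift (dil \<epsilon> k)) (ift (\<lambda>p. \<i> * complex_of_real (fst p) * dil \<epsilon> k p))" "ift (dil \<epsilon> k) \<in> H1"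
proof -
  show w: "is_weak_dx (ift (dil \<epsilon> k)) (ift (\<lambda>p. \<i> * complex_of_real (fst p) * dil \<epsilon> k p))"
    by (rule is_weak_dx_ift[OF dil_band(1)[OF assms eps_pos] dil_support[OF assms eps_pos]])
  show "ift (dil \<epsilon> k) \<in> H1"
    using w ift_L2(1)[OF dil_band(2,1)[OF assms eps_pos]] unfolding H1_def by blast
qed

text \<open>On the frequency side the flux d times the x-derivative is \<open>q1\<close>. The
  adjoint formula moves the remaining derivative from \<open>v\<close> onto it, so that the form
  becomes a single pairing of \<open>v\<close> with an inverse transform.\<close>

lemma form_hom_ift:
  assumes k0: "k0 \<in> band" and v: "v \<in> H1"
  shows "form_hom D (ift (dil \<epsilon> (\<lambda>p. complex_of_real (hom_symbol p) * k0 p))) v = l2_inner strip_M (ift (dil \<epsilon> k0)) v"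
proof -
  define k where "k p = complex_of_real (hom_symbol p) * k0 p" for p
  have k: "k \<in> band" unfolding k_def[abs_def] by (rule band_hom_symbol[OF k0])
  define \<kappa> where "\<kappa> = dil \<epsilon> k"
  have \<kappa>: "\<kappa> \<in> L2 strip_M" "integrable strip_M \<kappa>" and \<kappa>0: "\<And>\<xi> y. \<bar>\<xi>\<bar> > pi / \<epsilon> \<Longrightarrow> \<kappa> (\<xi>, y) = 0"
    unfolding \<kappa>_def by (rule dil_band[OF k eps_pos])+ (rule dil_support[OF k eps_pos])
  define q where "q p = complex_of_real (d (snd p)) * \<kappa> p" for p
  have q: "q \<in> L2 strip_M" unfolding q_def[abs_def] by (rule L2_d[OF \<kappa>(1)])
  have q0: "q (\<xi>, y) = 0" if "\<bar>\<xi>\<bar> > pi / \<epsilon>" for \<xi> y using \<kappa>0[OF that] by (simp add: q_def)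
  define q1 where "q1 p = \<i> * complex_of_real (fst p) * q p" for p
  have q1: "q1 \<in> L2 strip_M" unfolding q1_def[abs_def] by (rule L2_freq_mult[OF q q0])
  have q10: "q1 (\<xi>, y) = 0" if "\<bar>\<xi>\<bar> > pi / \<epsilon>" for \<xi> y using q0[OF that] by (simp add: q1_def)
  define q2 where "q2 p = \<i> * complex_of_real (fst p) * q1 p" for p
  have q2: "q2 \<in> L2 strip_M" unfolding q2_def[abs_def] by (rule L2_freq_mult[OF q1 q10])
  have q20: "q2 (\<xi>, y) = 0" if "\<bar>\<xi>\<bar> > pi / \<epsilon>" for \<xi> y using q10[OF that] by (simp add: q2_def)
  have q2i: "integrable strip_M q2" by (rule integrable_bounded_support[OF q2 q20])
  \<comment> \<open>The coefficient depends on \<open>y\<close> only and commutes with a transform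
    in \<open>x\<close>.\<close>
  have dq: "(\<lambda>p. complex_of_real (d (snd p)) * ift (\<lambda>p. \<i> * complex_of_real (fst p) * \<kappa> p) p) = ift q1"
  proof
    fix p :: "real \<times> real"
    have "q1 = (\<lambda>p. complex_of_real (d (snd p)) * (\<i> * complex_of_real (fst p) * \<kappa> p))"
      by (auto simp: q1_def q_def fun_eq_iff)
    then show "complex_of_real (d (snd p)) * ift (\<lambda>p. \<i> * complex_of_real (fst p) * \<kappa> p) p = ift q1 p"
      using ift_cmult[of "\<lambda>y. complex_of_real (d y)" "\<lambda>p. \<i> * complex_of_real (fst p) * \<kappa> p" "fst p" "snd p"] by simp
  qed
  have "form_hom D (ift \<kappa>) v = l2_inner strip_M (ift q1) (weak_dx v) + l2_inner strip_M (ift \<kappa>) v"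
    using form_hom_eq[OF ift_dil_H1(2,1)[OF k] v weak_dx_is_weak[OF v]] unfolding \<kappa>_def[symmetric] dq .
  also have "l2_inner strip_M (ift q1) (weak_dx v) = - l2_inner strip_M (ift q2) v"
    using weak_dx_ift_adjoint[where R = "pi / \<epsilon>", OF H1_L2[OF v] weak_dx_is_weak[OF v] q1 q10] unfolding q2_def[abs_def] .
  also have "- l2_inner strip_M (ift q2) v + l2_inner strip_M (ift \<kappa>) v = l2_inner strip_M (ift (\<lambda>p. \<kappa> p + (-1) * q2 p)) v"
    unfolding ift_inner_add[OF \<kappa>(2,1) q2i q2 H1_L2[OF v]] by simp
  \<comment> \<open>The two factors i \<open>\<xi>\<close> multiply to - \<open>\<xi>\<close>^2, so
    the combination is (1 + d \<open>\<xi>\<close>^2) \<open>\<kappa>\<close>. At the dilated point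
    the bracket is the reciprocal of \<open>hom_symbol\<close>.\<close>
  also have "(\<lambda>p. \<kappa> p + (-1) * q2 p) = dil \<epsilon> k0"
  proof
    fix p :: "real \<times> real"
    let ?s = "(\<epsilon> * fst p, snd p)"
    have "\<kappa> p + (-1) * q2 p = complex_of_real (1 + d (snd p) * (fst p)\<^sup>2) * \<kappa> p"
      by (simp add: q2_def q1_def q_def algebra_simps power2_eq_square)
    also have "1 + d (snd p) * (fst p)\<^sup>2 = 1 + d (snd ?s) * (fst ?s)\<^sup>2 / \<epsilon>\<^sup>2"
      using eps_pos by (simp add: power_mult_distrib)
    also have "complex_of_real \<dots> * \<kappa> p = of_real (sqrt \<epsilon>) * (complex_of_real ((1 + d (snd ?s) * (fst ?s)\<^sup>2 / \<epsilon>\<^sup>2) * hom_symbol ?s) * k0 ?s)"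
      unfolding \<kappa>_def dil_def k_def of_real_mult by (simp only: mult_ac)
    also have "(1 + d (snd ?s) * (fst ?s)\<^sup>2 / \<epsilon>\<^sup>2) * hom_symbol ?s = 1"
      using hom_symbol_denominator_pos[of ?s] unfolding hom_symbol_def by simp
    finally show "\<kappa> p + (-1) * q2 p = dil \<epsilon> k0 p" by (simp add: dil_def)
  qed
  finally show ?thesis unfolding \<kappa>_def k_def[abs_def] .
qed

text \<open>Coercivity once more: tested with v = z - z', which has the weak derivative
  \<open>v'\<close>, the form is a nonnegative energy plus the squared norm of
  \<open>v\<close>.\<close>

lemma op_hom_unique:
  assumes "(z, w) \<in> op_hom D" "(z', w') \<in> op_hom D" "AE p in strip_M. w p = w' p"
  shows "AE p in strip_M. z p = z' p"
proof -
  have z: "z \<in> H1" "z' \<in> H1" and w: "w \<in> L2 strip_M" "w' \<in> L2 strip_M"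
    and eq: "\<And>v. v \<in> H1 \<Longrightarrow> form_hom D z v = l2_inner strip_M w v" "\<And>v. v \<in> H1 \<Longrightarrow> form_hom D z' v = l2_inner strip_M w' v"
    using assms by (auto simp: op_hom_def form_op_def)
  define v where "v p = z p - z' p" for p
  define v' where "v' p = weak_dx z p - weak_dx z' p" for p
  have wk: "is_weak_dx z (weak_dx z)" "is_weak_dx z' (weak_dx z')" using z by (auto intro: weak_dx_is_weak)
  have v': "is_weak_dx v v'"
    unfolding v_def[abs_def] v'_def[abs_def] by (rule is_weak_dx_diff[OF H1_L2[OF z(1)] H1_L2[OF z(2)] wk])
  have vL2: "v \<in> L2 strip_M" unfolding v_def[abs_def] by (rule L2_diff[OF H1_L2[OF z(1)] H1_L2[OF z(2)]])
  have v: "v \<in> H1" using vL2 v' unfolding H1_def by blast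
  let ?T = "\<lambda>u p. complex_of_real (d (snd p)) * weak_dx u p"
  have "l2_inner strip_M (?T z) v' - l2_inner strip_M (?T z') v' = l2_inner strip_M (\<lambda>p. ?T z p - ?T z' p) v'"
    by (rule l2_inner_diff_left[OF L2_d[OF weak_L2[OF wk(1)]] L2_d[OF weak_L2[OF wk(2)]] weak_L2[OF v'], symmetric])
  also have "\<dots> = (LINT p|strip_M. complex_of_real (d (snd p) * (cmod (v' p))\<^sup>2))"
    unfolding l2_inner_def
  proof (rule Bochner_Integration.integral_cong[OF refl])
    fix p
    have "?T z p - ?T z' p = of_real (d (snd p)) * v' p" by (simp add: v'_def right_diff_distrib)
    then show "(?T z p - ?T z' p) * cnj (v' p) = complex_of_real (d (snd p) * (cmod (v' p))\<^sup>2)"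
      by (simp only: of_real_mult complex_norm_square mult.assoc)
  qed
  finally have 1: "l2_inner strip_M (?T z) v' - l2_inner strip_M (?T z') v' = of_real (LINT p|strip_M. d (snd p) * (cmod (v' p))\<^sup>2)"
    unfolding integral_complex_of_real .
  have 2: "l2_inner strip_M z v - l2_inner strip_M z' v = of_real ((l2_norm strip_M v)\<^sup>2)"
    unfolding l2_inner_self[symmetric] l2_inner_diff_left[OF H1_L2[OF z(1)] H1_L2[OF z(2)] vL2, symmetric] v_def[symmetric] ..
  have "l2_inner strip_M w v = l2_inner strip_M w' v"
    by (rule l2_inner_AE_cong[OF w[THEN L2_measurable] vL2[THEN L2_measurable] vL2[THEN L2_measurable] assms(3)]) simp
  then have "0 = form_hom D z v - form_hom D z' v" using eq[OF v] by simp
  also have "\<dots> = (l2_inner strip_M (?T z) v' - l2_inner strip_M (?T z') v') + (l2_inner strip_M z v - l2_inner strip_M z' v)"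
    unfolding form_hom_eq[OF z(1) wk(1) v v'] form_hom_eq[OF z(2) wk(2) v v'] by (simp only: add_diff_add)
  also have "\<dots> = of_real ((LINT p|strip_M. d (snd p) * (cmod (v' p))\<^sup>2) + (l2_norm strip_M v)\<^sup>2)"
    unfolding 1 2 by simp
  finally have "0 = complex_of_real ((LINT p|strip_M. d (snd p) * (cmod (v' p))\<^sup>2) + (l2_norm strip_M v)\<^sup>2)" .
  from of_real_eq_0_iff[THEN iffD1, OF this[symmetric]]
  have 0: "(LINT p|strip_M. d (snd p) * (cmod (v' p))\<^sup>2) + (l2_norm strip_M v)\<^sup>2 = 0" .
  have "0 \<le> (LINT p|strip_M. d (snd p) * (cmod (v' p))\<^sup>2)"
    using d_pos by (intro Bochner_Integration.integral_nonneg) (simp add: less_imp_le[OF d_pos])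
  with 0 have "(l2_norm strip_M v)\<^sup>2 = 0" using zero_le_power2[of "l2_norm strip_M v"] by linarith
  then have "AE p in strip_M. v p = 0" using l2_norm_zero_iff[OF vL2] by simp
  then show ?thesis by eventually_elim (simp add: v_def)
qed

text \<open>
  In the Gelfand picture both resolvents are multiplication operators, with symbols \<open>eps_symbol\<close> and
  \<open>hom_symbol\<close>, so the two solutions can be written down explicitly.
\<close>
lemma resolvents:
  assumes "(F, w) \<in> interp \<epsilon>"
  obtains k where "k \<in> band" "l2_norm strip_M k = l2_norm lborel F"
    "(scaled_adj \<epsilon> (\<lambda>p. complex_of_real (eps_symbol p) * k p), F) \<in> op_eps D \<epsilon>"
    "(ift (dil \<epsilon> (\<lambda>p. complex_of_real (hom_symbol p) * k p)), w) \<in> op_hom D"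
proof -
  obtain g where F: "F \<in> L2 lborel" and g: "(scaling \<epsilon> F, g) \<in> gelfand" and w: "w \<in> L2 strip_M"
    "AE p in strip_M. w p = ift (dil \<epsilon> (ext_zero g)) p"
    by (rule interp_facts[OF assms eps_pos])
  let ?k = "ext_zero g"
  have k: "?k \<in> band" by (rule gelfand_facts[OF g])
  have norm: "l2_norm strip_M ?k = l2_norm lborel F"
    using gelfand_facts(3)[OF g] scaling_L2(2)[OF F eps_pos] by simp
  have u: "scaled_adj \<epsilon> (\<lambda>p. complex_of_real (eps_symbol p) * ?k p) \<in> L2 lborel"
    by (rule scaled_adj_L2(1)[OF band_eps_symbol[OF k] eps_pos])
  have "form_eps D \<epsilon> (scaled_adj \<epsilon> (\<lambda>p. complex_of_real (eps_symbol p) * ?k p)) v = l2_inner lborel F v" if v: "v \<in> L2 lborel" for v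
  proof -
    have "l2_inner lborel (scaled_adj \<epsilon> ?k) v = l2_inner lborel F v"
      by (rule l2_inner_AE_cong[OF L2_measurable[OF scaled_adj_L2(1)[OF k eps_pos]] L2_measurable[OF F]
            L2_measurable[OF v] L2_measurable[OF v] scaled_adj_gelfand[OF g eps_pos]]) simp
    then show ?thesis using form_eps_scaled_adj[OF k v] by simp
  qed
  then have 1: "(scaled_adj \<epsilon> (\<lambda>p. complex_of_real (eps_symbol p) * ?k p), F) \<in> op_eps D \<epsilon>"
    using u F by (simp add: op_eps_def form_op_def)
  have "form_hom D (ift (dil \<epsilon> (\<lambda>p. complex_of_real (hom_symbol p) * ?k p))) v = l2_inner strip_M w v" if v: "v \<in> H1" for v
  proof -
    have "l2_inner strip_M w v = l2_inner strip_M (ift (dil \<epsilon> ?k)) v"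
      by (rule l2_inner_AE_cong[OF L2_measurable[OF w(1)] L2_measurable[OF ift_L2(1)[OF dil_band(2,1)[OF k eps_pos]]]
            L2_measurable[OF H1_L2[OF v]] L2_measurable[OF H1_L2[OF v]] w(2)]) simp
    then show ?thesis using form_hom_ift[OF k v] by simp
  qed
  then have 2: "(ift (dil \<epsilon> (\<lambda>p. complex_of_real (hom_symbol p) * ?k p)), w) \<in> op_hom D"
    using ift_dil_H1(2)[OF band_hom_symbol[OF k]] w(1) by (simp add: op_hom_def form_op_def)
  show ?thesis by (rule that[OF k norm 1 2])
qed

lemma symbol_bound:
  assumes "\<bar>fst p\<bar> \<le> pi"
  shows "\<bar>eps_symbol p - hom_symbol p\<bar> \<le> 3 / (4 * m) * \<epsilon>\<^sup>2"
proof -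
  have "\<bar>eps_symbol p - hom_symbol p\<bar> \<le> 3 / (4 * d (snd p)) * \<epsilon>\<^sup>2"
    unfolding eps_symbol_def hom_symbol_def
    by (rule resolvent_symbol_bound)
      (use cos_quartic_bound[of "fst p"] cos_lower_bound[OF assms] d_pos eps_pos in \<open>auto simp flip: power_mult\<close>)
  also have "\<dots> \<le> 3 / (4 * m) * \<epsilon>\<^sup>2"
    using d_lower[of "snd p"] m_pos by (intro mult_right_mono divide_left_mono) auto
  finally show ?thesis .
qed

text \<open>Whatever representatives the relations return, uniqueness identifies \<open>g\<close>
  and \<open>h\<close> almost everywhere with transforms of the two symbols times the same
  \<open>k\<close>. As \<open>scaled_adj\<close> is a contraction, the supremum of the symbol
  difference over [-pi, pi] bounds the result.\<close>

lemma resolvent_difference: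
  assumes gF: "(g, F) \<in> op_eps D \<epsilon>" and Fh: "(F, h) \<in> interp \<epsilon> O (op_hom D)\<inverse> O interp_adj \<epsilon>"
  shows "l2_norm lborel (\<lambda>x. g x - h x) \<le> 3 / (4 * m) * \<epsilon>\<^sup>2 * l2_norm lborel F"
proof -
  obtain w z where w: "(F, w) \<in> interp \<epsilon>" and z: "(z, w) \<in> op_hom D" and h: "(z, h) \<in> interp_adj \<epsilon>"
    using Fh by auto
  obtain k where k: "k \<in> band" "l2_norm strip_M k = l2_norm lborel F"
    "(scaled_adj \<epsilon> (\<lambda>p. complex_of_real (eps_symbol p) * k p), F) \<in> op_eps D \<epsilon>"
    "(ift (dil \<epsilon> (\<lambda>p. complex_of_real (hom_symbol p) * k p)), w) \<in> op_hom D"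
    by (rule resolvents[OF w])
  let ?u = "\<lambda>p. complex_of_real (eps_symbol p) * k p" and ?s = "\<lambda>p. complex_of_real (hom_symbol p) * k p"
  have u: "?u \<in> band" and s: "?s \<in> band" by (rule band_eps_symbol[OF k(1)], rule band_hom_symbol[OF k(1)])
  have L2: "g \<in> L2 lborel" "h \<in> L2 lborel"
    using gF h by (auto simp: op_eps_def form_op_def interp_adj_def l2_adjoint_def)
  have AEg: "AE x in lborel. g x = scaled_adj \<epsilon> ?u x" by (rule op_eps_unique[OF gF k(3)])
  have "AE p in strip_M. z p = ift (dil \<epsilon> ?s) p" by (rule op_hom_unique[OF z k(4)]) simp
  then have AEh: "AE x in lborel. h x = scaled_adj \<epsilon> ?s x"
    by (rule interp_adj_unique[OF h interp_adj_ift[OF s eps_pos] _ eps_pos])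
  have d: "(\<lambda>p. ?u p + (-1) * ?s p) \<in> band" by (rule band_add[OF u s])
  have "l2_norm lborel (\<lambda>x. g x - h x) = l2_norm lborel (scaled_adj \<epsilon> (\<lambda>p. ?u p + (-1) * ?s p))"
  proof (rule l2_norm_AE_cong[OF L2_measurable[OF L2_diff[OF L2]] L2_measurable[OF scaled_adj_L2(1)[OF d eps_pos]]])
    show "AE x in lborel. g x - h x = scaled_adj \<epsilon> (\<lambda>p. ?u p + (-1) * ?s p) x"
      using AEg AEh scaled_adj_add[OF u s eps_pos, of "-1"] by eventually_elim simp
  qed
  also have "\<dots> \<le> l2_norm strip_M (\<lambda>p. ?u p + (-1) * ?s p)" by (rule scaled_adj_L2(2)[OF d eps_pos])
  also have "\<dots> \<le> 3 / (4 * m) * \<epsilon>\<^sup>2 * l2_norm strip_M k"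
  proof (rule l2_norm_bound[OF L2_measurable[OF band_L2[OF d]] band_L2[OF k(1)]])
    show "AE p in strip_M. cmod (?u p + (-1) * ?s p) \<le> 3 / (4 * m) * \<epsilon>\<^sup>2 * cmod (k p)"
    proof (rule AE_I2)
      fix p :: "real \<times> real"
      have eq: "?u p + (-1) * ?s p = of_real (eps_symbol p - hom_symbol p) * k p" by (simp add: left_diff_distrib)
      show "cmod (?u p + (-1) * ?s p) \<le> 3 / (4 * m) * \<epsilon>\<^sup>2 * cmod (k p)"
      proof (cases "\<bar>fst p\<bar> \<le> pi")
        case True
        then show ?thesis
          unfolding eq norm_mult norm_of_real using symbol_bound by (intro mult_right_mono) auto
      next
        case False
        then have "k p = 0" using band_zero[OF k(1), of "fst p" "snd p"] by simp
        then show ?thesis by simp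
      qed
    qed
  qed (use m_pos in simp)
  finally show ?thesis unfolding k(2) .
qed

text \<open>\<open>l2_opnorm\<close> is infinite unless the relation is defined on all of L2, so
  both resolvents and the adjoint must be shown to reach every \<open>F\<close>. The explicit
  solutions provide this.\<close>

lemma resolvent_difference_domain:
  assumes F: "F \<in> L2 lborel"
  shows "F \<in> Domain (op_diff ((op_eps D \<epsilon>)\<inverse>) (interp \<epsilon> O (op_hom D)\<inverse> O interp_adj \<epsilon>))"
proof -
  obtain w where w: "(F, w) \<in> interp \<epsilon>" by (rule interp_exists[OF F eps_pos])
  obtain k where k: "k \<in> band" "l2_norm strip_M k = l2_norm lborel F"
    "(scaled_adj \<epsilon> (\<lambda>p. complex_of_real (eps_symbol p) * k p), F) \<in> op_eps D \<epsilon>"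
    "(ift (dil \<epsilon> (\<lambda>p. complex_of_real (hom_symbol p) * k p)), w) \<in> op_hom D"
    by (rule resolvents[OF w])
  have "(F, scaled_adj \<epsilon> (\<lambda>p. complex_of_real (hom_symbol p) * k p)) \<in> interp \<epsilon> O (op_hom D)\<inverse> O interp_adj \<epsilon>"
    using w k(4) interp_adj_ift[OF band_hom_symbol[OF k(1)] eps_pos] by blast
  then show ?thesis using k(3) unfolding op_diff_def by blast
qed

theorem resolvent_difference_opnorm:
  "l2_opnorm lborel lborel (op_diff ((op_eps D \<epsilon>)\<inverse>) (interp \<epsilon> O (op_hom D)\<inverse> O interp_adj \<epsilon>))
    \<le> ennreal (3 / (4 * m) * \<epsilon>\<^sup>2)"
proof -
  let ?S = "interp \<epsilon> O (op_hom D)\<inverse> O interp_adj \<epsilon>"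
  let ?T = "op_diff ((op_eps D \<epsilon>)\<inverse>) ?S"
  have T: "\<exists>g h. (g, F) \<in> op_eps D \<epsilon> \<and> (F, h) \<in> ?S \<and> e = (\<lambda>x. g x - h x)" if "(F, e) \<in> ?T" for F e
    using that unfolding op_diff_def by auto
  have L2: "F \<in> L2 lborel \<and> e \<in> L2 lborel" if Fe: "(F, e) \<in> ?T" for F e
  proof -
    obtain g h where gh: "(g, F) \<in> op_eps D \<epsilon>" "(F, h) \<in> ?S" "e = (\<lambda>x. g x - h x)" using T[OF Fe] by blast
    have "g \<in> L2 lborel" "F \<in> L2 lborel" using gh(1) by (auto simp: op_eps_def form_op_def)
    moreover have "h \<in> L2 lborel" using gh(2) by (auto simp: interp_adj_def l2_adjoint_def)
    ultimately show ?thesis unfolding gh(3) by (simp add: L2_diff)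
  qed
  have "Domain ?T = L2 lborel" using L2 resolvent_difference_domain by blast
  moreover have "Range ?T \<subseteq> L2 lborel" using L2 by blast
  ultimately have "l2_opnorm lborel lborel ?T = (SUP (F, e) \<in> {(F, e) \<in> ?T. l2_norm lborel F \<le> 1}. ennreal (l2_norm lborel e))"
    unfolding l2_opnorm_def by simp
  also have "\<dots> \<le> ennreal (3 / (4 * m) * \<epsilon>\<^sup>2)"
  proof (rule SUP_least, clarify)
    fix F e assume Fe: "(F, e) \<in> ?T" and F1: "l2_norm lborel F \<le> 1"
    obtain g h where gh: "(g, F) \<in> op_eps D \<epsilon>" "(F, h) \<in> ?S" "e = (\<lambda>x. g x - h x)" using T[OF Fe] by blast
    have "l2_norm lborel e \<le> 3 / (4 * m) * \<epsilon>\<^sup>2 * l2_norm lborel F"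
      unfolding gh(3) by (rule resolvent_difference[OF gh(1,2)])
    also have "\<dots> \<le> 3 / (4 * m) * \<epsilon>\<^sup>2 * 1" using F1 m_pos by (intro mult_left_mono) auto
    finally show "ennreal (l2_norm lborel e) \<le> ennreal (3 / (4 * m) * \<epsilon>\<^sup>2)" by (intro ennreal_leI) simp
  qed
  finally show ?thesis .
qed

end

theorem theorem7p31:
  fixes D :: "real \<Rightarrow> real" and m :: real
  assumes "D \<in> borel_measurable lebesgue"
    and "\<exists>K. AE y in lebesgue. \<bar>D y\<bar> \<le> K"
    and "\<And>y. D (y + 1) = D y"
    and "m > 0"
    and "\<And>y. D y \<ge> m"
  shows "\<exists>C>0. \<forall>\<epsilon>. 0 < \<epsilon> \<and> \<epsilon> < 1 \<longrightarrow>
    l2_opnorm lborel lborel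
      (op_diff ((op_eps D \<epsilon>)\<inverse>) (interp \<epsilon> O (op_hom D)\<inverse> O interp_adj \<epsilon>))
    \<le> ennreal (C * \<epsilon>)"
proof -
  obtain d K where d: "d \<in> borel_measurable borel" "\<And>y. m \<le> d y" "\<And>y. d y \<le> K" "\<And>y. d (frac y) = d y"
    "AE y in lborel. D y = d y"
    by (rule periodic_borel_representative[OF assms(1,2,3,5)]) blast+
  show ?thesis
  proof (intro exI[of _ "3 / (4 * m)"] conjI allI impI)
    show "0 < 3 / (4 * m)" using assms(4) by simp
    fix \<epsilon> :: real assume \<epsilon>: "0 < \<epsilon> \<and> \<epsilon> < 1"
    interpret fibre_problem D d m K \<epsilon>
      using d assms(4) \<epsilon> by unfold_locales auto
    \<comment> \<open>The quadratic rate is weakened to the linear one for \<open>\<epsilon>\<close>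
      below 1; the constant depends on the lower bound \<open>m\<close> alone.\<close>
    have "\<epsilon>\<^sup>2 \<le> \<epsilon>" using \<epsilon> by (simp add: power2_eq_square mult_left_le)
    then have "3 / (4 * m) * \<epsilon>\<^sup>2 \<le> 3 / (4 * m) * \<epsilon>" using assms(4) by (intro mult_left_mono) auto
    then show "l2_opnorm lborel lborel (op_diff ((op_eps D \<epsilon>)\<inverse>) (interp \<epsilon> O (op_hom D)\<inverse> O interp_adj \<epsilon>))
        \<le> ennreal (3 / (4 * m) * \<epsilon>)"
      by (intro order_trans[OF resolvent_difference_opnorm] ennreal_leI)
  qed
qed

end
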